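(* Let $d=p_1^{\alpha_1}\cdots p_r^{\alpha_r}$, where $p_1<p_2<\cdots<p_r$ are primes, $\alpha_i>0$ for all $i$, and $r\ge 2$. Let $e\in K$ be a primitive $d$-th root of $1$, let $2\le a\le d-1$, and let $I_a\subset K[x,y,z]$ be the ideal generated by all homogeneous polynomials of degree $d$ invariant under the action of $M_a=\begin{pmatrix}1&0&0\\0&e&0\\0&0&e^a\end{pmatrix}$. Then $I_a$ is a monomial minimal GT-system and $\mu(I_a)\ge \lfloor d/2\rfloor+3$.
   Context: $K$ is an algebraically closed field of characteristic zero and $R=K[x,y,z]$. $M_a$ acts by $x\mapsto x$, $y\mapsto ey$, $z\mapsto e^a z$. $\mu(I)$ is the minimal number of generators of $I$. A homogeneous artinian ideal $I\subset R$ generated by $r'\le d+1$ forms of degree $d$ is a Togliatti system if for every linear form $L$ the map $\times L:(R/I)_{d-1}\to(R/I)_d$ does not have maximal rank. It is a monomial Togliatti system if generated by monomials; a monomial Togliatti system is minimal if no proper subset of its set of minimal monomial generators generates a monomial Togliatti system. A GT-system is a Togliatti system generated by all forms of degree $d$ invariant under a diagonal representation of $\mathbb{Z}/d\mathbb{Z}$, whose associated morphism from $\mathbb{P}^2$ (given by a minimal set of generators) is a Galois covering of its image with cyclic Galois group $\mathbb{Z}/d\mathbb{Z}$. *)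

theory Defs
  imports
    "HOL-Analysis.Analysis"
    "HOL-Algebra.Elementary_Groups"
    "HOL-Algebra.Bij"
    "HOL-Library.Poly_Mapping"
    "HOL-Computational_Algebra.Polynomial"
    "HOL-Computational_Algebra.Fraction_Field"
begin

definition primitive_root_of_unity :: "nat \<Rightarrow> 'a::field \<Rightarrow> bool" where
  "primitive_root_of_unity d e \<longleftrightarrow> d > 0 \<and> e ^ d = 1 \<and> (\<forall>k. 0 < k \<and> k < d \<longrightarrow> e ^ k \<noteq> 1)"


section \<open>The polynomial ring in three variables\<close>

text \<open>
  A polynomial maps exponent vectors to coefficients. The variables are indexed by the
  three-element type \<^typ>\<open>3\<close>; the indices 1, 2, 3 stand for \<open>x\<close>, \<open>y\<close>, \<open>z\<close>
  (and \<open>3 = 0\<close> in this type).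
\<close>

type_synonym 'a poly3 = "(3 \<Rightarrow>\<^sub>0 nat) \<Rightarrow>\<^sub>0 'a"

definition const :: "'a::field \<Rightarrow> 'a poly3" where
  "const c = Poly_Mapping.single 0 c"

definition var :: "3 \<Rightarrow> 'a::field poly3" where
  "var i = Poly_Mapping.single (Poly_Mapping.single i 1) 1"

definition monomials :: "'a::field poly3 set" where
  "monomials = {Poly_Mapping.single m 1 | m. True}"

definition mdeg :: "(3 \<Rightarrow>\<^sub>0 nat) \<Rightarrow> nat" where
  "mdeg m = (\<Sum>i\<in>UNIV. Poly_Mapping.lookup m i)"

text \<open>The graded piece \<open>R\<^sub>d\<close>; it contains 0.\<close>

definition forms :: "nat \<Rightarrow> 'a::field poly3 set" where
  "forms d = {F. \<forall>m\<in>Poly_Mapping.keys F. mdeg m = d}"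

definition evalp :: "'a::field poly3 \<Rightarrow> (3 \<Rightarrow> 'a) \<Rightarrow> 'a" where
  "evalp F v = (\<Sum>m\<in>Poly_Mapping.keys F. Poly_Mapping.lookup F m *
      (\<Prod>i\<in>UNIV. v i ^ Poly_Mapping.lookup m i))"

text \<open>Linear substitution: the \<open>i\<close>-th variable is replaced by \<open>\<Sum>\<^sub>j M\<^sub>i\<^sub>j X\<^sub>j\<close>.\<close>

definition act :: "'a::field ^ 3 ^ 3 \<Rightarrow> 'a poly3 \<Rightarrow> 'a poly3" where
  "act M F = (\<Sum>m\<in>Poly_Mapping.keys F. const (Poly_Mapping.lookup F m) *
      (\<Prod>i\<in>UNIV. (\<Sum>j\<in>UNIV. const (M $ i $ j) * var j) ^ Poly_Mapping.lookup m i))"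

definition invariant_forms :: "nat \<Rightarrow> ('a::field ^ 3 ^ 3) set \<Rightarrow> 'a poly3 set" where
  "invariant_forms d Ms = {F \<in> forms d. \<forall>M\<in>Ms. act M F = F}"


section \<open>Ideals\<close>

text \<open>Ideals are the submodules of the ring regarded as a module over itself.\<close>

abbreviation is_ideal :: "'a::field poly3 set \<Rightarrow> bool" where
  "is_ideal \<equiv> module.subspace (*)"

abbreviation ideal_gen :: "'a::field poly3 set \<Rightarrow> 'a poly3 set" where
  "ideal_gen \<equiv> module.span (*)"

definition mu :: "'a::field poly3 set \<Rightarrow> nat" where
  "mu I = (LEAST n. \<exists>S. finite S \<and> card S = n \<and> ideal_gen S = I)"

definition minimal_generators :: "'a::field poly3 set \<Rightarrow> 'a poly3 set \<Rightarrow> bool" where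
  "minimal_generators I S \<longleftrightarrow> ideal_gen S = I \<and> (\<forall>T. T \<subset> S \<longrightarrow> ideal_gen T \<noteq> I)"

text \<open>The quotient ring is artinian; its ideals correspond to the ideals containing \<open>I\<close>.\<close>

definition artinian_ideal :: "'a::field poly3 set \<Rightarrow> bool" where
  "artinian_ideal I \<longleftrightarrow> is_ideal I \<and>
     (\<forall>J :: nat \<Rightarrow> 'a poly3 set. (\<forall>n. is_ideal (J n) \<and> I \<subseteq> J n \<and> J (Suc n) \<subseteq> J n) \<longrightarrow>
        (\<exists>N. \<forall>n\<ge>N. J n = J N))"

definition residue_class :: "'a::field poly3 set \<Rightarrow> 'a poly3 \<Rightarrow> 'a poly3 set" where
  "residue_class I f = {g. g - f \<in> I}"

text \<open>The graded piece \<open>(R/I)\<^sub>j\<close> of the quotient by a homogeneous ideal.\<close>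

definition quot_piece :: "'a::field poly3 set \<Rightarrow> nat \<Rightarrow> 'a poly3 set set" where
  "quot_piece I j = residue_class I ` forms j"

text \<open>Multiplication by \<open>L\<close> on residue classes; for an ideal \<open>I\<close> all members of the union agree.\<close>

definition mult_map :: "'a::field poly3 set \<Rightarrow> 'a poly3 \<Rightarrow> 'a poly3 set \<Rightarrow> 'a poly3 set" where
  "mult_map I L C = (\<Union>f\<in>C. residue_class I (L * f))"

definition has_max_rank :: "('b \<Rightarrow> 'c) \<Rightarrow> 'b set \<Rightarrow> 'c set \<Rightarrow> bool" where
  "has_max_rank f V W \<longleftrightarrow> inj_on f V \<or> f ` V = W"


section \<open>Togliatti systems\<close>

definition togliatti_system :: "nat \<Rightarrow> 'a::field poly3 set \<Rightarrow> bool" where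
  "togliatti_system d I \<longleftrightarrow>
     artinian_ideal I \<and>
     (\<exists>S. S \<subseteq> forms d \<and> finite S \<and> card S \<le> d + 1 \<and> ideal_gen S = I) \<and>
     (\<forall>L\<in>forms 1. \<not> has_max_rank (mult_map I L) (quot_piece I (d - 1)) (quot_piece I d))"

definition monomial_togliatti :: "nat \<Rightarrow> 'a::field poly3 set \<Rightarrow> bool" where
  "monomial_togliatti d I \<longleftrightarrow>
     togliatti_system d I \<and> (\<exists>S. S \<subseteq> monomials \<and> ideal_gen S = I)"

text \<open>The set \<open>S\<close> of minimal monomial generators of a monomial ideal is unique.\<close>

definition minimal_monomial_togliatti :: "nat \<Rightarrow> 'a::field poly3 set \<Rightarrow> bool" where
  "minimal_monomial_togliatti d I \<longleftrightarrow>
     monomial_togliatti d I \<and>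
     (\<forall>S. S \<subseteq> monomials \<and> minimal_generators I S \<longrightarrow>
        (\<forall>T. T \<subset> S \<longrightarrow> \<not> monomial_togliatti d (ideal_gen T)))"


section \<open>Projective spaces and regular maps\<close>

text \<open>
  The projective space with homogeneous coordinates indexed by \<open>A\<close>: a point is the set of all
  its homogeneous coordinate vectors, which are padded with zeros outside \<open>A\<close>.
\<close>

definition proj_point :: "('i \<Rightarrow> 'a::field) \<Rightarrow> ('i \<Rightarrow> 'a) set" where
  "proj_point v = {\<lambda>i. c * v i | c. c \<noteq> 0}"

definition proj_space :: "'i set \<Rightarrow> ('i \<Rightarrow> 'a::field) set set" where
  "proj_space A = proj_point ` {v. v \<noteq> (\<lambda>_. 0) \<and> (\<forall>i. i \<notin> A \<longrightarrow> v i = 0)}"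

abbreviation P2 :: "(3 \<Rightarrow> 'a::field) set set" where
  "P2 \<equiv> proj_space UNIV"

definition zariski_open :: "(3 \<Rightarrow> 'a::field) set set \<Rightarrow> bool" where
  "zariski_open U \<longleftrightarrow> (\<exists>H. (\<forall>h\<in>H. \<exists>k. h \<in> forms k) \<and>
      U = {p \<in> P2. \<exists>h\<in>H. \<forall>v\<in>p. evalp h v \<noteq> 0})"

text \<open>\<open>f\<close> is locally given by forms of the same degree without common zeros.\<close>

definition regular_map :: "'i set \<Rightarrow> ((3 \<Rightarrow> 'a::field) set \<Rightarrow> ('i \<Rightarrow> 'a) set) \<Rightarrow> bool" where
  "regular_map A f \<longleftrightarrow> f \<in> P2 \<rightarrow> proj_space A \<and>
     (\<forall>p\<in>P2. \<exists>U. zariski_open U \<and> p \<in> U \<and>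
        (\<exists>k G. (\<forall>i\<in>A. G i \<in> forms k) \<and>
           (\<forall>q\<in>U. \<forall>v\<in>q. (\<exists>i\<in>A. evalp (G i) v \<noteq> 0) \<and>
               f q = proj_point (\<lambda>i. if i \<in> A then evalp (G i) v else 0))))"

definition automorphisms_P2 :: "((3 \<Rightarrow> 'a::field) set \<Rightarrow> (3 \<Rightarrow> 'a) set) set" where
  "automorphisms_P2 = {\<sigma> \<in> Bij P2. regular_map UNIV \<sigma> \<and> regular_map UNIV (inv_into P2 \<sigma>)}"


section \<open>Galois coverings\<close>

text \<open>
  The map from the plane to projective space given by a set \<open>S\<close> of forms of the same degree.
  The coordinates of the target are indexed by \<open>S\<close> itself. All members of the union agree.
\<close>

definition assoc_map :: "'a::field poly3 set \<Rightarrow> (3 \<Rightarrow> 'a) set \<Rightarrow> ('a poly3 \<Rightarrow> 'a) set" where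
  "assoc_map S p = (\<Union>v\<in>p. proj_point (\<lambda>F. if F \<in> S then evalp F v else 0))"

text \<open>
  For \<open>F \<in> S\<close>, the preimage of the affine chart of the target where the coordinate \<open>F\<close> does not
  vanish is the affine variety \<open>F \<noteq> 0\<close> of the plane. Its coordinate ring consists of
  the fractions \<open>g / F\<^sup>k\<close> of degree 0.
\<close>

definition chart_ring :: "nat \<Rightarrow> 'a::field poly3 \<Rightarrow> 'a poly3 fract set" where
  "chart_ring d F = {Fract g (F ^ k) | g k. g \<in> forms (k * d)}"

text \<open>
  The coordinate ring of the image in that chart, embedded by pullback of functions:
  the \<open>K\<close>-subalgebra generated by the fractions \<open>G / F\<close> with \<open>G \<in> S\<close>.
\<close>

definition image_chart_ring :: "'a::field poly3 set \<Rightarrow> 'a poly3 \<Rightarrow> 'a poly3 fract set" where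
  "image_chart_ring S F = \<Inter>{A. (\<forall>c. Fract (const c) 1 \<in> A) \<and> (\<forall>G\<in>S. Fract G F \<in> A) \<and>
      (\<forall>s\<in>A. \<forall>t\<in>A. s + t \<in> A \<and> s * t \<in> A)}"

text \<open>
  Finiteness of the map onto its image, checked on the affine charts above: the
  coordinate ring upstairs is a finitely generated module over the one downstairs.
\<close>

definition finite_onto_image :: "nat \<Rightarrow> 'a::field poly3 set \<Rightarrow> bool" where
  "finite_onto_image d S \<longleftrightarrow> (\<forall>F\<in>S. \<exists>B. finite B \<and> B \<subseteq> chart_ring d F \<and>
      chart_ring d F =
        {(\<Sum>b\<in>B. c b * b) | c. \<forall>b\<in>B. c b \<in> image_chart_ring S F})"

definition deck_transformations ::
    "((3 \<Rightarrow> 'a::field) set \<Rightarrow> 'b) \<Rightarrow> ((3 \<Rightarrow> 'a) set \<Rightarrow> (3 \<Rightarrow> 'a) set) set" where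
  "deck_transformations f = {\<sigma> \<in> automorphisms_P2. \<forall>p\<in>P2. f (\<sigma> p) = f p}"

definition deck_group ::
    "((3 \<Rightarrow> 'a::field) set \<Rightarrow> 'b) \<Rightarrow> ((3 \<Rightarrow> 'a) set \<Rightarrow> (3 \<Rightarrow> 'a) set) monoid" where
  "deck_group f = BijGroup P2 \<lparr>carrier := deck_transformations f\<rparr>"

text \<open>
  The map given by \<open>S \<subseteq> forms d\<close> is a Galois covering of its image: a finite morphism
  whose group of deck transformations (the Galois group) acts transitively on every fibre.
\<close>

definition galois_covering :: "nat \<Rightarrow> 'a::field poly3 set \<Rightarrow> bool" where
  "galois_covering d S \<longleftrightarrow>
     regular_map S (assoc_map S) \<and> finite_onto_image d S \<and>
     (\<forall>p\<in>P2. \<forall>q\<in>P2. assoc_map S p = assoc_map S q \<longrightarrow>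
        (\<exists>\<sigma>\<in>deck_transformations (assoc_map S). \<sigma> p = q))"


section \<open>GT-systems\<close>

definition GL3 :: "('a::field ^ 3 ^ 3) monoid" where
  "GL3 = \<lparr>carrier = {M. invertible M}, mult = (**), one = mat 1\<rparr>"

definition diagonal_representation :: "nat \<Rightarrow> (int \<Rightarrow> 'a::field ^ 3 ^ 3) \<Rightarrow> bool" where
  "diagonal_representation d \<rho> \<longleftrightarrow> \<rho> \<in> hom (integer_mod_group d) GL3 \<and>
     (\<forall>k\<in>carrier (integer_mod_group d). \<forall>i j. i \<noteq> j \<longrightarrow> \<rho> k $ i $ j = 0)"

text \<open>
  Any two minimal sets of degree \<open>d\<close> generators differ by a linear change of coordinates of the
  target; a Togliatti system has at least one such set.
\<close>

definition GT_system :: "nat \<Rightarrow> 'a::field poly3 set \<Rightarrow> bool" where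
  "GT_system d I \<longleftrightarrow>
     togliatti_system d I \<and>
     (\<exists>\<rho>. diagonal_representation d \<rho> \<and>
        I = ideal_gen (invariant_forms d (\<rho> ` carrier (integer_mod_group d)))) \<and>
     (\<forall>S. finite S \<and> S \<subseteq> forms d \<and> minimal_generators I S \<longrightarrow>
        galois_covering d S \<and> deck_group (assoc_map S) \<cong> integer_mod_group d)"

definition M_matrix :: "'a::field \<Rightarrow> nat \<Rightarrow> 'a ^ 3 ^ 3" where
  "M_matrix e a = vector [vector [1, 0, 0], vector [0, e, 0], vector [0, 0, e ^ a]]"

definition I_ideal :: "nat \<Rightarrow> 'a::field \<Rightarrow> nat \<Rightarrow> 'a poly3 set" where
  "I_ideal d e a = ideal_gen (invariant_forms d {M_matrix e a})"

end

theory Submission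
  imports Defs "Jordan_Normal_Form.Determinant" "HOL-Number_Theory.Cong"
begin

text \<open>
  Let \<open>\<Lambda>\<close> be the set of exponents \<open>(i, j, k)\<close> of degree \<open>d\<close> with \<open>d\<close> dividing \<open>j + a k\<close>, so that \<open>I\<^sub>a\<close> is
  generated by the monomials in \<open>\<Lambda>\<close>. Pairing \<open>k\<close> with \<open>d - k\<close> gives \<open>\<lfloor>d/2\<rfloor> + 3 \<le> |\<Lambda>| \<le> d + 1\<close>. For a linear form
  \<open>L\<close>, the product of the translates \<open>M\<^sup>t L\<close> is invariant, so \<open>\<Prod>\<^sub>t\<^sub>>\<^sub>0 M\<^sup>t L\<close> lies in the kernel of
  multiplication by \<open>L\<close>; by the upper bound a map that is not injective is not surjective either.

  For minimality take \<open>L = x + y + z\<close>. Any invariant multiple of \<open>L\<close> of degree \<open>d\<close> is a scalar multiple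
  of \<open>N = \<Prod>\<^sub>t (x + e\<^sup>t y + e\<^bsup>a t\<^esup> z)\<close>, hence it suffices that every monomial in \<open>\<Lambda>\<close> occurs in
  \<open>N\<close>. Now \<open>N\<close> is a circulant determinant, and its coefficient at \<open>(i, j, k)\<close> is a signed count of the
  permutations of \<open>\<int>/d\<close> with \<open>j\<close> steps \<open>+1\<close> and \<open>k\<close> steps \<open>+a\<close>. Counting inversions shows that all
  of these have the same sign, and an interval exchange provides one of them.

  Invariants of degree \<open>d\<close> separate the orbits of \<open>M\<close> in the plane. This gives the fibres of the
  morphism, and, since the plane is irreducible, that a deck transformation is a power of \<open>M\<close>.
\<close>

section \<open>Signs of permutations\<close>

text \<open>The obstacle is cancellation: as a sum of products of roots of unity, a coefficient of
  \<open>N\<close> shows no reason to be nonzero. The determinant turns it into a sum of signs. The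
  displacements \<open>p t - t\<close> of a permutation add up to 0, so the number of steps that
  wrap past \<open>d\<close> is forced to be \<open>m = (j + a k) / d\<close>, which is read off
  from the monomial. The parity of the number of inversions turns out to depend only on
  \<open>d\<close>, \<open>a\<close>, \<open>k\<close> and \<open>m\<close>. So the terms of one
  monomial add up without cancellation, and characteristic 0 keeps their number from vanishing. The
  bound \<open>d + 1\<close> is the difference of the dimensions of the forms of degree
  \<open>d\<close> and \<open>d - 1\<close>; this is what makes a noninjective multiplication
  nonsurjective. The generators in \<open>GT_system\<close> need not be monomials. In degree
  \<open>d\<close>, membership in the ideal is membership in a K-span, and this span is the same for
  every generating set of forms of degree \<open>d\<close>; statements about such a set are
  therefore checked on the invariant monomials.\<close>

definition inversions :: "nat \<Rightarrow> (nat \<Rightarrow> nat) \<Rightarrow> (nat \<times> nat) set" where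
  "inversions n p = {(s, t). s < t \<and> t < n \<and> p t < p s}"

lemma finite_inversions: "finite (inversions n p)"
  by (rule finite_subset[of _ "{..<n} \<times> {..<n}"]) (auto simp: inversions_def)

text \<open>Swapping two neighbours reverses the order of no other pair, so applying the swap to
  both entries matches the remaining inversions; only the pair \<open>(k, Suc k)\<close> is
  lost.\<close>

lemma inversions_compose_adjacent:
  assumes "Suc k < n" "p (Suc k) < p k"
  shows "card (inversions n p) = Suc (card (inversions n (p \<circ> Transposition.transpose k (Suc k))))"
proof -
  let ?s = "Transposition.transpose k (Suc k)"
  have mono: "?s s < ?s t" if "s < t" "(s, t) \<noteq> (k, Suc k)" for s t
    using that by (simp add: Transposition.transpose_def) presburger
  have bound: "?s t < n" if "t < n" for t
    using that assms(1) by (simp add: Transposition.transpose_def)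
  have "bij_betw (\<lambda>(s, t). (?s s, ?s t)) (inversions n (p \<circ> ?s)) (inversions n p - {(k, Suc k)})"
  proof (rule bij_betw_byWitness[where f' = "\<lambda>(s, t). (?s s, ?s t)"])
    have "(k, Suc k) \<notin> inversions n (p \<circ> ?s)"
      using assms(2) by (simp add: inversions_def)
    then have *: "(?s s, ?s t) \<in> inversions n p - {(k, Suc k)}" if "(s, t) \<in> inversions n (p \<circ> ?s)" for s t
    proof -
      have st: "s < t" "t < n" "p (?s t) < p (?s s)" "(s, t) \<noteq> (k, Suc k)"
        using that \<open>(k, Suc k) \<notin> _\<close> by (auto simp: inversions_def)
      then have "?s s < ?s t" "?s t < n"
        using mono bound by blast+
      moreover have "(?s s, ?s t) \<noteq> (k, Suc k)"
      proof
        assume "(?s s, ?s t) = (k, Suc k)"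
        then have "s = Suc k" "t = k"
          by (metis prod.inject transpose_apply_first transpose_apply_second transpose_involutory)+
        with st show False by simp
      qed
      ultimately show ?thesis
        using st by (simp add: inversions_def)
    qed
    show "(\<lambda>(s, t). (?s s, ?s t)) ` inversions n (p \<circ> ?s) \<subseteq> inversions n p - {(k, Suc k)}"
    proof (rule image_subsetI)
      fix x assume "x \<in> inversions n (p \<circ> ?s)"
      then show "(\<lambda>(s, t). (?s s, ?s t)) x \<in> inversions n p - {(k, Suc k)}"
        using *[of "fst x" "snd x"] by (cases x) simp
    qed
    show "(\<lambda>(s, t). (?s s, ?s t)) ` (inversions n p - {(k, Suc k)}) \<subseteq> inversions n (p \<circ> ?s)"
      using mono bound by (auto simp: inversions_def)
  qed auto
  then have "card (inversions n (p \<circ> ?s)) = card (inversions n p - {(k, Suc k)})"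
    by (rule bij_betw_same_card)
  moreover have "(k, Suc k) \<in> inversions n p"
    using assms by (auto simp: inversions_def)
  ultimately show ?thesis
    using finite_inversions[of n p] by (metis card_Suc_Diff1)
qed

text \<open>A strictly increasing self-map of an initial segment cannot fall below the identity
  (induction from 0) nor exceed it (induction down from \<open>n - 1\<close>).\<close>

lemma permutes_no_inversions:
  assumes "p permutes {0..<n}" "inversions n p = {}"
  shows "p = id"
proof -
  have mono: "s < t \<Longrightarrow> t < n \<Longrightarrow> p s < p t" for s t
  proof -
    assume st: "s < t" "t < n"
    then have "\<not> p t < p s"
      using assms(2) by (auto simp: inversions_def)
    moreover have "p s \<noteq> p t"
      using st permutes_inj[OF assms(1)] by (metis injD less_irrefl)
    ultimately show ?thesis by simp
  qed
  have "p t = t" if "t < n" for t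
  proof -
    have low: "t < n \<Longrightarrow> t \<le> p t" for t
      by (induction t) (use mono in \<open>fastforce+\<close>)
    have high: "i < n \<Longrightarrow> p (n - 1 - i) \<le> n - 1 - i" for i
    proof (induction i)
      case 0
      then show ?case
        using permutes_in_image[OF assms(1), of "n - 1"] by auto
    next
      case (Suc i)
      then have "p (n - 1 - Suc i) < p (n - 1 - i)"
        by (intro mono) auto
      with Suc show ?case by auto
    qed
    show ?thesis
      using low[OF that] high[of "n - 1 - t"] that by auto
  qed
  then show ?thesis
    using permutes_not_in[OF assms(1)] by (metis atLeastLessThan_iff eq_id_iff)
qed

text \<open>Bubble sort: a permutation with inversions has a descent at neighbouring positions, and
  undoing it flips the sign and removes one inversion.\<close>

lemma sign_eq_inversions:
  assumes "p permutes {0..<n}"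
  shows "sign p = (-1) ^ card (inversions n p)"
  using assms
proof (induction "card (inversions n p)" arbitrary: p)
  case 0
  then have "p = id"
    using finite_inversions permutes_no_inversions by (metis card_0_eq)
  then show ?case
    using 0 by (simp add: sign_id)
next
  case (Suc N)
  have "\<exists>k. Suc k < n \<and> p (Suc k) < p k"
  proof (rule ccontr)
    assume *: "\<not> ?thesis"
    have step: "p k \<le> p (Suc k)" if "Suc k < n" for k
      using * that by (meson not_less)
    have "s + i < n \<Longrightarrow> p s \<le> p (s + i)" for s i
    proof (induction i)
      case (Suc i)
      then show ?case
        using step[of "s + i"] by simp
    qed simp
    then have "inversions n p = {}"
      unfolding inversions_def by (auto simp: not_less) (metis le_add_diff_inverse less_imp_le not_less)
    then show False
      using Suc(2) by simp
  qed
  then obtain k where k: "Suc k < n" "p (Suc k) < p k" by blast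
  let ?s = "Transposition.transpose k (Suc k)"
  have s: "?s permutes {0..<n}"
    using k by (intro permutes_swap_id) auto
  have p': "(p \<circ> ?s) permutes {0..<n}"
    using permutes_compose[OF s Suc(3)] .
  have "sign (p \<circ> ?s) = (-1) ^ N"
    using Suc(1)[OF _ p'] inversions_compose_adjacent[OF k] Suc(2) by simp
  moreover have "sign (p \<circ> ?s) = - sign p"
    using sign_compose[of p ?s] s Suc(3) permutation_permutes[of ?s] permutation_permutes[of p]
    by (simp add: sign_swap_id) (metis finite_atLeastLessThan)
  ultimately show ?case
    using Suc(2) inversions_compose_adjacent[OF k] by (metis minus_equation_iff mult_minus1 power_Suc)
qed

text \<open>Count the \<open>p s\<close> values below \<open>p s\<close> and the \<open>s\<close>
  positions before \<open>s\<close>: both counts share the earlier positions with smaller value. So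
  the displacement \<open>p s - s\<close> is the number of inversions to the right of
  \<open>s\<close> minus the number to its left.\<close>

lemma card_inversions_right:
  assumes "p permutes {0..<n}" "s < n"
  shows "card {t. (s, t) \<in> inversions n p} + s = card {t. (t, s) \<in> inversions n p} + p s"
proof -
  let ?C = "{t. t < s \<and> p t < p s}"
  have fin: "finite {t. (s, t) \<in> inversions n p}" "finite {t. (t, s) \<in> inversions n p}"
    by (rule finite_subset[of _ "{..<n}"]; auto simp: inversions_def)+
  have ne: "p t \<noteq> p s" if "t \<noteq> s" for t
    using permutes_inj[OF assms(1)] that by (metis injD)
  have eq1: "{t. t < n \<and> p t < p s} = ?C \<union> {t. (s, t) \<in> inversions n p}"
    using assms(2) by (auto simp: inversions_def) (metis nat_neq_iff)
  have "p ` {t. t < n \<and> p t < p s} = {..<p s}"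
  proof -
    have "p s < n"
      using permutes_in_image[OF assms(1)] assms(2) by simp
    show ?thesis
    proof (intro equalityI subsetI)
      fix u assume "u \<in> {..<p s}"
      then have "u \<in> p ` {0..<n}"
        using permutes_image[OF assms(1)] \<open>p s < n\<close> by auto
      then show "u \<in> p ` {t. t < n \<and> p t < p s}"
        using \<open>u \<in> {..<p s}\<close> by auto
    qed auto
  qed
  then have "card {t. t < n \<and> p t < p s} = p s"
    using card_image[of p "{t. t < n \<and> p t < p s}"] permutes_inj[OF assms(1)]
    by (metis card_lessThan inj_on_subset subset_UNIV)
  then have "card (?C \<union> {t. (s, t) \<in> inversions n p}) = p s"
    using eq1 by simp
  moreover have "card (?C \<union> {t. (s, t) \<in> inversions n p}) = card ?C + card {t. (s, t) \<in> inversions n p}"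
    using fin by (intro card_Un_disjoint) (auto simp: inversions_def)
  moreover have "{..<s} = ?C \<union> {t. (t, s) \<in> inversions n p}"
    using assms(2) ne by (auto simp: inversions_def) (metis linorder_neqE_nat nat_less_le)
  then have "card (?C \<union> {t. (t, s) \<in> inversions n p}) = s"
    by (metis card_lessThan)
  moreover have "card (?C \<union> {t. (t, s) \<in> inversions n p}) = card ?C + card {t. (t, s) \<in> inversions n p}"
    using fin by (intro card_Un_disjoint) (auto simp: inversions_def)
  ultimately show ?thesis by linarith
qed

section \<open>Three-line circulant determinants\<close>

text \<open>
  In the expansion of the circulant determinant, such a permutation of \<open>\<int>/d\<close> contributes to the
  monomial \<open>x\<^bsup>d - |J| - |K|\<^esup> y\<^bsup>|J|\<^esup> z\<^bsup>|K|\<^esup>\<close>.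
\<close>

definition shift_perm :: "nat \<Rightarrow> nat \<Rightarrow> nat set \<Rightarrow> nat set \<Rightarrow> (nat \<Rightarrow> nat) \<Rightarrow> bool" where
  "shift_perm d a J K p \<longleftrightarrow> p permutes {0..<d} \<and> J \<subseteq> {0..<d} \<and> K \<subseteq> {0..<d} \<and> J \<inter> K = {} \<and>
     (\<forall>t\<in>J. p t = (t + 1) mod d) \<and> (\<forall>t\<in>K. p t = (t + a) mod d) \<and>
     (\<forall>t\<in>{0..<d} - J - K. p t = t)"

lemma mod_less_double: "(m::nat) < 2 * d \<Longrightarrow> m mod d = (if m < d then m else m - d)"
  by (auto simp: mod_if)

text \<open>\<open>k1\<close> and \<open>k2\<close> count the steps \<open>a\<close> without and
  with a wrap past \<open>d\<close>; \<open>E\<close> counts the unit step from \<open>d - 1\<close>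
  to \<open>0\<close>. Only long jumps create inversions: each inversion has its left end in
  \<open>K1\<close> or its right end at a wrapping step. Both families are counted by displacements,
  and \<open>k1 * (k2 + E)\<close> is the size of their overlap. The linear equation says that all
  displacements sum to 0.\<close>

lemma shift_perm_card_inversions:
  assumes "shift_perm d a J K p" "1 < a" "a < d"
  obtains k1 k2 E where "card K = k1 + k2" "E \<le> card J"
    "k1 * a + card J + k2 * a = d * (k2 + E)"
    "card (inversions d p) + k1 * (k2 + E) = k1 * a + k2 * (d - a + E) + E * (d - 1)"
proof -
  from assms have perm: "p permutes {0..<d}" and JK: "J \<subseteq> {0..<d}" "K \<subseteq> {0..<d}" "J \<inter> K = {}"
    and pJ: "\<And>t. t \<in> J \<Longrightarrow> p t = (t + 1) mod d" and pK: "\<And>t. t \<in> K \<Longrightarrow> p t = (t + a) mod d"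
    and p0: "\<And>t. t < d \<Longrightarrow> t \<notin> J \<Longrightarrow> t \<notin> K \<Longrightarrow> p t = t"
    unfolding shift_perm_def by auto
  note inj = permutes_inj[OF perm]
  define K1 where "K1 = {t\<in>K. t + a < d}"
  define K2 where "K2 = {t\<in>K. d \<le> t + a}"
  define E where "E = {t\<in>J. t = d - 1}"
  let ?I = "inversions d p"
  have finJK: "finite J" "finite K"
    using JK finite_subset by blast+
  then have fin: "finite K1" "finite K2" "finite E"
    by (auto simp: K1_def K2_def E_def)
  have pK1: "p t = t + a" if "t \<in> K1" for t
    using that pK[of t] by (auto simp: K1_def)
  have pK2: "p t = t + a - d" "t < d" "d - a \<le> t" "t \<in> K" if "t \<in> K2" for t
    using that pK[of t] JK assms(3) mod_less_double[of "t + a" d] by (auto simp: K2_def)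
  have pE: "p t = 0" "t = d - 1" "t \<in> J" if "t \<in> E" for t
    using that pJ[of t] assms by (auto simp: E_def)
  have pJ': "p t = t + 1" if "t \<in> J" "t \<notin> E" for t
    using that pJ[of t] JK assms(3) by (auto simp: E_def mod_less_double)
  have cardE: "card E \<le> 1"
    using card_mono[of "{d - 1}" E] by (auto simp: E_def)
  have up: "p t = t + a \<and> t \<in> K1 \<or> p t = t + a - d \<and> t \<in> K2 \<or> p t = 0 \<and> t \<in> E \<or>
      p t = t + 1 \<and> t \<in> J - E \<or> p t = t \<and> t \<notin> K \<and> t \<notin> J" if "t < d" for t
  proof -
    consider "t \<in> K1" | "t \<in> K2" | "t \<in> E" | "t \<in> J - E" | "t \<notin> K" "t \<notin> J"
      using K1_def K2_def E_def by fastforce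
    then show ?thesis
      using that pK1 pK2(1) pE(1) pJ' p0 by cases blast+
  qed
  have dich: "s \<in> K1 \<or> t \<in> K2 \<union> E" if "(s, t) \<in> ?I" for s t
  proof (rule ccontr)
    assume *: "\<not> ?thesis"
    have st: "s < t" "t < d" "p t < p s"
      using that by (auto simp: inversions_def)
    have "p s \<le> s + 1"
      using up[of s] * st assms by linarith
    moreover have "t \<le> p t"
      using up[of t] * st by (metis UnCI le_add1 order_refl)
    ultimately show False
      using st by simp
  qed
  have both: "(s, t) \<in> ?I" if "s \<in> K1" "t \<in> K2 \<union> E" for s t
  proof -
    have "s < d - a" "s \<in> K"
      using that by (auto simp: K1_def)
    then show ?thesis
      using that pK1[of s] pK2[of t] pE[of t] JK(3) assms unfolding inversions_def by auto
  qed
  \<comment> \<open>No point left of \<open>s\<close> can land beyond \<open>s + a\<close>, so the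
    displacement of \<open>s\<close> counts exactly the inversions to its right.\<close>
  have right_K1: "card {t. (s, t) \<in> ?I} = a" if "s \<in> K1" for s
  proof -
    have sd: "s < d"
      using that by (auto simp: K1_def)
    have "{t. (t, s) \<in> ?I} = {}"
    proof -
      have "(t, s) \<notin> ?I" for t
        using up[of t] pK1[OF that] that assms unfolding inversions_def by auto
      then show ?thesis by blast
    qed
    then show ?thesis
      using card_inversions_right[OF perm sd] pK1[OF that] by simp
  qed
  \<comment> \<open>Wrapping steps \<open>a\<close> keep their mutual order, so to the right of
    \<open>s\<close> only the step from \<open>d - 1\<close> to \<open>0\<close> can form an
    inversion with it.\<close>
  have left_K2: "card {t. (t, s) \<in> ?I} = d - a + card E" if "s \<in> K2" for s
  proof -
    note s = pK2[OF that]
    have "{t. (s, t) \<in> ?I} = E"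
    proof (intro equalityI subsetI)
      fix t assume t: "t \<in> {t. (s, t) \<in> ?I}"
      then have "t \<in> K2 \<union> E"
        using dich[of s t] that by (auto simp: K1_def K2_def)
      then show "t \<in> E"
        using t s pK2[of t] by (auto simp: inversions_def)
    next
      fix t assume t: "t \<in> E"
      have "s \<noteq> t"
        using s(4) pE(3)[OF t] JK(3) by auto
      then have "p s \<noteq> p t"
        using inj by (metis injD)
      then show "t \<in> {t. (s, t) \<in> ?I}"
        using s pE[OF t] \<open>s \<noteq> t\<close> assms by (auto simp: inversions_def)
    qed
    then show ?thesis
      using card_inversions_right[OF perm s(2)] s assms by simp
  qed
  have left_E: "card {t. (t, s) \<in> ?I} = d - 1" if "s \<in> E" for s
  proof -
    note s = pE[OF that]
    have "{t. (s, t) \<in> ?I} = {}"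
      using s by (auto simp: inversions_def)
    then show ?thesis
      using card_inversions_right[OF perm, of s] s assms by simp
  qed
  have finI: "finite {t. (s, t) \<in> ?I}" "finite {t. (t, s) \<in> ?I}" for s
    by (rule finite_subset[of _ "{..<d}"]; auto simp: inversions_def)+
  define A where "A = (SIGMA s:K1. {t. (s, t) \<in> ?I})"
  define B where "B = prod.swap ` (SIGMA s:K2 \<union> E. {t. (t, s) \<in> ?I})"
  have "K2 \<inter> E = {}"
    using JK(3) pK2(4) pE(3) by blast
  have cA: "card A = card K1 * a"
    unfolding A_def using fin finI right_K1 by (subst card_SigmaI) auto
  have cB: "card B = card K2 * (d - a + card E) + card E * (d - 1)"
  proof -
    have "card B = (\<Sum>s\<in>K2 \<union> E. card {t. (t, s) \<in> ?I})"
      unfolding B_def using fin finI by (subst card_image) (auto intro: inj_onI simp: card_SigmaI)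
    also have "\<dots> = (\<Sum>s\<in>K2. card {t. (t, s) \<in> ?I}) + (\<Sum>s\<in>E. card {t. (t, s) \<in> ?I})"
      using fin \<open>K2 \<inter> E = {}\<close> by (intro sum.union_disjoint) auto
    finally show ?thesis
      using left_K2 left_E by simp
  qed
  have "A \<inter> B = K1 \<times> (K2 \<union> E)"
    unfolding A_def B_def using both by (auto simp: image_def)
  moreover have "A \<union> B = ?I"
    unfolding A_def B_def using dich by (auto simp: image_def)
  moreover have "finite A" "finite B"
    unfolding A_def B_def using fin finI by auto
  ultimately have "card ?I + card (K1 \<times> (K2 \<union> E)) = card A + card B"
    using card_Un_Int[of A B] by simp
  moreover have "card (K2 \<union> E) = card K2 + card E"
    using fin \<open>K2 \<inter> E = {}\<close> by (simp add: card_Un_disjoint)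
  ultimately have count: "card ?I + card K1 * (card K2 + card E) =
      card K1 * a + card K2 * (d - a + card E) + card E * (d - 1)"
    using cA cB by (simp add: card_cartesian_product)
  have "K = K1 \<union> K2" "K1 \<inter> K2 = {}"
    by (auto simp: K1_def K2_def)
  then have cK: "card K = card K1 + card K2"
    using fin card_Un_disjoint by metis
  have "E \<subseteq> J"
    by (auto simp: E_def)
  then have EJ: "card E \<le> card J"
    using finJK card_mono by blast
  have "(\<Sum>t\<in>{0..<d}. int (p t) - int t) = 0"
    using sum.permute[OF perm, of int] by (simp add: sum_subtractf comp_def)
  moreover have "(\<Sum>t\<in>{0..<d}. int (p t) - int t) =
      (\<Sum>t\<in>{0..<d}. (if t \<in> K1 then int a else 0) + (if t \<in> K2 then int a - int d else 0) +
        (if t \<in> J then 1 else 0) - (if t \<in> E then int d else 0))"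
  proof (rule sum.cong)
    fix t assume "t \<in> {0..<d}"
    then have t: "t < d" by simp
    have disj: "t \<in> K1 \<Longrightarrow> t \<notin> K2" "t \<in> K1 \<Longrightarrow> t \<notin> J" "t \<in> K2 \<Longrightarrow> t \<notin> J" "t \<in> E \<Longrightarrow> t \<in> J"
      "t \<in> K1 \<Longrightarrow> t \<in> K" "t \<in> K2 \<Longrightarrow> t \<in> K"
      using JK(3) by (auto simp: K1_def K2_def E_def)
    show "int (p t) - int t = (if t \<in> K1 then int a else 0) + (if t \<in> K2 then int a - int d else 0) +
        (if t \<in> J then 1 else 0) - (if t \<in> E then int d else 0)"
      using up[OF t] disj pE(2)[of t] pK2(3)[of t] assms by auto
  qed simp
  moreover have "\<dots> = card K1 * int a + card K2 * (int a - int d) + card J - card E * int d"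
  proof -
    have ind: "(\<Sum>t\<in>{0..<d}. if t \<in> X then c else 0) = int (card X) * c" if "X \<subseteq> {0..<d}" for X and c :: int
      using that by (simp flip: sum.inter_restrict sum.inter_filter add: Int_absorb1)
    show ?thesis
      using JK ind[of K1 "int a"] ind[of K2 "int a - int d"] ind[of J 1] ind[of E "int d"]
      by (simp add: sum.distrib sum_subtractf K1_def K2_def E_def subset_iff)
  qed
  ultimately have "card K1 * int a + card K2 * (int a - int d) + card J - card E * int d = 0"
    by simp
  then have "int (card K1 * a + card J + card K2 * a) = int (d * (card K2 + card E))"
    by (simp add: algebra_simps)
  then have "card K1 * a + card J + card K2 * a = d * (card K2 + card E)"
    by (metis of_nat_eq_iff)
  then show ?thesis
    using that cK EJ count by blast
qed

text \<open>The displacement equation forces \<open>m = k2 + E\<close>. Modulo 2 the split into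
  \<open>k1\<close>, \<open>k2\<close> and \<open>E\<close> then disappears, because
  \<open>k2 * k2\<close> has the parity of \<open>k2\<close>.\<close>

lemma shift_perm_sign:
  assumes "shift_perm d a J K p" "1 < a" "a < d" "card J + a * card K = d * m"
  shows "sign p = (-1) ^ ((d - 1) * m + card K * (a + m))"
proof -
  obtain k1 k2 E where *: "card K = k1 + k2"
    "k1 * a + card J + k2 * a = d * (k2 + E)"
    "card (inversions d p) + k1 * (k2 + E) = k1 * a + k2 * (d - a + E) + E * (d - 1)"
    using shift_perm_card_inversions[OF assms(1-3)] by metis
  have "d * m = d * (k2 + E)"
    using * assms(4) by (simp add: algebra_simps)
  then have m: "m = k2 + E"
    using assms(3) by simp
  \<comment> \<open>Adding the overlap twice moves it to the other side of the count without a
    subtraction.\<close>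
  have "even (card (inversions d p)) \<longleftrightarrow> even (card (inversions d p) + 2 * k1 * (k2 + E))"
    by simp
  also have "card (inversions d p) + 2 * k1 * (k2 + E) =
      k1 * a + k2 * (d - a + E) + E * (d - 1) + k1 * (k2 + E)"
    using *(3) by (simp add: algebra_simps)
  also have "even \<dots> \<longleftrightarrow> even ((d - 1) * m + card K * (a + m))"
    using assms(2,3) unfolding m *(1) by auto
  finally show ?thesis
    using sign_eq_inversions[of p d] assms(1) unfolding shift_perm_def
    by (auto simp: minus_one_power_iff)
qed

section \<open>Permutations with prescribed numbers of steps\<close>

lemma card_mod_mem:
  fixes n :: nat
  assumes "R \<subseteq> {..<n}"
  shows "card {x. x < g * n \<and> x mod n \<in> R} = g * card R"
proof -
  have "{x. x < g * n \<and> x mod n \<in> R} = (\<lambda>(b, r). b * n + r) ` ({..<g} \<times> R)"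
  proof (intro equalityI subsetI)
    fix x assume "x \<in> {x. x < g * n \<and> x mod n \<in> R}"
    then have "x div n < g" "x mod n \<in> R"
      by (auto simp: less_mult_imp_div_less)
    then show "x \<in> (\<lambda>(b, r). b * n + r) ` ({..<g} \<times> R)"
      by (intro image_eqI[where x = "(x div n, x mod n)"]) auto
  next
    fix x assume "x \<in> (\<lambda>(b, r). b * n + r) ` ({..<g} \<times> R)"
    then obtain b r where x: "x = b * n + r" "b < g" "r \<in> R" by auto
    then have "r < n" using assms by auto
    have "b * n + r < Suc b * n"
      using \<open>r < n\<close> by simp
    also have "\<dots> \<le> g * n"
      using x(2) by (intro mult_right_mono) auto
    finally show "x \<in> {x. x < g * n \<and> x mod n \<in> R}"
      using x \<open>r < n\<close> by simp
  qed
  moreover have "inj_on (\<lambda>(b, r). b * n + r) ({..<g} \<times> R)"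
  proof (rule inj_onI, clarsimp)
    fix b r b' r' assume *: "r \<in> R" "r' \<in> R" "b * n + r = b' * n + r'"
    then have "r < n" "r' < n" using assms by auto
    then have "(b * n + r) div n = b" "(b' * n + r') div n = b'"
      by auto
    then show "b = b' \<and> r = r'" using * by auto
  qed
  ultimately show ?thesis
    by (simp add: card_image card_cartesian_product)
qed

text \<open>A unit \<open>\<kappa>\<close> permutes the residues modulo \<open>n\<close>;
  remembering the period \<open>t div n\<close> as well makes the map bijective on all
  \<open>c\<close> periods.\<close>

lemma card_mult_mod:
  fixes \<kappa> n c :: nat
  assumes "coprime \<kappa> n" "0 < n"
  shows "card {t. t < c * n \<and> P (\<kappa> * t mod n)} = c * card {x. x < n \<and> P x}"
proof -
  let ?f = "\<lambda>t. (\<kappa> * t mod n, t div n)"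
  have inj: "inj_on ?f {..<c * n}"
  proof (rule inj_onI)
    fix s t assume *: "?f s = ?f t"
    then have "[\<kappa> * s = \<kappa> * t] (mod n)"
      by (simp add: cong_def)
    then have "s mod n = t mod n"
      using assms(1) cong_mult_lcancel_nat by (simp add: cong_def)
    then show "s = t"
      using * by (metis div_mult_mod_eq prod.inject)
  qed
  have "?f ` {..<c * n} \<subseteq> {..<n} \<times> {..<c}"
    using assms(2) by (auto simp: less_mult_imp_div_less)
  moreover have "card (?f ` {..<c * n}) = card ({..<n} \<times> {..<c})"
    using inj by (simp add: card_image card_cartesian_product)
  ultimately have surj: "?f ` {..<c * n} = {..<n} \<times> {..<c}"
    by (intro card_subset_eq) auto
  have "?f ` {t. t < c * n \<and> P (\<kappa> * t mod n)} = {x. x < n \<and> P x} \<times> {..<c}"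
  proof (intro equalityI subsetI)
    fix y assume y: "y \<in> {x. x < n \<and> P x} \<times> {..<c}"
    then have "y \<in> ?f ` {..<c * n}"
      unfolding surj by auto
    then show "y \<in> ?f ` {t. t < c * n \<and> P (\<kappa> * t mod n)}"
      using y by auto
  qed (use assms(2) in \<open>auto simp: less_mult_imp_div_less\<close>)
  then have "card ({x. x < n \<and> P x} \<times> {..<c}) = card (?f ` {t. t < c * n \<and> P (\<kappa> * t mod n)})"
    by simp
  also have "\<dots> = card {t. t < c * n \<and> P (\<kappa> * t mod n)}"
    by (rule card_image, rule inj_on_subset[OF inj]) auto
  finally show ?thesis
    by (simp add: card_cartesian_product mult.commute)
qed

text \<open>
  The permutation comes from an interval exchange: along \<open>t \<mapsto> \<kappa> t mod n\<close> the step 1 becomes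
  \<open>+ \<kappa>\<close> and the step \<open>a\<close> becomes \<open>- \<iota>\<close>, and in each of \<open>g\<close> consecutive blocks of length
  \<open>\<iota> + \<kappa>\<close> these two steps swap the first \<open>\<iota>\<close> with the last \<open>\<kappa>\<close> values.
\<close>

lemma interval_exchange_shift_perm:
  fixes c n \<kappa> \<iota> g a :: nat
  assumes "0 < c" "0 < n" "coprime \<kappa> n" "\<kappa> * a + \<iota> = n * l" "0 < \<iota> + \<kappa>" "g * (\<iota> + \<kappa>) \<le> n"
  obtains J K p where "shift_perm (c * n) a J K p" "card J = c * (g * \<iota>)" "card K = c * (g * \<kappa>)"
proof -
  let ?d = "c * n" and ?b = "\<iota> + \<kappa>"
  define h where "h t = \<kappa> * t mod n" for t
  define J where "J = {t. t < ?d \<and> h t < g * ?b \<and> h t mod ?b \<in> {..<\<iota>}}"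
  define K where "K = {t. t < ?d \<and> h t < g * ?b \<and> h t mod ?b \<in> {\<iota>..<?b}}"
  define q where "q t = (if t \<in> J then (t + 1) mod ?d else if t \<in> K then (t + a) mod ?d else t)" for t
  \<comment> \<open>The interval exchange in the coordinate \<open>h\<close>; \<open>hq\<close>
    below shows that \<open>h\<close> carries \<open>q\<close> to \<open>ex\<close>.\<close>
  define ex where "ex x = (if x < g * ?b then if x mod ?b < \<iota> then x + \<kappa> else x - \<iota> else x)" for x
  have d: "0 < ?d" using assms by simp
  have hn: "h t < n" for t
    using assms(2) by (simp add: h_def)
  have count: "card {t. t < ?d \<and> h t < g * ?b \<and> h t mod ?b \<in> R} = c * (g * card R)" if "R \<subseteq> {..<?b}" for R
  proof -
    have "card {t. t < ?d \<and> h t < g * ?b \<and> h t mod ?b \<in> R} =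
        c * card {x. x < n \<and> (x < g * ?b \<and> x mod ?b \<in> R)}"
      unfolding h_def using assms by (intro card_mult_mod) auto
    also have "{x. x < n \<and> (x < g * ?b \<and> x mod ?b \<in> R)} = {x. x < g * ?b \<and> x mod ?b \<in> R}"
      using assms(6) by auto
    finally show ?thesis
      using card_mod_mem[OF that] by simp
  qed
  have cJ: "card J = c * (g * \<iota>)"
    unfolding J_def using count[of "{..<\<iota>}"] by simp
  have cK: "card K = c * (g * \<kappa>)"
    unfolding K_def using count[of "{\<iota>..<?b}"] by (simp add: subset_iff)
  have ex_divmod: "ex x div ?b = x div ?b"
      "ex x mod ?b = (if x mod ?b < \<iota> then x mod ?b + \<kappa> else x mod ?b - \<iota>)" "ex x < g * ?b"
    if "x < g * ?b" for x
  proof -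
    define u r where "u = x div ?b" and "r = x mod ?b"
    have x: "x = u * ?b + r" and r: "r < ?b"
      unfolding u_def r_def using assms(5) by (simp_all only: div_mult_mod_eq mod_less_divisor)
    have block: "(u * b + s) div b = u" "(u * b + s) mod b = s" if "s < b" for b s
      using that by auto
    define r' where "r' = (if r < \<iota> then r + \<kappa> else r - \<iota>)"
    have r': "r' < ?b"
      using r by (auto simp: r'_def)
    have exx: "ex x = u * ?b + r'"
      unfolding ex_def r'_def r_def[symmetric] using that x by auto
    show "ex x div ?b = x div ?b" "ex x mod ?b = (if x mod ?b < \<iota> then x mod ?b + \<kappa> else x mod ?b - \<iota>)"
      using block[OF r'] exx unfolding u_def[symmetric] r_def[symmetric] r'_def[symmetric] by metis+
    have "u < g"
      using that by (simp add: u_def less_mult_imp_div_less)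
    have "ex x < Suc u * ?b"
      using exx r' by simp
    also have "\<dots> \<le> g * ?b"
      using \<open>u < g\<close> by (intro mult_right_mono) auto
    finally show "ex x < g * ?b" .
  qed
  have ex_inj: "x = y" if "ex x = ex y" for x y
  proof -
    have "x < g * ?b \<longleftrightarrow> y < g * ?b"
      using ex_divmod(3)[of x] ex_divmod(3)[of y] that by (metis ex_def)
    show ?thesis
    proof (cases "x < g * ?b")
      case True
      then have "y < g * ?b"
        using \<open>x < g * ?b \<longleftrightarrow> y < g * ?b\<close> by simp
      have "x mod ?b < ?b" "y mod ?b < ?b"
        using assms(5) by auto
      moreover have "u = v" if "u < ?b" "v < ?b"
          "(if u < \<iota> then u + \<kappa> else u - \<iota>) = (if v < \<iota> then v + \<kappa> else v - \<iota>)" for u v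
        using that by (auto split: if_splits)
      ultimately have "x mod ?b = y mod ?b"
        using ex_divmod(2)[OF True] ex_divmod(2)[OF \<open>y < g * ?b\<close>] that by metis
      moreover have "x div ?b = y div ?b"
        using ex_divmod(1)[OF True] ex_divmod(1)[OF \<open>y < g * ?b\<close>] that by simp
      ultimately show ?thesis
        by (metis div_mult_mod_eq)
    next
      case False
      then show ?thesis
        using that \<open>x < g * ?b \<longleftrightarrow> y < g * ?b\<close> by (auto simp: ex_def)
    qed
  qed
  have h_add: "h ((t + u) mod ?d) = (h t + \<kappa> * u) mod n" for t u
  proof -
    have "[\<kappa> * ((t + u) mod ?d) = \<kappa> * (t + u)] (mod n)"
      by (intro cong_mult cong_refl) (simp add: cong_def mod_mod_cancel)
    also have "[\<kappa> * (t + u) = h t + \<kappa> * u] (mod n)"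
      by (simp add: cong_def h_def distrib_left mod_add_left_eq)
    finally show ?thesis
      by (simp add: cong_def h_def)
  qed
  have hq: "h (q t) = ex (h t)" if "t < ?d" for t
  proof -
    consider "t \<in> J" | "t \<notin> J" "t \<in> K" | "t \<notin> J" "t \<notin> K" by blast
    then show ?thesis
    proof cases
      case 1
      then have *: "h t < g * ?b" "h t mod ?b < \<iota>" by (auto simp: J_def)
      then have e: "ex (h t) = h t + \<kappa>" by (simp add: ex_def)
      moreover have "h t + \<kappa> < n"
        using ex_divmod(3)[OF *(1)] e assms(6) by simp
      ultimately show ?thesis
        using h_add[of t 1] 1 by (simp add: q_def)
    next
      case 2
      then have *: "h t < g * ?b" "\<not> h t mod ?b < \<iota>" by (auto simp: K_def)
      then have e: "ex (h t) = h t - \<iota>" by (simp add: ex_def)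
      have "\<iota> \<le> h t"
        using * mod_less_eq_dividend[of "h t" ?b] by linarith
      then have "h t + \<kappa> * a = (h t - \<iota>) + n * l"
        using assms(4) by simp
      then have "(h t + \<kappa> * a) mod n = (h t - \<iota>) mod n"
        by simp
      also have "\<dots> = h t - \<iota>"
        using hn[of t] by simp
      finally show ?thesis
        using h_add[of t a] 2 e by (simp add: q_def)
    next
      case 3
      moreover have "\<not> h t < g * ?b"
      proof
        assume "h t < g * ?b"
        moreover have "h t mod ?b < ?b" using assms(5) by simp
        ultimately show False
          using 3 that by (auto simp: J_def K_def)
      qed
      ultimately show ?thesis
        by (simp add: q_def ex_def)
    qed
  qed
  \<comment> \<open>For \<open>c > 1\<close> the map \<open>h\<close> is not injective. From
    \<open>h s = h t\<close> it only follows that \<open>s\<close> and \<open>t\<close> take the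
    same kind of step, and equal steps cancel modulo \<open>c * n\<close>.\<close>
  have "inj_on q {0..<?d}"
  proof (rule inj_onI)
    fix s t assume st: "s \<in> {0..<?d}" "t \<in> {0..<?d}" "q s = q t"
    then have "h s = h t"
      using hq[of s] hq[of t] ex_inj by (metis atLeastLessThan_iff)
    then have types: "s \<in> J \<longleftrightarrow> t \<in> J" "s \<in> K \<longleftrightarrow> t \<in> K"
      using st by (auto simp: J_def K_def)
    have shift: "s = t" if "(s + u) mod ?d = (t + u) mod ?d" for u
    proof -
      have "[s = t] (mod ?d)"
        using that cong_add_rcancel_nat[of s u t ?d] by (simp add: cong_def)
      then show ?thesis
        using st by (simp add: cong_def)
    qed
    show "s = t"
      using st(3) types shift[of 1] shift[of a] by (auto simp: q_def split: if_splits)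
  qed
  moreover have "q ` {0..<?d} \<subseteq> {0..<?d}"
    using d by (auto simp: q_def)
  ultimately have "bij_betw q {0..<?d} {0..<?d}"
    by (simp add: bij_betw_def endo_inj_surj)
  moreover have "q t = t" if "t \<notin> {0..<?d}" for t
    using that by (auto simp: q_def J_def K_def)
  ultimately have "q permutes {0..<?d}"
    by (intro bij_imp_permutes) auto
  moreover have "J \<inter> K = {}"
    by (auto simp: J_def K_def)
  ultimately have "shift_perm ?d a J K q"
    unfolding shift_perm_def by (auto simp: q_def J_def K_def)
  then show ?thesis
    using that cJ cK by blast
qed

text \<open>Origin of the parameters of the interval exchange: \<open>g = gcd k m\<close> divides
  \<open>j = d m - a k\<close>, and after division by \<open>g\<close>, \<open>c = gcd k' d\<close>
  divides \<open>j'\<close> for the same reason. What remains is \<open>\<kappa>\<close> coprime to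
  \<open>n = d / c\<close> with \<open>\<kappa> * a + \<iota> = n * m'\<close>. The step counts are
  \<open>c g \<iota> = j\<close> and \<open>c g \<kappa> = k\<close>, and
  \<open>j + k \<le> d\<close> says that the \<open>g\<close> blocks fit below
  \<open>n\<close>.\<close>

lemma shift_perm_exists:
  assumes "0 < d" "j + a * k = d * m" "j + k \<le> d"
  obtains J K p where "shift_perm d a J K p" "card J = j" "card K = k"
proof (cases "j + k = 0")
  case True
  then have "shift_perm d a {} {} id"
    by (simp add: shift_perm_def permutes_id)
  then show ?thesis
    using that True by auto
next
  case False
  define g where "g = gcd k m"
  have "g \<noteq> 0"
    using False assms by (auto simp: g_def)
  then obtain k' m' where km: "k = g * k'" "m = g * m'" "coprime k' m'"
    using gcd_coprime_exists[of k m] unfolding g_def by (metis mult.commute)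
  have "g dvd j"
  proof -
    have "g dvd d * m" "g dvd a * k"
      using km by simp_all
    then show ?thesis
      using assms(2) dvd_add_left_iff[of g "a * k" j] by simp
  qed
  then obtain j' where j: "j = g * j'" by auto
  have eq': "j' + a * k' = d * m'"
  proof -
    have "g * (j' + a * k') = g * (d * m')"
      using assms(2) by (simp add: km j algebra_simps)
    then show ?thesis using \<open>g \<noteq> 0\<close> by simp
  qed
  define c where "c = gcd k' d"
  have "c \<noteq> 0"
    using assms(1) by (auto simp: c_def)
  then obtain \<kappa> n where kn: "k' = c * \<kappa>" "d = c * n" "coprime \<kappa> n"
    using gcd_coprime_exists[of k' d] unfolding c_def by (metis mult.commute)
  have "c dvd j'"
  proof -
    have "c dvd j' + a * k'" "c dvd a * k'"
      using kn eq' by auto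
    then show ?thesis
      using dvd_add_left_iff by blast
  qed
  then obtain \<iota> where i: "j' = c * \<iota>" by auto
  have "c * (\<kappa> * a + \<iota>) = c * (n * m')"
    using eq' kn i by (simp add: algebra_simps)
  then have "\<kappa> * a + \<iota> = n * m'"
    using \<open>c \<noteq> 0\<close> by simp
  moreover have "0 < \<iota> + \<kappa>"
    using False km j kn i by (cases "\<iota> + \<kappa>") auto
  moreover have "c * (g * (\<iota> + \<kappa>)) \<le> c * n"
    using assms(3) km j kn i by (simp add: algebra_simps)
  then have "g * (\<iota> + \<kappa>) \<le> n"
    using \<open>c \<noteq> 0\<close> by simp
  moreover have "0 < n"
    using assms(1) kn by (cases n) auto
  moreover have "0 < c"
    using \<open>c \<noteq> 0\<close> by simp
  ultimately obtain J K p where "shift_perm (c * n) a J K p" "card J = c * (g * \<iota>)" "card K = c * (g * \<kappa>)"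
    using interval_exchange_shift_perm[of c n \<kappa> a \<iota> m' g] kn(3) by metis
  then show ?thesis
    using that kn km j i by (simp add: mult.left_commute)
qed

section \<open>Diagonalisation and expansion of the circulant matrix\<close>

lemma sum_powers_root_of_unity:
  fixes \<omega> :: "'b::idom"
  assumes "\<omega> ^ d = 1" "\<omega> ^ k \<noteq> 1"
  shows "(\<Sum>t<d. \<omega> ^ (k * t)) = 0"
proof -
  have "(\<omega> ^ k - 1) * (\<Sum>t<d. (\<omega> ^ k) ^ t) = (\<omega> ^ k) ^ d - 1"
    by (rule power_diff_1_eq[symmetric])
  also have "\<dots> = 0"
    using assms(1) by (simp flip: power_mult add: mult.commute[of k] power_mult)
  finally show ?thesis
    using assms(2) by (simp add: power_mult)
qed

text \<open>The columns of the Fourier matrix \<open>V\<close> are eigenvectors of the circulant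
  matrix \<open>C\<close>. Over a mere domain \<open>V\<close> need not have an inverse, so its
  determinant is cancelled; it is nonzero because \<open>V * V'\<close> is \<open>d\<close> times
  the identity. The domain will be the polynomial ring itself.\<close>

lemma prod_eq_circulant_expansion:
  fixes \<omega> x y z :: "'b::idom" and a d :: nat
  assumes root: "\<omega> ^ d = 1" and prim: "\<And>k. 0 < k \<Longrightarrow> k < d \<Longrightarrow> \<omega> ^ k \<noteq> 1"
    and char: "of_nat d \<noteq> (0 :: 'b)"
  defines "c \<equiv> \<lambda>i j. (if j = i then x else 0) + (if j = (i + 1) mod d then y else 0) +
    (if j = (i + a) mod d then z else 0)"
  shows "(\<Prod>t<d. x + \<omega> ^ t * y + \<omega> ^ (a * t) * z) =
    (\<Sum>p | p permutes {0..<d}. of_int (sign p) * (\<Prod>i<d. c i (p i)))"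
proof -
  have d: "0 < d"
    using char by (cases d) auto
  define C where "C = Matrix.mat d d (\<lambda>(i, j). c i j)"
  define V where "V = Matrix.mat d d (\<lambda>(i, t). \<omega> ^ (i * t))"
  \<comment> \<open>The exponent \<open>d - j\<close> stands for \<open>- j\<close>.\<close>
  define V' where "V' = Matrix.mat d d (\<lambda>(t, j). \<omega> ^ ((d - j) * t))"
  define D where "D = Matrix.mat d d (\<lambda>(s, t). if s = t then x + \<omega> ^ t * y + \<omega> ^ (a * t) * z else 0)"
  have carr: "C \<in> carrier_mat d d" "V \<in> carrier_mat d d" "V' \<in> carrier_mat d d" "D \<in> carrier_mat d d"
    by (auto simp: C_def V_def V'_def D_def)
  have power_mod: "\<omega> ^ (i mod d * t) = \<omega> ^ (i * t)" for i t
  proof -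
    have "i * t = d * (i div d * t) + i mod d * t"
      by (metis add_mult_distrib mult.assoc mult_div_mod_eq)
    then have "\<omega> ^ (i * t) = (\<omega> ^ d) ^ (i div d * t) * \<omega> ^ (i mod d * t)"
      by (metis power_add power_mult)
    then show ?thesis
      using root by simp
  qed
  have "C * V = V * D"
  proof (rule eq_matI)
    fix i t assume "i < dim_row (V * D)" "t < dim_col (V * D)"
    then have it: "i < d" "t < d"
      using carr by auto
    have "(C * V) $$ (i, t) = (\<Sum>j\<in>{0..<d}. c i j * \<omega> ^ (j * t))"
      using it by (simp add: C_def V_def scalar_prod_def)
    also have "\<dots> = (\<Sum>j\<in>{0..<d}. (if j = i then x * \<omega> ^ (j * t) else 0) +
        (if j = (i + 1) mod d then y * \<omega> ^ (j * t) else 0) +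
        (if j = (i + a) mod d then z * \<omega> ^ (j * t) else 0))"
      by (rule sum.cong) (auto simp: c_def algebra_simps)
    also have "\<dots> = x * \<omega> ^ (i * t) + y * \<omega> ^ ((i + 1) mod d * t) + z * \<omega> ^ ((i + a) mod d * t)"
      using it d by (simp add: sum.distrib sum.delta')
    also have "\<dots> = \<omega> ^ (i * t) * (x + \<omega> ^ t * y + \<omega> ^ (a * t) * z)"
      unfolding power_mod by (simp add: algebra_simps power_add)
    also have "\<dots> = (\<Sum>s\<in>{0..<d}. if s = t then \<omega> ^ (i * t) * (x + \<omega> ^ t * y + \<omega> ^ (a * t) * z) else 0)"
      using it by (simp add: sum.delta')
    also have "\<dots> = (\<Sum>s\<in>{0..<d}. \<omega> ^ (i * s) * (if s = t then x + \<omega> ^ t * y + \<omega> ^ (a * t) * z else 0))"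
      by (rule sum.cong) auto
    also have "\<dots> = (V * D) $$ (i, t)"
      using it by (simp add: V_def D_def scalar_prod_def)
    finally show "(C * V) $$ (i, t) = (V * D) $$ (i, t)" .
  qed (use carr in auto)
  then have "Determinant.det C * Determinant.det V = Determinant.det V * Determinant.det D"
    using det_mult[OF carr(1,2)] det_mult[OF carr(2,4)] by metis
  moreover have "Determinant.det V \<noteq> 0"
  proof -
    have "V * V' = of_nat d \<cdot>\<^sub>m 1\<^sub>m d"
    proof (rule eq_matI)
      fix i j assume "i < dim_row (of_nat d \<cdot>\<^sub>m 1\<^sub>m d :: 'b mat)" "j < dim_col (of_nat d \<cdot>\<^sub>m 1\<^sub>m d :: 'b mat)"
      then have ij: "i < d" "j < d"
        by auto
      have "(V * V') $$ (i, j) = (\<Sum>t<d. \<omega> ^ (i * t) * \<omega> ^ ((d - j) * t))"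
        using ij by (simp add: V_def V'_def scalar_prod_def lessThan_atLeast0)
      also have "\<dots> = (\<Sum>t<d. \<omega> ^ ((i + (d - j)) * t))"
        by (simp add: algebra_simps power_add)
      also have "\<dots> = (if i = j then of_nat d else 0)"
      proof (cases "i = j")
        case True
        then show ?thesis
          using ij root by (simp add: power_mult)
      next
        case False
        have "\<omega> ^ (i + (d - j)) \<noteq> 1"
        proof (cases "i < j")
          case True
          then show ?thesis
            using prim[of "i + (d - j)"] ij by auto
        next
          case F: False
          then have "i + (d - j) = (i - j) + d"
            using ij by simp
          then have "\<omega> ^ (i + (d - j)) = \<omega> ^ (i - j)"
            using root by (simp add: power_add)
          then show ?thesis
            using prim[of "i - j"] ij False F by auto
        qed
        then show ?thesis
          using sum_powers_root_of_unity[OF root] False by simp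
      qed
      also have "\<dots> = (of_nat d \<cdot>\<^sub>m 1\<^sub>m d) $$ (i, j)"
        using ij by simp
      finally show "(V * V') $$ (i, j) = (of_nat d \<cdot>\<^sub>m 1\<^sub>m d) $$ (i, j)" .
    qed (use carr in auto)
    then have "Determinant.det V * Determinant.det V' = of_nat d ^ d"
      using det_mult[OF carr(2,3)] by simp
    then show ?thesis
      using char by auto
  qed
  ultimately have "Determinant.det C = Determinant.det D"
    by (simp add: mult.commute)
  moreover have "Determinant.det D = (\<Prod>t<d. x + \<omega> ^ t * y + \<omega> ^ (a * t) * z)"
  proof -
    have "Determinant.det D = prod_list (diag_mat D)"
      using carr(4) by (intro det_upper_triangular) (auto simp: D_def)
    also have "\<dots> = (\<Prod>t<d. x + \<omega> ^ t * y + \<omega> ^ (a * t) * z)"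
      by (simp add: prod_list_diag_prod D_def lessThan_atLeast0)
    finally show ?thesis .
  qed
  moreover have "Determinant.det C = (\<Sum>p | p permutes {0..<d}. of_int (sign p) * (\<Prod>i<d. c i (p i)))"
    unfolding det_def'[OF carr(1)]
  proof (rule sum.cong)
    fix p assume "p \<in> {p. p permutes {0..<d}}"
    then have "p i < d" if "i < d" for i
      using that permutes_in_image[of p "{0..<d}" i] by simp
    then show "signof p * (\<Prod>i = 0..<d. C $$ (i, p i)) = of_int (sign p) * (\<Prod>i<d. c i (p i))"
      by (simp add: C_def lessThan_atLeast0)
  qed simp
  ultimately show ?thesis by simp
qed

text \<open>Recovers the step sets from \<open>p\<close>, so that the expansion is a sum over
  permutations and not over triples \<open>(J, K, p)\<close>.\<close>

definition unit_steps :: "nat \<Rightarrow> (nat \<Rightarrow> nat) \<Rightarrow> nat \<Rightarrow> nat set" where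
  "unit_steps d p u = {t. t < d \<and> p t = (t + u) mod d}"

abbreviation shift_perms :: "nat \<Rightarrow> nat \<Rightarrow> (nat \<Rightarrow> nat) set" where
  "shift_perms d a \<equiv> {p. shift_perm d a (unit_steps d p 1) (unit_steps d p a) p}"

lemma finite_shift_perms: "finite (shift_perms d a)"
  by (rule finite_subset[OF _ finite_permutations[of "{0..<d}"]]) (auto simp: shift_perm_def)

lemma steps_distinct:
  assumes "1 < a" "a < d" "t < d"
  shows "(t + 1) mod d \<noteq> t" "(t + a) mod d \<noteq> t" "(t + 1) mod d \<noteq> (t + a) mod (d::nat)"
  using assms by (auto simp: mod_less_double)

text \<open>The steps 0, 1 and \<open>a\<close> are distinct modulo \<open>d\<close>, so a point can
  be in only one of the three classes.\<close>

lemma shift_perm_unit_steps: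
  assumes "shift_perm d a J K p" "1 < a" "a < d"
  shows "J = unit_steps d p 1" "K = unit_steps d p a"
proof -
  have *: "J \<subseteq> {0..<d}" "K \<subseteq> {0..<d}" "J \<inter> K = {}" "\<And>t. t \<in> J \<Longrightarrow> p t = (t + 1) mod d"
    "\<And>t. t \<in> K \<Longrightarrow> p t = (t + a) mod d" "\<And>t. t < d \<Longrightarrow> t \<notin> J \<Longrightarrow> t \<notin> K \<Longrightarrow> p t = t"
    using assms(1) unfolding shift_perm_def by auto
  have "t \<in> J \<longleftrightarrow> p t = (t + 1) mod d" "t \<in> K \<longleftrightarrow> p t = (t + a) mod d" if "t < d" for t
    using steps_distinct[OF assms(2,3) that] *(3) *(4)[of t] *(5)[of t] *(6)[of t] that by (metis disjoint_iff)+
  then show "J = unit_steps d p 1" "K = unit_steps d p a"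
    using *(1,2) by (auto simp: unit_steps_def)
qed

text \<open>A permutation with any other step meets a zero entry of the matrix. For the rest,
  exactly one of the three summands of each entry is present, so the product is a single
  monomial.\<close>

lemma prod_eq_shift_perm_sum:
  fixes \<omega> x y z :: "'b::idom" and a d :: nat
  assumes root: "\<omega> ^ d = 1" and prim: "\<And>k. 0 < k \<Longrightarrow> k < d \<Longrightarrow> \<omega> ^ k \<noteq> 1"
    and char: "of_nat d \<noteq> (0 :: 'b)" and a: "1 < a" "a < d"
  shows "(\<Prod>t<d. x + \<omega> ^ t * y + \<omega> ^ (a * t) * z) =
    (\<Sum>p\<in>shift_perms d a. of_int (sign p) *
      (x ^ (d - card (unit_steps d p 1) - card (unit_steps d p a)) *
       y ^ card (unit_steps d p 1) * z ^ card (unit_steps d p a)))"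
proof -
  let ?c = "\<lambda>i j. (if j = i then x else 0) + (if j = (i + 1) mod d then y else 0) +
    (if j = (i + a) mod d then z else 0)"
  have sub: "shift_perms d a \<subseteq> {p. p permutes {0..<d}}"
    by (auto simp: shift_perm_def)
  have zero: "(\<Prod>i<d. ?c i (p i)) = 0" if "p permutes {0..<d}" "p \<notin> shift_perms d a" for p
  proof -
    have "\<exists>t<d. p t \<noteq> t \<and> p t \<noteq> (t + 1) mod d \<and> p t \<noteq> (t + a) mod d"
    proof (rule ccontr)
      assume "\<not> ?thesis"
      then have "p t = t \<or> p t = (t + 1) mod d \<or> p t = (t + a) mod d" if "t < d" for t
        using that by blast
      then have "shift_perm d a (unit_steps d p 1) (unit_steps d p a) p"
        unfolding shift_perm_def unit_steps_def using that(1) steps_distinct[OF a] by fastforce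
      then show False
        using that(2) by simp
    qed
    then show ?thesis
      by auto
  qed
  have summand: "(\<Prod>i<d. ?c i (p i)) = x ^ (d - card (unit_steps d p 1) - card (unit_steps d p a)) *
       y ^ card (unit_steps d p 1) * z ^ card (unit_steps d p a)" if "p \<in> shift_perms d a" for p
  proof -
    let ?J = "unit_steps d p 1" and ?K = "unit_steps d p a"
    have JK: "?J \<subseteq> {0..<d}" "?K \<subseteq> {0..<d}" "?J \<inter> ?K = {}" "\<And>t. t \<in> {0..<d} - ?J - ?K \<Longrightarrow> p t = t"
      using that unfolding shift_perm_def by auto
    have fin: "finite ?J" "finite ?K"
      using JK finite_subset by blast+
    have card_rest: "card ({0..<d} - (?J \<union> ?K)) = d - card ?J - card ?K"
      using fin JK by (simp add: card_Diff_subset card_Un_disjoint)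
    have "(\<Prod>i<d. ?c i (p i)) = (\<Prod>i\<in>{0..<d}. ?c i (p i))"
      by (simp add: lessThan_atLeast0)
    also have "{0..<d} = ({0..<d} - (?J \<union> ?K)) \<union> (?J \<union> ?K)"
      using JK by auto
    also have "(\<Prod>i\<in>\<dots>. ?c i (p i)) = (\<Prod>i\<in>{0..<d} - (?J \<union> ?K). ?c i (p i)) *
        ((\<Prod>i\<in>?J. ?c i (p i)) * (\<Prod>i\<in>?K. ?c i (p i)))"
      using fin JK(3) by (subst prod.union_disjoint) (auto simp: prod.union_disjoint)
    also have "(\<Prod>i\<in>?J. ?c i (p i)) = (\<Prod>i\<in>?J. y)"
    proof (rule prod.cong)
      fix t assume "t \<in> ?J"
      then have t: "t < d" "p t = (t + 1) mod d" by (auto simp: unit_steps_def)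
      show "?c t (p t) = y"
        unfolding t(2) using steps_distinct[OF a t(1)] by simp
    qed simp
    also have "(\<Prod>i\<in>?K. ?c i (p i)) = (\<Prod>i\<in>?K. z)"
    proof (rule prod.cong)
      fix t assume "t \<in> ?K"
      then have t: "t < d" "p t = (t + a) mod d" by (auto simp: unit_steps_def)
      show "?c t (p t) = z"
        unfolding t(2) using steps_distinct[OF a t(1)] by simp
    qed simp
    also have "(\<Prod>i\<in>{0..<d} - (?J \<union> ?K). ?c i (p i)) = (\<Prod>i\<in>{0..<d} - (?J \<union> ?K). x)"
    proof (rule prod.cong)
      fix t assume "t \<in> {0..<d} - (?J \<union> ?K)"
      then have t: "t < d" "p t = t" using JK(4) by auto
      show "?c t (p t) = x"
        unfolding t(2) using steps_distinct[OF a t(1)] by auto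
    qed simp
    finally show ?thesis
      using card_rest by (simp add: mult.assoc)
  qed
  have "(\<Sum>p | p permutes {0..<d}. of_int (sign p) * (\<Prod>i<d. ?c i (p i))) =
      (\<Sum>p\<in>shift_perms d a. of_int (sign p) * (\<Prod>i<d. ?c i (p i)))"
    using sub zero by (intro sum.mono_neutral_right) (auto simp: finite_permutations)
  also have "\<dots> = (\<Sum>p\<in>shift_perms d a. of_int (sign p) *
      (x ^ (d - card (unit_steps d p 1) - card (unit_steps d p a)) *
       y ^ card (unit_steps d p 1) * z ^ card (unit_steps d p a)))"
    using summand by (intro sum.cong) auto
  finally show ?thesis
    using prod_eq_circulant_expansion[OF root prim char, of x y a z] by simp
qed

section \<open>Polynomials in three variables\<close>

text \<open>Frees \<open>$\<close> for the entries of the fixed-size matrices in the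
  statement.\<close>

no_notation vec_index (infixl \<open>$\<close> 100)

abbreviation xmon :: "(3 \<Rightarrow>\<^sub>0 nat) \<Rightarrow> 'a::field poly3" where
  "xmon m \<equiv> Poly_Mapping.single m 1"

definition expo :: "nat \<Rightarrow> nat \<Rightarrow> nat \<Rightarrow> (3 \<Rightarrow>\<^sub>0 nat)" where
  "expo i j k = Poly_Mapping.single 1 i + Poly_Mapping.single 2 j + Poly_Mapping.single 3 k"

lemma lookup_expo [simp]:
  "Poly_Mapping.lookup (expo i j k) 1 = i"
  "Poly_Mapping.lookup (expo i j k) 2 = j"
  "Poly_Mapping.lookup (expo i j k) 3 = k"
  by (simp_all add: expo_def lookup_add lookup_single)

lemma exponent_eqI:
  fixes m n :: "3 \<Rightarrow>\<^sub>0 nat"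
  assumes "Poly_Mapping.lookup m 1 = Poly_Mapping.lookup n 1"
    "Poly_Mapping.lookup m 2 = Poly_Mapping.lookup n 2" "Poly_Mapping.lookup m 3 = Poly_Mapping.lookup n 3"
  shows "m = n"
proof (rule poly_mapping_eqI)
  fix i :: 3
  show "Poly_Mapping.lookup m i = Poly_Mapping.lookup n i"
    using assms exhaust_3[of i] by auto
qed

lemma expo_lookup [simp]:
  "expo (Poly_Mapping.lookup m 1) (Poly_Mapping.lookup m 2) (Poly_Mapping.lookup m 3) = m"
  by (rule exponent_eqI) simp_all

lemma expo_inject [simp]: "expo i j k = expo i' j' k' \<longleftrightarrow> i = i' \<and> j = j' \<and> k = k'"
  by (metis lookup_expo)

lemma expo_add: "expo i j k + expo i' j' k' = expo (i + i') (j + j') (k + k')"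
  by (rule exponent_eqI) (simp_all add: lookup_add)

lemma mdeg_eq: "mdeg m = Poly_Mapping.lookup m 1 + Poly_Mapping.lookup m 2 + Poly_Mapping.lookup m 3"
  by (simp add: mdeg_def sum_3)

lemma mdeg_expo [simp]: "mdeg (expo i j k) = i + j + k"
  by (simp add: mdeg_eq)

lemma mdeg_add [simp]: "mdeg (m + n) = mdeg m + mdeg n"
  by (simp add: mdeg_eq lookup_add)

lemma mdeg_zero [simp]: "mdeg 0 = 0"
  by (simp add: mdeg_eq)

lemma mdeg_eq_0_iff [simp]: "mdeg m = 0 \<longleftrightarrow> m = 0"
  by (auto simp: mdeg_eq intro!: exponent_eqI)

lemma finite_mdeg: "finite {m. mdeg m = d}"
proof (rule finite_subset)
  show "{m. mdeg m = d} \<subseteq> (\<lambda>(i, j, k). expo i j k) ` ({..d} \<times> {..d} \<times> {..d})"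
  proof
    fix m assume "m \<in> {m. mdeg m = d}"
    then show "m \<in> (\<lambda>(i, j, k). expo i j k) ` ({..d} \<times> {..d} \<times> {..d})"
      by (intro image_eqI[where x = "(Poly_Mapping.lookup m 1, Poly_Mapping.lookup m 2, Poly_Mapping.lookup m 3)"])
        (auto simp: mdeg_eq)
  qed
qed auto

text \<open>Monomials divisible by \<open>x\<close> correspond to those of degree \<open>n\<close>;
  the others are the \<open>n + 2\<close> monomials in \<open>y\<close> and \<open>z\<close>. For
  \<open>Suc n = d\<close> the dimension grows by \<open>d + 1\<close>.\<close>

lemma card_mdeg_Suc: "card {m. mdeg m = Suc n} = card {m. mdeg m = n} + (n + 2)"
proof -
  let ?A = "(\<lambda>m. expo 1 0 0 + m) ` {m. mdeg m = n}" and ?B = "(\<lambda>j. expo 0 j (Suc n - j)) ` {..Suc n}"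
  have "{m. mdeg m = Suc n} = ?A \<union> ?B"
  proof (intro equalityI subsetI)
    fix m assume m: "m \<in> {m. mdeg m = Suc n}"
    obtain i j k where ijk: "m = expo i j k"
      by (metis expo_lookup)
    show "m \<in> ?A \<union> ?B"
    proof (cases i)
      case 0
      then have "m = expo 0 j (Suc n - j)" "j \<le> Suc n"
        using m ijk by auto
      then show ?thesis by auto
    next
      case (Suc i')
      then have "m = expo 1 0 0 + expo i' j k" "mdeg (expo i' j k) = n"
        using m ijk by (auto simp: expo_add)
      then show ?thesis by blast
    qed
  qed auto
  moreover have "?A \<inter> ?B = {}"
  proof -
    have "Poly_Mapping.lookup (expo 1 0 0 + m) 1 \<noteq> Poly_Mapping.lookup (expo 0 j k) 1" for m j k
      by (simp add: lookup_add)
    then show ?thesis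
      by (metis (no_types, lifting) disjoint_iff imageE)
  qed
  moreover have "card ?A = card {m. mdeg m = n}"
    by (rule card_image) (auto intro: inj_onI)
  moreover have "card ?B = n + 2"
    by (subst card_image) (auto intro: inj_onI)
  ultimately show ?thesis
    using finite_mdeg by (simp add: card_Un_disjoint)
qed

lemma poly_mapping_sum_keys:
  fixes F :: "'k \<Rightarrow>\<^sub>0 'c::comm_monoid_add"
  assumes "finite A" "Poly_Mapping.keys F \<subseteq> A"
  shows "(\<Sum>m\<in>A. Poly_Mapping.single m (Poly_Mapping.lookup F m)) = F"
proof (rule poly_mapping_eqI)
  fix n
  have "(\<Sum>m\<in>A. if n = m then Poly_Mapping.lookup F m else 0) = Poly_Mapping.lookup F n"
    using assms by (auto simp: in_keys_iff)
  then show "Poly_Mapping.lookup (\<Sum>m\<in>A. Poly_Mapping.single m (Poly_Mapping.lookup F m)) n = Poly_Mapping.lookup F n"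
    by (simp add: lookup_sum lookup_single when_def eq_commute)
qed

lemma poly_mapping_add_induct [case_names single add]:
  fixes F :: "'k \<Rightarrow>\<^sub>0 'c::comm_monoid_add"
  assumes single: "\<And>m c. P (Poly_Mapping.single m c)" and add: "\<And>F G. P F \<Longrightarrow> P G \<Longrightarrow> P (F + G)"
  shows "P F"
proof -
  have "P (\<Sum>m\<in>A. Poly_Mapping.single m (Poly_Mapping.lookup F m))" if "finite A" for A
    using that
  proof (induction A rule: finite_induct)
    case empty
    show ?case using single[of _ 0] by simp
  qed (simp add: single add)
  from this[of "Poly_Mapping.keys F"] show ?thesis
    by (simp add: poly_mapping_sum_keys)
qed

lemma prod_single:
  fixes g :: "'i \<Rightarrow> 'c::comm_semiring_1" and f :: "'i \<Rightarrow> 'm::comm_monoid_add"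
  assumes "finite A"
  shows "(\<Prod>i\<in>A. Poly_Mapping.single (f i) (g i)) = Poly_Mapping.single (sum f A) (prod g A)"
  using assms by (induction A rule: finite_induct) (simp_all add: mult_single)

lemma power_single_single:
  fixes c :: "'c::comm_semiring_1"
  shows "Poly_Mapping.single (Poly_Mapping.single i (1::nat)) c ^ n = Poly_Mapping.single (Poly_Mapping.single i n) (c ^ n)"
  by (induction n) (simp_all add: mult_single flip: single_add)

lemma const_add: "const (b + c) = const b + const c"
  and const_mult: "const (b * c) = const b * const c"
  and const_0 [simp]: "const 0 = 0"
  and const_1 [simp]: "const 1 = 1"
  by (simp_all add: const_def single_add mult_single)

lemma const_power: "const (c ^ n) = const c ^ n"
  by (induction n) (simp_all add: const_mult)

lemma const_eq_1_iff [simp]: "const c = 1 \<longleftrightarrow> c = 1"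
  by (metis const_def lookup_single_eq const_1)

lemma const_of_int: "const (of_int n) = of_int n"
  by (simp add: const_def)

lemma const_mult_single: "const b * Poly_Mapping.single m c = Poly_Mapping.single m (b * c)"
  by (simp add: const_def mult_single)

lemma single_eq_const_mult: "Poly_Mapping.single m c = const c * xmon m"
  by (simp add: const_mult_single)

lemma lookup_single_mult:
  fixes F :: "'a::field poly3"
  shows "Poly_Mapping.lookup (Poly_Mapping.single m c * F) (m + n) = c * Poly_Mapping.lookup F n"
  by (induction F rule: poly_mapping_add_induct)
    (auto simp: mult_single lookup_single lookup_add distrib_left when_def)

lemma lookup_const_mult [simp]:
  "Poly_Mapping.lookup (const c * F) n = c * Poly_Mapping.lookup F n"
  using lookup_single_mult[of 0 c F n] by (simp add: const_def)

lemma keys_const_mult: "Poly_Mapping.keys (const c * F) \<subseteq> Poly_Mapping.keys F"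
  by (auto simp: in_keys_iff)

lemma xmon_expo: "xmon (expo i j k) = var 1 ^ i * var 2 ^ j * var 3 ^ k"
  by (simp add: var_def power_single_single[unfolded One_nat_def] mult_single expo_def)

lemma xmon_add: "xmon (m + n) = xmon m * xmon n"
  by (simp add: mult_single)

section \<open>Evaluation\<close>

definition monval :: "(3 \<Rightarrow> 'a::field) \<Rightarrow> (3 \<Rightarrow>\<^sub>0 nat) \<Rightarrow> 'a" where
  "monval v m = (\<Prod>i\<in>UNIV. v i ^ Poly_Mapping.lookup m i)"

lemma monval_eq:
  "monval v m = v 1 ^ Poly_Mapping.lookup m 1 * v 2 ^ Poly_Mapping.lookup m 2 * v 3 ^ Poly_Mapping.lookup m 3"
  unfolding monval_def UNIV_3 by (simp add: ac_simps)

lemma monval_expo: "monval v (expo i j k) = v 1 ^ i * v 2 ^ j * v 3 ^ k"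
  unfolding monval_eq lookup_expo ..

lemma monval_add: "monval v (m + n) = monval v m * monval v n"
  by (simp add: monval_def lookup_add power_add prod.distrib)

lemma monval_0 [simp]: "monval v 0 = 1"
  by (simp add: monval_def)

lemma monval_scale: "monval (\<lambda>i. c * v i) m = c ^ mdeg m * monval v m"
  by (simp add: monval_def mdeg_def power_mult_distrib prod.distrib power_sum)

lemma evalp_superset:
  assumes "finite A" "Poly_Mapping.keys F \<subseteq> A"
  shows "evalp F v = (\<Sum>m\<in>A. Poly_Mapping.lookup F m * monval v m)"
  unfolding evalp_def monval_def using assms
  by (intro sum.mono_neutral_left) (auto simp: in_keys_iff)

lemma evalp_single [simp]: "evalp (Poly_Mapping.single m c) v = c * monval v m"
  by (subst evalp_superset[of "{m}"]) auto

lemma evalp_0 [simp]: "evalp 0 v = 0"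
  by (simp add: evalp_def)

lemma evalp_add: "evalp (F + G) v = evalp F v + evalp G v"
proof -
  let ?A = "Poly_Mapping.keys F \<union> Poly_Mapping.keys G"
  have "Poly_Mapping.keys (F + G) \<subseteq> ?A"
    by (rule Poly_Mapping.keys_add)
  then show ?thesis
    by (simp add: evalp_superset[of ?A] lookup_add distrib_right sum.distrib)
qed

lemma evalp_mult: "evalp (F * G) v = evalp F v * evalp G v"
proof (induction F rule: poly_mapping_add_induct)
  case (single m c)
  show ?case
    by (induction G rule: poly_mapping_add_induct)
      (simp_all add: mult_single monval_add distrib_left evalp_add)
qed (simp add: distrib_right evalp_add)

lemma evalp_const [simp]: "evalp (const c) v = c"
  by (simp add: const_def)

lemma evalp_1 [simp]: "evalp 1 v = 1"
  using evalp_const[of 1 v] by simp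

lemma evalp_uminus: "evalp (- F) v = - evalp F v"
  using evalp_add[of F "- F" v] by (simp add: eq_neg_iff_add_eq_0 add.commute)

lemma evalp_diff: "evalp (F - G) v = evalp F v - evalp G v"
  using evalp_add[of F "- G" v] by (simp add: evalp_uminus)

lemma evalp_power: "evalp (F ^ n) v = evalp F v ^ n"
  by (induction n) (simp_all add: evalp_mult)

lemma evalp_sum: "evalp (sum f A) v = (\<Sum>i\<in>A. evalp (f i) v)"
  by (induction A rule: infinite_finite_induct) (simp_all add: evalp_add)

lemma evalp_prod: "evalp (prod f A) v = (\<Prod>i\<in>A. evalp (f i) v)"
  by (induction A rule: infinite_finite_induct) (simp_all add: evalp_mult)

lemma evalp_var [simp]: "evalp (var i) v = v i"
proof -
  have "(\<Prod>j\<in>UNIV. v j ^ Poly_Mapping.lookup (Poly_Mapping.single i (1::nat)) j) = (\<Prod>j\<in>UNIV. if j = i then v j else 1)"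
    by (rule prod.cong) (auto simp: lookup_single)
  then show ?thesis
    by (simp add: var_def monval_def)
qed

lemmas evalp_simps = evalp_add evalp_mult evalp_diff evalp_uminus evalp_power evalp_sum evalp_prod

lemma evalp_scale:
  assumes "F \<in> forms k"
  shows "evalp F (\<lambda>i. c * v i) = c ^ k * evalp F v"
  using assms by (simp add: evalp_superset[of "Poly_Mapping.keys F"] monval_scale forms_def sum_distrib_left mult.left_commute)

text \<open>Kronecker's substitution \<open>x = t, y = t\<^sup>B, z = t\<^bsup>B\<^sup>2\<^esup>\<close> keeps the monomials of \<open>F\<close> apart.\<close>

lemma evalp_eq_0_imp:
  fixes F :: "'a::{field, ring_char_0} poly3"
  assumes "\<And>v. evalp F v = 0"
  shows "F = 0"
proof -
  define B where "B = Suc (\<Sum>m\<in>Poly_Mapping.keys F. mdeg m)"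
  have small: "Poly_Mapping.lookup m i < B" if "m \<in> Poly_Mapping.keys F" for m i
  proof -
    have "Poly_Mapping.lookup m i \<le> mdeg m"
      unfolding mdeg_def by (rule member_le_sum) auto
    also have "\<dots> \<le> (\<Sum>m\<in>Poly_Mapping.keys F. mdeg m)"
      using that by (intro member_le_sum) auto
    finally show ?thesis by (simp add: B_def)
  qed
  \<comment> \<open>\<open>B\<close> exceeds every exponent in \<open>F\<close>, so the exponents
    are the base \<open>B\<close> digits of \<open>\<phi> m\<close> and can be read back.\<close>
  define \<phi> where "\<phi> m = Poly_Mapping.lookup m 1 + B * (Poly_Mapping.lookup m 2 + B * Poly_Mapping.lookup m 3)" for m :: "3 \<Rightarrow>\<^sub>0 nat"
  have inj: "m = n" if "m \<in> Poly_Mapping.keys F" "n \<in> Poly_Mapping.keys F" "\<phi> m = \<phi> n" for m n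
  proof -
    have digits: "(i + B * u) mod B = i" "(i + B * u) div B = u" if "i < B" for i u
      using that by auto
    have "Poly_Mapping.lookup m 1 = Poly_Mapping.lookup n 1"
      using that(3) digits(1) small that(1,2) unfolding \<phi>_def by metis
    moreover have *: "Poly_Mapping.lookup m 2 + B * Poly_Mapping.lookup m 3 = Poly_Mapping.lookup n 2 + B * Poly_Mapping.lookup n 3"
      using that(3) digits(2) small that(1,2) unfolding \<phi>_def by metis
    moreover have "Poly_Mapping.lookup m 2 = Poly_Mapping.lookup n 2"
      using * digits(1) small that(1,2) by metis
    moreover have "Poly_Mapping.lookup m 3 = Poly_Mapping.lookup n 3"
      using * digits(2) small that(1,2) by metis
    ultimately show ?thesis
      by (intro exponent_eqI)
  qed
  define P where "P = (\<Sum>m\<in>Poly_Mapping.keys F. Polynomial.monom (Poly_Mapping.lookup F m) (\<phi> m))"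
  have "poly P t = 0" for t
  proof -
    define v :: "3 \<Rightarrow> 'a" where "v i = (if i = 1 then t else if i = 2 then t ^ B else t ^ (B * B))" for i
    have v: "v 1 = t" "v 2 = t ^ B" "v 3 = t ^ (B * B)"
      by (simp_all add: v_def)
    have "poly P t = (\<Sum>m\<in>Poly_Mapping.keys F. Poly_Mapping.lookup F m * monval v m)"
      unfolding P_def poly_sum poly_monom
      by (rule sum.cong) (simp_all add: monval_eq v \<phi>_def power_add distrib_left mult.assoc flip: power_mult)
    also have "\<dots> = 0"
      using assms evalp_superset[of "Poly_Mapping.keys F" F v] by simp
    finally show ?thesis .
  qed
  then have "P = 0"
    using poly_all_0_iff_0 by blast
  have "Poly_Mapping.lookup F n = 0" if "n \<in> Poly_Mapping.keys F" for n
  proof -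
    have "0 = coeff P (\<phi> n)"
      using \<open>P = 0\<close> by simp
    also have "\<dots> = (\<Sum>m\<in>Poly_Mapping.keys F. if n = m then Poly_Mapping.lookup F m else 0)"
      unfolding P_def coeff_sum using inj that by (intro sum.cong) auto
    also have "\<dots> = Poly_Mapping.lookup F n"
      using that by simp
    finally show ?thesis by simp
  qed
  then show ?thesis
    by (metis in_keys_iff lookup_zero poly_mapping_eqI)
qed

lemma ex_evalp_nonzero:
  fixes F :: "'a::{field, ring_char_0} poly3"
  assumes "F \<noteq> 0"
  obtains v where "evalp F v \<noteq> 0"
  using evalp_eq_0_imp[of F] assms by blast

section \<open>Forms\<close>

lemma forms_0 [simp]: "0 \<in> forms k"
  by (simp add: forms_def)

lemma forms_single [simp]: "c \<noteq> 0 \<Longrightarrow> Poly_Mapping.single m c \<in> forms k \<longleftrightarrow> mdeg m = k"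
  by (simp add: forms_def)

lemma forms_xmon: "mdeg m = k \<Longrightarrow> Poly_Mapping.single m c \<in> forms k"
  by (cases "c = 0") simp_all

lemma forms_var [simp]: "var i \<in> forms 1"
  unfolding var_def using exhaust_3[of i]
  by (intro forms_xmon, unfold mdeg_def sum_3, elim disjE) (simp_all add: lookup_single)

lemma forms_const [simp]: "const c \<in> forms 0"
  unfolding const_def by (intro forms_xmon) simp

lemma forms_add: "F \<in> forms k \<Longrightarrow> G \<in> forms k \<Longrightarrow> F + G \<in> forms k"
  using Poly_Mapping.keys_add[of F G] by (auto simp: forms_def subset_iff)

lemma forms_uminus: "F \<in> forms k \<Longrightarrow> - F \<in> forms k"
  by (simp add: forms_def in_keys_iff)

lemma forms_diff: "F \<in> forms k \<Longrightarrow> G \<in> forms k \<Longrightarrow> F - G \<in> forms k"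
  using forms_add[of F k "- G"] forms_uminus by auto

lemma forms_mult: "F \<in> forms k \<Longrightarrow> G \<in> forms l \<Longrightarrow> F * G \<in> forms (k + l)"
  using Poly_Mapping.keys_mult[of F G] by (auto simp: forms_def subset_iff)

lemma forms_const_mult: "F \<in> forms k \<Longrightarrow> const c * F \<in> forms k"
  using forms_mult[OF forms_const] by simp

lemma forms_prod: "finite A \<Longrightarrow> (\<And>i. i \<in> A \<Longrightarrow> f i \<in> forms 1) \<Longrightarrow> prod f A \<in> forms (card A)"
proof (induction A rule: finite_induct)
  case empty
  show ?case using forms_const[of 1] by simp
next
  case (insert x A)
  then show ?case using forms_mult[of "f x" 1 "prod f A"] by simp
qed

lemma forms_power: "F \<in> forms d \<Longrightarrow> F ^ n \<in> forms (n * d)"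
proof (induction n)
  case 0
  show ?case using forms_const[of 1] by simp
next
  case (Suc n)
  then show ?case using forms_mult[of F d "F ^ n"] by simp
qed

section \<open>Diagonal substitutions\<close>

text \<open>What \<open>act\<close> becomes for a diagonal matrix (\<open>act_diagonal\<close>):
  monomials are eigenvectors, so it is computed coefficient by coefficient.\<close>

definition torus :: "(3 \<Rightarrow> 'a::field) \<Rightarrow> 'a poly3 \<Rightarrow> 'a poly3" where
  "torus u F = Poly_Mapping.mapp (\<lambda>m c. c * monval u m) F"

lemma lookup_torus [simp]: "Poly_Mapping.lookup (torus u F) m = Poly_Mapping.lookup F m * monval u m"
  by (auto simp: torus_def lookup_mapp when_def in_keys_iff)

lemma torus_single [simp]: "torus u (Poly_Mapping.single m c) = Poly_Mapping.single m (c * monval u m)"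
  by (rule poly_mapping_eqI) (auto simp: lookup_single when_def)

lemma torus_add: "torus u (F + G) = torus u F + torus u G"
  by (rule poly_mapping_eqI) (simp add: lookup_add distrib_right)

lemma torus_mult: "torus u (F * G) = torus u F * torus u G"
proof (induction F rule: poly_mapping_add_induct)
  case (single m c)
  show ?case
    by (induction G rule: poly_mapping_add_induct)
      (simp_all add: mult_single monval_add distrib_left distrib_right torus_add mult_ac)
qed (simp add: distrib_right torus_add)

lemma torus_prod: "torus u (prod f A) = (\<Prod>i\<in>A. torus u (f i))"
proof (induction A rule: infinite_finite_induct)
  case empty
  show ?case by (rule poly_mapping_eqI) (simp add: lookup_one when_def)
  case (infinite A)
  show ?case using infinite by (simp, intro poly_mapping_eqI) (simp add: lookup_one when_def)
qed (simp add: torus_mult)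

lemma torus_forms: "F \<in> forms k \<Longrightarrow> torus u F \<in> forms k"
  by (auto simp: forms_def in_keys_iff)

lemma evalp_torus: "evalp (torus u F) v = evalp F (\<lambda>i. u i * v i)"
proof (induction F rule: poly_mapping_add_induct)
  case (single m c)
  show ?case
    by (simp add: monval_def power_mult_distrib prod.distrib)
qed (simp add: torus_add evalp_add)

lemma monval_neq_0: "(\<And>i. u i \<noteq> 0) \<Longrightarrow> monval u m \<noteq> 0"
  by (simp add: monval_def)

lemma torus_eq_0_iff:
  assumes "\<And>i. u i \<noteq> 0"
  shows "torus u F = 0 \<longleftrightarrow> F = 0"
  using monval_neq_0[of u] assms by (simp add: poly_mapping_eq_iff fun_eq_iff)

lemma act_diagonal:
  assumes "\<And>i j. i \<noteq> j \<Longrightarrow> M $ i $ j = 0"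
  shows "act M F = torus (\<lambda>i. M $ i $ i) F"
proof -
  have row: "(\<Sum>j\<in>UNIV. const (M $ i $ j) * var j) = Poly_Mapping.single (Poly_Mapping.single i 1) (M $ i $ i)" for i
  proof -
    have "(\<Sum>j\<in>UNIV. const (M $ i $ j) * var j) = (\<Sum>j\<in>UNIV. if j = i then const (M $ i $ i) * var i else 0)"
      using assms by (intro sum.cong) auto
    then show ?thesis
      by (simp add: var_def const_mult_single)
  qed
  have exps: "(\<Sum>i\<in>UNIV. Poly_Mapping.single i (Poly_Mapping.lookup m i)) = m" for m :: "3 \<Rightarrow>\<^sub>0 nat"
    by (rule poly_mapping_sum_keys) auto
  have "act M F = (\<Sum>m\<in>Poly_Mapping.keys F. Poly_Mapping.single m (Poly_Mapping.lookup F m * monval (\<lambda>i. M $ i $ i) m))"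
    unfolding act_def row power_single_single prod_single[OF finite] exps const_mult_single monval_def ..
  also have "\<dots> = (\<Sum>m\<in>Poly_Mapping.keys F. Poly_Mapping.single m (Poly_Mapping.lookup (torus (\<lambda>i. M $ i $ i) F) m))"
    by simp
  also have "\<dots> = torus (\<lambda>i. M $ i $ i) F"
    by (rule poly_mapping_sum_keys) (auto simp: in_keys_iff)
  finally show ?thesis .
qed

section \<open>Ideals and spans\<close>

interpretation idl: Modules.module "(*) :: 'a::field poly3 \<Rightarrow> 'a poly3 \<Rightarrow> 'a poly3"
  by unfold_locales (simp_all add: algebra_simps)

text \<open>A second structure on the ring: dimension counts take place over K, while spans for
  \<open>idl\<close> are ideals.\<close>

interpretation KV: vector_space "\<lambda>(c::'a::field) (F::'a poly3). const c * F"
proof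
  fix b c :: 'a and F G :: "'a poly3"
  show "const c * (F + G) = const c * F + const c * G"
    by (rule distrib_left)
  show "const (b + c) * F = const b * F + const c * F"
    unfolding const_add by (rule distrib_right)
  show "const b * (const c * F) = const (b * c) * F"
    unfolding const_mult by (rule mult.assoc[symmetric])
  show "const 1 * F = F"
    unfolding const_1 by (rule mult_1)
qed

text \<open>With multiplication as scalar action these simplification rules would regroup nested
  products.\<close>

declare idl.scale_scale [simp del] KV.scale_scale [simp del]

lemma subspace_if_ideal: "is_ideal I \<Longrightarrow> KV.subspace I"
  by (simp add: KV.subspace_def idl.subspace_def)

text \<open>Polynomials all of whose terms are divisible by some generator form an ideal; conversely
  such a polynomial is the sum of its terms.\<close>

lemma ideal_gen_xmon:
  "(f::'a::field poly3) \<in> ideal_gen (xmon ` A) \<longleftrightarrow> (\<forall>m\<in>Poly_Mapping.keys f. \<exists>s\<in>A. \<exists>t. m = s + t)"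
proof
  have "is_ideal {f::'a poly3. \<forall>m\<in>Poly_Mapping.keys f. \<exists>s\<in>A. \<exists>t. m = s + t}" (is "is_ideal ?J")
  proof (rule idl.subspaceI)
    fix f g :: "'a poly3" assume "f \<in> ?J" "g \<in> ?J"
    then show "f + g \<in> ?J"
      using Poly_Mapping.keys_add[of f g] by blast
  next
    fix c f :: "'a poly3" assume f: "f \<in> ?J"
    have "\<exists>s\<in>A. \<exists>t. m = s + t" if "m \<in> Poly_Mapping.keys (c * f)" for m
    proof -
      obtain b n where "m = b + n" "n \<in> Poly_Mapping.keys f"
        using \<open>m \<in> _\<close> Poly_Mapping.keys_mult[of c f] by blast
      moreover from this f obtain s t where "s \<in> A" "n = s + t"
        by blast
      ultimately show ?thesis
        by (metis add.left_commute)
    qed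
    then show "c * f \<in> ?J" by blast
  qed simp
  moreover have "xmon ` A \<subseteq> ?J"
    by auto (metis add_0_right)
  ultimately show "f \<in> ideal_gen (xmon ` A) \<Longrightarrow> \<forall>m\<in>Poly_Mapping.keys f. \<exists>s\<in>A. \<exists>t. m = s + t"
    using idl.span_minimal by blast
next
  assume *: "\<forall>m\<in>Poly_Mapping.keys f. \<exists>s\<in>A. \<exists>t. m = s + t"
  have "(\<Sum>m\<in>Poly_Mapping.keys f. Poly_Mapping.single m (Poly_Mapping.lookup f m)) \<in> ideal_gen (xmon ` A)"
  proof (rule idl.span_sum)
    fix m assume "m \<in> Poly_Mapping.keys f"
    then obtain s t where st: "s \<in> A" "m = s + t"
      using * by blast
    have "Poly_Mapping.single m (Poly_Mapping.lookup f m) = Poly_Mapping.single t (Poly_Mapping.lookup f m) * xmon s"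
      by (simp add: st mult_single add.commute)
    then show "Poly_Mapping.single m (Poly_Mapping.lookup f m) \<in> ideal_gen (xmon ` A)"
      using st by (simp only:) (intro idl.span_scale idl.span_base imageI)
  qed
  then show "f \<in> ideal_gen (xmon ` A)"
    by (simp add: poly_mapping_sum_keys)
qed

lemma kspan_xmon: "KV.span (xmon ` A) = {f::'a::field poly3. Poly_Mapping.keys f \<subseteq> A}"
proof (intro equalityI subsetI)
  have "KV.subspace {f::'a poly3. Poly_Mapping.keys f \<subseteq> A}"
  proof (rule KV.subspaceI)
    fix f g :: "'a poly3" assume "f \<in> {f. Poly_Mapping.keys f \<subseteq> A}" "g \<in> {f. Poly_Mapping.keys f \<subseteq> A}"
    then show "f + g \<in> {f. Poly_Mapping.keys f \<subseteq> A}"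
      using Poly_Mapping.keys_add[of f g] by blast
  next
    fix c and f :: "'a poly3" assume "f \<in> {f. Poly_Mapping.keys f \<subseteq> A}"
    then show "const c * f \<in> {f. Poly_Mapping.keys f \<subseteq> A}"
      using keys_const_mult by blast
  qed simp
  moreover have "xmon ` A \<subseteq> {f::'a poly3. Poly_Mapping.keys f \<subseteq> A}"
    by auto
  ultimately show "f \<in> KV.span (xmon ` A) \<Longrightarrow> f \<in> {f::'a poly3. Poly_Mapping.keys f \<subseteq> A}" for f
    using KV.span_minimal by blast
next
  fix f :: "'a poly3" assume *: "f \<in> {f. Poly_Mapping.keys f \<subseteq> A}"
  have "(\<Sum>m\<in>Poly_Mapping.keys f. const (Poly_Mapping.lookup f m) * xmon m) \<in> KV.span (xmon ` A)"
    using * by (intro KV.span_sum KV.span_scale KV.span_base) auto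
  then show "f \<in> KV.span (xmon ` A)"
    by (simp add: const_mult_single poly_mapping_sum_keys)
qed

lemma inj_xmon: "inj (xmon :: _ \<Rightarrow> 'a::field poly3)"
  by (rule injI) (metis lookup_single_eq lookup_single_not_eq zero_neq_one)

lemma kindependent_xmon: "KV.independent (xmon ` A :: 'a::field poly3 set)"
proof
  assume "KV.dependent (xmon ` A :: 'a poly3 set)"
  then obtain m where m: "m \<in> A" "(xmon m :: 'a poly3) \<in> KV.span (xmon ` A - {xmon m})"
    unfolding KV.dependent_def by blast
  have "xmon ` A - {xmon m :: 'a poly3} = xmon ` (A - {m})"
    using inj_xmon by (auto simp: inj_def)
  then have "(xmon m :: 'a poly3) \<in> KV.span (xmon ` (A - {m}))"
    using m(2) by (simp only:)
  then show False
    by (simp add: kspan_xmon)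
qed

definition component :: "nat \<Rightarrow> 'a::field poly3 \<Rightarrow> 'a poly3" where
  "component d F = Poly_Mapping.mapp (\<lambda>m c. c when mdeg m = d) F"

lemma lookup_component [simp]:
  "Poly_Mapping.lookup (component d F) m = (if mdeg m = d then Poly_Mapping.lookup F m else 0)"
  by (auto simp: component_def lookup_mapp when_def in_keys_iff)

lemma component_add: "component d (F + G) = component d F + component d G"
  by (rule poly_mapping_eqI) (simp add: lookup_add)

lemma component_const_mult: "component d (const c * F) = const c * component d F"
  by (rule poly_mapping_eqI) simp

lemma component_forms: "F \<in> forms d \<Longrightarrow> component d F = F"
  by (rule poly_mapping_eqI) (auto simp: forms_def in_keys_iff)

text \<open>A nonconstant term of \<open>r\<close> lifts every term of \<open>F\<close> above degree
  \<open>d\<close>.\<close>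

lemma component_mult:
  assumes "\<And>m. m \<in> Poly_Mapping.keys F \<Longrightarrow> d \<le> mdeg m"
  shows "component d (r * F) = const (Poly_Mapping.lookup r 0) * component d F"
proof (induction r rule: poly_mapping_add_induct)
  case (single k c)
  show ?case
  proof (cases "k = 0")
    case True
    then show ?thesis
      using component_const_mult[of d c F] by (simp add: const_def)
  next
    case False
    have "mdeg m \<noteq> d" if m: "m \<in> Poly_Mapping.keys (Poly_Mapping.single k c * F)" for m
    proof -
      obtain b n where bn: "m = b + n" "b \<in> Poly_Mapping.keys (Poly_Mapping.single k c)" "n \<in> Poly_Mapping.keys F"
        using m Poly_Mapping.keys_mult[of "Poly_Mapping.single k c" F] by blast
      then have "b = k"
        by (auto split: if_splits)
      moreover have "mdeg k \<noteq> 0"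
        using False by simp
      ultimately show ?thesis
        using bn(1) assms[OF bn(3)] by (simp del: mdeg_eq_0_iff)
    qed
    then have "component d (Poly_Mapping.single k c * F) = 0"
      by (intro poly_mapping_eqI) (auto simp: in_keys_iff)
    then show ?thesis
      using False by (simp add: lookup_single)
  qed
qed (simp add: distrib_right component_add lookup_add const_add)

text \<open>In the lowest degree ring coefficients act through their constant terms, so ideal
  membership turns into membership in a K-span. The generators may be inhomogeneous, as
  \<open>mu\<close> allows. The degree bound is part of \<open>?J\<close> because
  \<open>component_mult\<close> needs it.\<close>

lemma component_ideal_gen:
  fixes S :: "'a::field poly3 set"
  assumes "\<And>s m. s \<in> S \<Longrightarrow> m \<in> Poly_Mapping.keys s \<Longrightarrow> d \<le> mdeg m" "F \<in> ideal_gen S"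
  shows "component d F \<in> KV.span (component d ` S)"
proof -
  let ?J = "{F. (\<forall>m\<in>Poly_Mapping.keys F. d \<le> mdeg m) \<and> component d F \<in> KV.span (component d ` S)}"
  have "is_ideal ?J"
  proof (rule idl.subspaceI)
    fix f g assume "f \<in> ?J" "g \<in> ?J"
    then show "f + g \<in> ?J"
      using Poly_Mapping.keys_add[of f g] by (auto simp: component_add KV.span_add)
  next
    fix c f assume f: "f \<in> ?J"
    have "d \<le> mdeg m" if m: "m \<in> Poly_Mapping.keys (c * f)" for m
    proof -
      obtain b n where "m = b + n" "n \<in> Poly_Mapping.keys f"
        using m Poly_Mapping.keys_mult[of c f] by blast
      then show ?thesis
        using f by (auto simp: trans_le_add2)
    qed
    then show "c * f \<in> ?J"
      using f component_mult[of f d c] KV.span_scale by auto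
  next
    have "component d 0 = (0 :: 'a poly3)"
      by (rule poly_mapping_eqI) simp
    then show "0 \<in> ?J"
      by (simp add: KV.span_zero)
  qed
  moreover have "S \<subseteq> ?J"
    using assms(1) by (auto intro: KV.span_base)
  ultimately show ?thesis
    using assms(2) idl.span_minimal by blast
qed

lemma ideal_gen_forms_kspan:
  assumes "S \<subseteq> forms d" "F \<in> ideal_gen S" "F \<in> forms d"
  shows "F \<in> KV.span S"
proof -
  have "component d F \<in> KV.span (component d ` S)"
    using assms(1,2) by (intro component_ideal_gen) (auto simp: forms_def)
  moreover have "component d ` S = S"
    using assms(1) component_forms by (force simp: image_def)
  ultimately show ?thesis
    using component_forms[OF assms(3)] by simp
qed

lemma KV_span_subset_ideal_gen: "KV.span S \<subseteq> ideal_gen S"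
  by (intro KV.span_minimal subspace_if_ideal idl.subspace_span) (rule idl.span_superset)

section \<open>Artinian quotients\<close>

text \<open>Start at an index of least dimension: a vector lost later would extend a basis of the
  smaller space to an independent set that is too large.\<close>

lemma kspace_chain_stable:
  fixes V :: "nat \<Rightarrow> 'a::field poly3 set"
  assumes sub: "\<And>n. KV.subspace (V n)" and dec: "\<And>n. V (Suc n) \<subseteq> V n"
    and fin: "finite T" "\<And>n. V n \<subseteq> KV.span T"
  shows "\<exists>N. \<forall>n\<ge>N. V n = V N"
proof -
  have "\<exists>N. \<forall>n. KV.dim (V N) \<le> KV.dim (V n)"
    using ex_has_least_nat[of "\<lambda>_. True" 0 "\<lambda>n. KV.dim (V n)"] by auto
  then obtain N where N: "\<And>n. KV.dim (V N) \<le> KV.dim (V n)"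
    by blast
  have basis: "\<exists>b\<subseteq>V n. finite b \<and> KV.independent b \<and> V n = KV.span b \<and> card b = KV.dim (V n)" for n
  proof -
    obtain b where b: "b \<subseteq> V n" "KV.independent b" "V n \<subseteq> KV.span b" "card b = KV.dim (V n)"
      using KV.basis_exists by blast
    moreover have "finite b"
      using KV.independent_span_bound[OF fin(1) b(2)] b(1) fin(2) by blast
    moreover have "KV.span b \<subseteq> V n"
      using KV.span_minimal[OF b(1) sub] .
    ultimately show ?thesis
      by blast
  qed
  have "V n = V N" if "N \<le> n" for n
  proof
    have "V (N + i) \<subseteq> V N" for i
      by (induction i) (use dec in auto)
    then show "V n \<subseteq> V N"
      using that by (metis le_add_diff_inverse)
    show "V N \<subseteq> V n"
    proof
      fix f assume f: "f \<in> V N"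
      obtain b where b: "b \<subseteq> V n" "finite b" "KV.independent b" "V n = KV.span b" "card b = KV.dim (V n)"
        using basis by blast
      obtain b' where b': "finite b'" "V N = KV.span b'" "card b' = KV.dim (V N)"
        using basis by blast
      show "f \<in> V n"
      proof (rule ccontr)
        assume *: "f \<notin> V n"
        then have "KV.independent (insert f b)"
          using b by (simp add: KV.independent_insert)
        moreover have "insert f b \<subseteq> KV.span b'"
          using f b(1) \<open>V n \<subseteq> V N\<close> b'(2) by auto
        ultimately have "card (insert f b) \<le> card b'"
          using KV.independent_span_bound[OF b'(1)] by blast
        moreover have "f \<notin> b"
          using * b(1) by blast
        ultimately show False
          using N[of n] b b' by simp
      qed
    qed
  qed
  then show ?thesis by blast
qed

text \<open>The finitely many monomials with all exponents below \<open>n\<close> span the ring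
  modulo \<open>I\<close>. An ideal containing \<open>I\<close> is therefore determined by its
  intersection with this finite-dimensional space.\<close>

lemma artinian_if_powers:
  fixes I :: "'a::field poly3 set"
  assumes I: "is_ideal I" and powers: "\<And>i. var i ^ n \<in> I"
  shows "artinian_ideal I"
  unfolding artinian_ideal_def
proof (intro conjI allI impI)
  fix J :: "nat \<Rightarrow> 'a poly3 set"
  assume J: "\<forall>n. is_ideal (J n) \<and> I \<subseteq> J n \<and> J (Suc n) \<subseteq> J n"
  define A where "A = {m :: 3 \<Rightarrow>\<^sub>0 nat. \<forall>i. Poly_Mapping.lookup m i < n}"
  have "finite A"
  proof (rule finite_subset)
    show "A \<subseteq> (\<lambda>(i, j, k). expo i j k) ` ({..<n} \<times> {..<n} \<times> {..<n})"
    proof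
      fix m assume "m \<in> A"
      then show "m \<in> (\<lambda>(i, j, k). expo i j k) ` ({..<n} \<times> {..<n} \<times> {..<n})"
        by (intro image_eqI[where x = "(Poly_Mapping.lookup m 1, Poly_Mapping.lookup m 2, Poly_Mapping.lookup m 3)"])
          (auto simp: A_def)
    qed
  qed auto
  let ?V = "KV.span (xmon ` A) :: 'a poly3 set"
  have split: "\<exists>f1 f2. f = f1 + f2 \<and> f1 \<in> ?V \<and> f2 \<in> I" for f :: "'a poly3"
  proof (induction f rule: poly_mapping_add_induct)
    case (single m c)
    show ?case
    proof (cases "m \<in> A")
      case True
      then have "Poly_Mapping.single m c \<in> ?V"
        unfolding kspan_xmon by auto
      then show ?thesis
        using idl.subspace_0[OF I] by (metis add_0_right)
    next
      case False
      then obtain i where "n \<le> Poly_Mapping.lookup m i"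
        by (auto simp: A_def not_less)
      then have "m = (m - Poly_Mapping.single i n) + Poly_Mapping.single i n"
        by (intro poly_mapping_eqI) (auto simp: lookup_add lookup_minus lookup_single when_def)
      then have "Poly_Mapping.single m c = Poly_Mapping.single (m - Poly_Mapping.single i n) c * xmon (Poly_Mapping.single i n)"
        by (metis mult.right_neutral mult_single)
      also have "xmon (Poly_Mapping.single i n) = (var i ^ n :: 'a poly3)"
        by (simp add: var_def power_single_single[unfolded One_nat_def])
      finally have "Poly_Mapping.single m c \<in> I"
        using idl.subspace_scale[OF I powers] by simp
      then show ?thesis
        using KV.span_zero by (metis add_0)
    qed
  next
    case (add F G)
    then obtain f1 f2 g1 g2 where "F = f1 + f2" "G = g1 + g2" "f1 \<in> ?V" "g1 \<in> ?V" "f2 \<in> I" "g2 \<in> I"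
      by blast
    then have "F + G = (f1 + g1) + (f2 + g2)" "f1 + g1 \<in> ?V" "f2 + g2 \<in> I"
      using KV.span_add idl.subspace_add[OF I] by (simp_all add: algebra_simps)
    then show ?case by blast
  qed
  have "\<exists>N. \<forall>n\<ge>N. J n \<inter> ?V = J N \<inter> ?V"
  proof (rule kspace_chain_stable[of _ "xmon ` A"])
    show "KV.subspace (J n \<inter> ?V)" for n
      using J KV.subspace_inter[OF subspace_if_ideal KV.subspace_span] by blast
    show "J (Suc n) \<inter> ?V \<subseteq> J n \<inter> ?V" for n
      using J by blast
    show "finite (xmon ` A)"
      using \<open>finite A\<close> by simp
  qed simp
  then obtain N where N: "\<And>n. n \<ge> N \<Longrightarrow> J n \<inter> ?V = J N \<inter> ?V"
    by blast
  have sub: "J k \<subseteq> J l" if "J k \<inter> ?V = J l \<inter> ?V" for k l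
  proof
    fix f assume f: "f \<in> J k"
    obtain f1 f2 where s: "f = f1 + f2" "f1 \<in> ?V" "f2 \<in> I"
      using split by blast
    have Jk: "is_ideal (J k)" "is_ideal (J l)" "I \<subseteq> J k" "I \<subseteq> J l"
      using J by blast+
    have "f1 = f - f2"
      using s by simp
    then have "f1 \<in> J k"
      using idl.subspace_diff[OF Jk(1) f, of f2] s(3) Jk(3) by auto
    then have "f1 \<in> J l"
      using s that by blast
    then show "f \<in> J l"
      using s Jk by (auto intro: idl.subspace_add)
  qed
  have "J n = J N" if "n \<ge> N" for n
    using sub[of n N] sub[of N n] N[OF that] by blast
  then show "\<exists>N. \<forall>n\<ge>N. J n = J N"
    by blast
qed (fact I)

section \<open>Multiplication maps\<close>

lemma residue_class_eq_iff:
  assumes "is_ideal I"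
  shows "residue_class I f = residue_class I g \<longleftrightarrow> f - g \<in> I"
proof
  assume "residue_class I f = residue_class I g"
  moreover have "f \<in> residue_class I f"
    using idl.subspace_0[OF assms] by (simp add: residue_class_def)
  ultimately show "f - g \<in> I"
    by (auto simp: residue_class_def)
next
  assume *: "f - g \<in> I"
  have "h - f \<in> I \<longleftrightarrow> h - g \<in> I" for h
  proof -
    have "h - g = (h - f) + (f - g)" "h - f = (h - g) - (f - g)"
      by simp_all
    then show ?thesis
      using * idl.subspace_add[OF assms] idl.subspace_diff[OF assms] by metis
  qed
  then show "residue_class I f = residue_class I g"
    by (simp add: residue_class_def)
qed

lemma mult_map_residue_class:
  assumes "is_ideal I"
  shows "mult_map I L (residue_class I f) = residue_class I (L * f)"
proof -
  have "residue_class I (L * g) = residue_class I (L * f)" if "g \<in> residue_class I f" for g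
  proof -
    have "L * g - L * f = L * (g - f)"
      by (simp add: algebra_simps)
    then show ?thesis
      using that idl.subspace_scale[OF assms] by (simp add: residue_class_eq_iff[OF assms]) (simp add: residue_class_def)
  qed
  moreover have "f \<in> residue_class I f"
    using idl.subspace_0[OF assms] by (simp add: residue_class_def)
  ultimately show ?thesis
    unfolding mult_map_def by blast
qed

lemma has_max_rank_mult_map:
  assumes I: "is_ideal I" and L: "L \<in> forms 1" and d: "0 < d"
  shows "has_max_rank (mult_map I L) (quot_piece I (d - 1)) (quot_piece I d) \<longleftrightarrow>
    (\<forall>f\<in>forms (d - 1). L * f \<in> I \<longrightarrow> f \<in> I) \<or> (\<forall>g\<in>forms d. \<exists>f\<in>forms (d - 1). g - L * f \<in> I)"
proof -
  have Lf: "L * f \<in> forms d" if "f \<in> forms (d - 1)" for f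
    using forms_mult[OF L that] d by simp
  have "inj_on (mult_map I L) (quot_piece I (d - 1)) \<longleftrightarrow> (\<forall>f\<in>forms (d - 1). L * f \<in> I \<longrightarrow> f \<in> I)"
  proof
    assume inj: "inj_on (mult_map I L) (quot_piece I (d - 1))"
    show "\<forall>f\<in>forms (d - 1). L * f \<in> I \<longrightarrow> f \<in> I"
    proof (intro ballI impI)
      fix f assume f: "f \<in> forms (d - 1)" "L * f \<in> I"
      then have "mult_map I L (residue_class I f) = mult_map I L (residue_class I 0)"
        by (simp add: mult_map_residue_class[OF I] residue_class_eq_iff[OF I])
      then have "residue_class I f = residue_class I 0"
        using inj f by (simp add: inj_on_def quot_piece_def)
      then show "f \<in> I"
        by (simp add: residue_class_eq_iff[OF I])
    qed
  next
    assume *: "\<forall>f\<in>forms (d - 1). L * f \<in> I \<longrightarrow> f \<in> I"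
    show "inj_on (mult_map I L) (quot_piece I (d - 1))"
    proof (rule inj_onI)
      fix C D assume CD: "C \<in> quot_piece I (d - 1)" "D \<in> quot_piece I (d - 1)" "mult_map I L C = mult_map I L D"
      then obtain f g where fg: "f \<in> forms (d - 1)" "g \<in> forms (d - 1)" "C = residue_class I f" "D = residue_class I g"
        by (auto simp: quot_piece_def)
      then have "L * f - L * g \<in> I"
        using CD(3) by (simp add: mult_map_residue_class[OF I] residue_class_eq_iff[OF I])
      then have "L * (f - g) \<in> I"
        by (simp add: algebra_simps)
      then have "f - g \<in> I"
        using * fg(1,2) forms_diff by blast
      then show "C = D"
        using fg by (simp add: residue_class_eq_iff[OF I])
    qed
  qed
  moreover have "mult_map I L ` quot_piece I (d - 1) = quot_piece I d \<longleftrightarrow>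
      (\<forall>g\<in>forms d. \<exists>f\<in>forms (d - 1). g - L * f \<in> I)"
  proof -
    have "mult_map I L ` quot_piece I (d - 1) = (\<lambda>f. residue_class I (L * f)) ` forms (d - 1)"
      by (simp add: quot_piece_def image_image mult_map_residue_class[OF I])
    also have "\<dots> = quot_piece I d \<longleftrightarrow> (\<forall>g\<in>forms d. \<exists>f\<in>forms (d - 1). residue_class I g = residue_class I (L * f))"
      using Lf by (auto simp: quot_piece_def image_iff) (metis imageI image_iff)+
    finally show ?thesis
      by (simp add: residue_class_eq_iff[OF I])
  qed
  ultimately show ?thesis
    by (simp add: has_max_rank_def)
qed

section \<open>The invariant monomials\<close>

locale diagonal_action =
  fixes d a :: nat and e :: "'a::{alg_closed_field, field_char_0}"
  assumes prim: "primitive_root_of_unity d e" and a_ge: "2 \<le> a" and a_le: "a \<le> d - 1"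
begin

lemma d_gt: "2 < d" and a_less: "a < d"
  using a_ge a_le by auto

lemma e_power_d: "e ^ d = 1"
  using prim by (simp add: primitive_root_of_unity_def)

lemma e_power_mod: "e ^ (k mod d) = e ^ k"
proof -
  have "e ^ k = e ^ (d * (k div d) + k mod d)"
    by simp
  also have "\<dots> = e ^ (k mod d)"
    unfolding power_add power_mult e_power_d by simp
  finally show ?thesis ..
qed

lemma e_power_eq_1_iff: "e ^ k = 1 \<longleftrightarrow> d dvd k"
proof -
  have "e ^ (k mod d) = 1 \<longleftrightarrow> k mod d = 0"
    using prim d_gt by (auto simp: primitive_root_of_unity_def)
  then show ?thesis
    by (simp add: e_power_mod dvd_eq_mod_eq_0)
qed

lemma e_neq_0 [simp]: "e \<noteq> 0"
  using e_power_d d_gt by (metis zero_neq_one power_0_left less_nat_zero_code)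

text \<open>The substitution \<open>M_matrix e a\<close> multiplies the monomial of exponent
  \<open>m\<close> by \<open>e ^ weight m\<close>.\<close>

definition weight :: "(3 \<Rightarrow>\<^sub>0 nat) \<Rightarrow> nat" where
  "weight m = Poly_Mapping.lookup m 2 + a * Poly_Mapping.lookup m 3"

definition inv_exps :: "(3 \<Rightarrow>\<^sub>0 nat) set" where
  "inv_exps = {m. mdeg m = d \<and> d dvd weight m}"

text \<open>The diagonal of the \<open>t\<close>-th power of \<open>M_matrix e a\<close>.\<close>

definition diag :: "nat \<Rightarrow> 3 \<Rightarrow> 'a" where
  "diag t i = (if i = 1 then 1 else if i = 2 then e ^ t else e ^ (a * t))"

lemma diag_simps [simp]: "diag t 1 = 1" "diag t 2 = e ^ t" "diag t 3 = e ^ (a * t)"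
  by (simp_all add: diag_def)

lemma diag_neq_0 [simp]: "diag t i \<noteq> 0"
  by (simp add: diag_def)

lemma diag_add: "diag (s + t) i = diag s i * diag t i"
  by (simp add: diag_def power_add algebra_simps)

lemma diag_mod: "diag (t mod d) = diag t"
proof
  fix i
  have "e ^ (a * (t mod d)) = e ^ (a * t)"
    using e_power_mod[of t] e_power_mod[of "a * t"] by (metis mod_mult_right_eq e_power_mod)
  then show "diag (t mod d) i = diag t i"
    by (simp add: diag_def e_power_mod)
qed

lemma monval_diag: "monval (diag t) m = (e ^ weight m) ^ t"
  by (simp add: monval_eq weight_def power_add power_mult_distrib flip: power_mult)
    (simp add: mult_ac)

lemma weight_expo [simp]: "weight (expo i j k) = j + a * k"
  by (simp add: weight_def)

lemma finite_inv_exps: "finite inv_exps"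
  by (rule finite_subset[OF _ finite_mdeg[of d]]) (auto simp: inv_exps_def)

lemma torus_diag_fixed_iff:
  "torus (diag 1) F = F \<longleftrightarrow> (\<forall>m\<in>Poly_Mapping.keys F. d dvd weight m)"
proof -
  have "torus (diag 1) F = F \<longleftrightarrow> (\<forall>m. Poly_Mapping.lookup F m * e ^ weight m = Poly_Mapping.lookup F m)"
    by (simp add: poly_mapping_eq_iff fun_eq_iff monval_diag)
  also have "\<dots> \<longleftrightarrow> (\<forall>m. Poly_Mapping.lookup F m \<noteq> 0 \<longrightarrow> d dvd weight m)"
    by (simp flip: e_power_eq_1_iff) metis
  finally show ?thesis
    by (auto simp: in_keys_iff)
qed

lemma keys_subset_inv_exps_iff:
  "Poly_Mapping.keys F \<subseteq> inv_exps \<longleftrightarrow> F \<in> forms d \<and> torus (diag 1) F = F"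
  unfolding torus_diag_fixed_iff by (auto simp: inv_exps_def forms_def)

definition rep_matrix :: "nat \<Rightarrow> 'a ^ 3 ^ 3" where
  "rep_matrix t = (\<chi> i j. if i = j then diag t i else 0)"

lemma act_rep_matrix: "act (rep_matrix t) F = torus (diag t) F"
  by (subst act_diagonal) (simp_all add: rep_matrix_def)

lemma M_matrix_eq: "M_matrix e a = rep_matrix 1"
proof -
  have "M_matrix e a $ i $ j = rep_matrix 1 $ i $ j" for i j
    using exhaust_3[of i] exhaust_3[of j]
    by (elim disjE) (simp_all add: M_matrix_def rep_matrix_def)
  then show ?thesis
    by (simp add: Finite_Cartesian_Product.vec_eq_iff)
qed

lemma invariant_forms_eq: "invariant_forms d {M_matrix e a} = {F. Poly_Mapping.keys F \<subseteq> inv_exps}"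
  by (auto simp: invariant_forms_def M_matrix_eq act_rep_matrix keys_subset_inv_exps_iff)

abbreviation I_inv :: "'a poly3 set" where
  "I_inv \<equiv> ideal_gen (xmon ` inv_exps)"

lemma ideal_gen_keys_subset: "ideal_gen {F :: 'a poly3. Poly_Mapping.keys F \<subseteq> A} = ideal_gen (xmon ` A)"
  using KV_span_subset_ideal_gen[of "xmon ` A"] kspan_xmon[of A]
  by (intro idl.span_eq[THEN iffD2] conjI) (auto intro: idl.span_base)

lemma I_ideal_eq: "I_ideal d e a = I_inv"
  unfolding I_ideal_def invariant_forms_eq by (rule ideal_gen_keys_subset)

lemma mdeg_ge_if_I_inv:
  assumes "A \<subseteq> inv_exps" "F \<in> ideal_gen (xmon ` A)" "m \<in> Poly_Mapping.keys F"
  shows "d \<le> mdeg m"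
proof -
  obtain s t where "s \<in> A" "m = s + t"
    using assms(2,3) unfolding ideal_gen_xmon by blast
  then show ?thesis
    using assms(1) by (auto simp: inv_exps_def)
qed

lemma forms_in_ideal_gen_iff:
  assumes "A \<subseteq> inv_exps" "F \<in> forms d"
  shows "F \<in> ideal_gen (xmon ` A) \<longleftrightarrow> Poly_Mapping.keys F \<subseteq> A"
proof
  have "xmon ` A \<subseteq> forms d"
    using assms(1) by (auto simp: inv_exps_def)
  then show "F \<in> ideal_gen (xmon ` A) \<Longrightarrow> Poly_Mapping.keys F \<subseteq> A"
    using ideal_gen_forms_kspan[of "xmon ` A" d F] assms(2) kspan_xmon[of A] by auto
next
  assume "Poly_Mapping.keys F \<subseteq> A"
  then show "F \<in> ideal_gen (xmon ` A)"
    unfolding ideal_gen_xmon by (metis add_0_right subsetD)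
qed

lemma low_degree_in_ideal_gen:
  assumes "A \<subseteq> inv_exps" "F \<in> forms (d - 1)" "F \<in> ideal_gen (xmon ` A)"
  shows "F = 0"
proof (rule ccontr)
  assume "F \<noteq> 0"
  then obtain m where "m \<in> Poly_Mapping.keys F"
    by (metis all_not_in_conv keys_eq_empty)
  then show False
    using mdeg_ge_if_I_inv[OF assms(1,3)] assms(2) d_gt by (fastforce simp: forms_def)
qed

section \<open>Counting the invariant monomials\<close>

text \<open>The residue of \<open>- a k\<close>: the exponent of \<open>y\<close> that invariance
  forces on a monomial with \<open>z\<close> exponent \<open>k\<close>. The outer \<open>mod\<close>
  turns the value \<open>d\<close> into 0.\<close>

definition res :: "nat \<Rightarrow> nat" where
  "res k = (d - a * k mod d) mod d"

lemma res_less: "res k < d"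
  using d_gt by (simp add: res_def)

lemma dvd_res: "d dvd res k + a * k"
proof -
  have "[res k + a * k = (d - a * k mod d) + a * k mod d] (mod d)"
    by (rule cong_add) (simp_all add: cong_def res_def)
  also have "(d - a * k mod d) + a * k mod d = d"
    using d_gt mod_less_divisor[of d "a * k"] by simp
  finally show ?thesis
    by (simp add: cong_def dvd_eq_mod_eq_0)
qed

lemma res_unique:
  assumes "j < d" "d dvd j + a * k"
  shows "j = res k"
proof -
  have "[j + a * k = res k + a * k] (mod d)"
    using assms(2) dvd_res[of k] by (simp add: cong_def dvd_eq_mod_eq_0)
  then have "[j = res k] (mod d)"
    using cong_add_rcancel_nat by blast
  then show ?thesis
    using assms(1) res_less by (simp add: cong_def)
qed

text \<open>The \<open>z\<close> exponents for which the forced \<open>y\<close> exponent leaves a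
  nonnegative exponent for \<open>x\<close>.\<close>

definition low :: "nat set" where
  "low = {k \<in> {1..<d}. res k + k \<le> d}"

text \<open>If \<open>k\<close> is neither 0 nor \<open>d\<close>, then \<open>j < d\<close> and
  \<open>k\<close> determines \<open>j\<close>. The remaining cases give the powers of the three
  variables.\<close>

lemma inv_exps_eq:
  "inv_exps = {expo d 0 0, expo 0 d 0, expo 0 0 d} \<union> (\<lambda>k. expo (d - res k - k) (res k) k) ` low"
proof (intro equalityI subsetI)
  fix m assume "m \<in> inv_exps"
  moreover obtain i j k where m: "m = expo i j k"
    by (metis expo_lookup)
  ultimately have *: "i + j + k = d" "d dvd j + a * k"
    by (auto simp: inv_exps_def)
  show "m \<in> {expo d 0 0, expo 0 d 0, expo 0 0 d} \<union> (\<lambda>k. expo (d - res k - k) (res k) k) ` low"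
  proof (cases "k = 0 \<or> k = d")
    case True
    then show ?thesis
    proof
      assume "k = 0"
      then have "d dvd j" "j \<le> d"
        using * by auto
      then have "j = 0 \<or> j = d"
        using d_gt by (auto elim!: dvdE)
      then show ?thesis
        using * m \<open>k = 0\<close> by auto
    qed (use * m in auto)
  next
    case False
    then have "j < d" using * by auto
    then have "j = res k"
      using *(2) by (rule res_unique)
    then show ?thesis
      using * m False by (intro UnI2 image_eqI[where x = k]) (auto simp: low_def)
  qed
next
  fix m assume "m \<in> {expo d 0 0, expo 0 d 0, expo 0 0 d} \<union> (\<lambda>k. expo (d - res k - k) (res k) k) ` low"
  then show "m \<in> inv_exps"
    using dvd_res by (auto simp: inv_exps_def low_def)
qed

lemma card_inv_exps: "card inv_exps = 3 + card low"
proof -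
  let ?A = "{expo d 0 0, expo 0 d 0, expo 0 0 d}" and ?B = "(\<lambda>k. expo (d - res k - k) (res k) k) ` low"
  have "card ?B = card low"
    by (rule card_image) (auto intro: inj_onI)
  moreover have "card ?A = 3"
    using d_gt by simp
  moreover have "?A \<inter> ?B = {}"
    by (auto simp: low_def)
  moreover have "finite low"
    by (simp add: low_def)
  ultimately show ?thesis
    unfolding inv_exps_eq by (subst card_Un_disjoint) auto
qed

text \<open>\<open>res k + res (d - k)\<close> is a multiple of \<open>d\<close> below
  \<open>2 * d\<close>, hence at most \<open>d\<close>; if both \<open>k\<close> and
  \<open>d - k\<close> violated the bound, it would exceed \<open>d\<close>.\<close>

lemma low_reflect:
  assumes "0 < k" "k < d"
  shows "k \<in> low \<or> d - k \<in> low"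
proof -
  have "d dvd (res k + a * k) + (res (d - k) + a * (d - k))"
    by (rule dvd_add[OF dvd_res dvd_res])
  also have "\<dots> = (res k + res (d - k)) + d * a"
  proof -
    have "a * k + a * (d - k) = d * a"
      using assms by (simp add: mult.commute[of d] flip: distrib_left)
    then show ?thesis by simp
  qed
  finally have "d dvd res k + res (d - k)"
    by (simp add: dvd_add_left_iff)
  moreover have "res k + res (d - k) < 2 * d"
    using res_less[of k] res_less[of "d - k"] by simp
  ultimately obtain q where q: "res k + res (d - k) = d * q" "d * q < d * 2"
    by (metis dvdE mult.commute)
  then have "q = 0 \<or> q = 1"
    by auto
  then have "res k + res (d - k) = 0 \<or> res k + res (d - k) = d"
    using q(1) by auto
  then show ?thesis
    using assms by (auto simp: low_def)
qed

lemma card_inv_exps_ge: "d div 2 + 3 \<le> card inv_exps"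
proof -
  let ?r = "(\<lambda>k. d - k) ` low"
  have fin: "finite low"
    by (simp add: low_def)
  have "{1..<d} \<subseteq> low \<union> ?r"
  proof
    fix k assume "k \<in> {1..<d}"
    then show "k \<in> low \<union> ?r"
      using low_reflect[of k] by (auto intro: image_eqI[where x = "d - k"])
  qed
  then have "card {1..<d} \<le> card (low \<union> ?r)"
    using fin by (intro card_mono) auto
  moreover have "card (low \<union> ?r) + card (low \<inter> ?r) = card low + card ?r"
    by (rule card_Un_Int[symmetric]) (use fin in auto)
  moreover have "card ?r \<le> card low"
    using fin by (rule card_image_le)
  \<comment> \<open>For even \<open>d\<close> the midpoint is its own mirror image.\<close>
  moreover have "even d \<Longrightarrow> 1 \<le> card (low \<inter> ?r)"
  proof -
    assume "even d"
    then obtain h where h: "d = 2 * h" by (elim evenE)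
    then have "h \<in> low"
      using low_reflect[of h] d_gt by auto
    then have "h \<in> low \<inter> ?r"
      using h by (auto intro: image_eqI[where x = h])
    then have "card (low \<inter> ?r) \<noteq> 0"
      using fin by (metis card_eq_0_iff empty_iff finite_Int)
    then show ?thesis by simp
  qed
  ultimately show ?thesis
    unfolding card_inv_exps by (cases "even d") (auto elim!: evenE oddE)
qed

text \<open>Here \<open>a \<ge> 2\<close> enters: \<open>k = d - 1\<close> forces the
  \<open>y\<close> exponent \<open>a\<close>, and \<open>a + (d - 1) > d\<close>. So
  \<open>low\<close> has at most \<open>d - 2\<close> elements.\<close>

lemma card_inv_exps_le: "card inv_exps \<le> d + 1"
proof -
  have "d dvd a + a * (d - 1)"
    using d_gt by (simp add: algebra_simps diff_mult_distrib2)
  then have "res (d - 1) = a"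
    using res_unique[of a "d - 1"] a_less by simp
  then have "d - 1 \<notin> low"
    using a_ge d_gt by (auto simp: low_def)
  have "low \<subseteq> {1..<d - 1}"
  proof
    fix k assume "k \<in> low"
    then have "1 \<le> k" "k < d" "k \<noteq> d - 1"
      using \<open>d - 1 \<notin> low\<close> by (auto simp: low_def)
    then show "k \<in> {1..<d - 1}"
      by simp
  qed
  then have "card low \<le> card {1..<d - 1}"
    by (intro card_mono) auto
  then show ?thesis
    unfolding card_inv_exps using d_gt by simp
qed

text \<open>The degree \<open>d\<close> components of any generators must span the invariant
  monomials over K, and these are independent.\<close>

lemma card_generators_ge:
  assumes "finite S" "ideal_gen S = I_inv"
  shows "card inv_exps \<le> card S"
proof -
  have deg: "d \<le> mdeg m" if "s \<in> S" "m \<in> Poly_Mapping.keys s" for s m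
    using mdeg_ge_if_I_inv[OF order_refl, of s m] that assms(2) idl.span_superset[of S] by blast
  have "xmon ` inv_exps \<subseteq> KV.span (component d ` S)"
  proof (rule image_subsetI)
    fix m assume m: "m \<in> inv_exps"
    then have "(xmon m :: 'a poly3) \<in> ideal_gen S"
      unfolding assms(2) by (intro idl.span_base imageI)
    then have "component d (xmon m) \<in> KV.span (component d ` S)"
      using component_ideal_gen[of S d] deg by blast
    then show "xmon m \<in> KV.span (component d ` S)"
      using m component_forms[of "xmon m :: 'a poly3" d] by (simp add: inv_exps_def)
  qed
  then have "card (xmon ` inv_exps :: 'a poly3 set) \<le> card (component d ` S)"
    using KV.independent_span_bound[OF finite_imageI[OF assms(1)] kindependent_xmon] by blast
  also have "\<dots> \<le> card S"
    using assms(1) by (rule card_image_le)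
  finally show ?thesis
    using card_image[OF inj_on_subset[OF inj_xmon subset_UNIV]] by metis
qed

lemma mu_I_inv_ge: "d div 2 + 3 \<le> mu I_inv"
proof -
  have "\<exists>n S. finite S \<and> card S = n \<and> ideal_gen S = I_inv"
    using finite_inv_exps by blast
  then have "\<exists>S. finite S \<and> card S = mu I_inv \<and> ideal_gen S = I_inv"
    unfolding mu_def by (rule LeastI_ex)
  then obtain S where S: "finite S" "card S = mu I_inv" "ideal_gen S = I_inv"
    by blast
  have "card inv_exps \<le> mu I_inv"
    using card_generators_ge[OF S(1,3)] S(2) by simp
  with card_inv_exps_ge show ?thesis
    by (rule order.trans)
qed

section \<open>The Togliatti property\<close>

text \<open>The norm of \<open>L\<close> for the cyclic group generated by
  \<open>M_matrix e a\<close>.\<close>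

definition orbit_prod :: "'a poly3 \<Rightarrow> 'a poly3" where
  "orbit_prod L = (\<Prod>t<d. torus (diag t) L)"

lemma torus_diag_0 [simp]: "torus (diag 0) F = F"
  by (rule poly_mapping_eqI) (simp add: monval_diag)

lemma torus_diag_diag: "torus (diag s) (torus (diag t) F) = torus (diag (s + t)) F"
  by (rule poly_mapping_eqI) (simp add: monval_diag power_add mult_ac)

lemma keys_orbit_prod:
  assumes "L \<in> forms 1"
  shows "Poly_Mapping.keys (orbit_prod L) \<subseteq> inv_exps"
  unfolding keys_subset_inv_exps_iff
proof
  show "orbit_prod L \<in> forms d"
    using forms_prod[of "{..<d}" "\<lambda>t. torus (diag t) L", OF _ torus_forms[OF assms]]
    by (simp add: orbit_prod_def)
  have "torus (diag 1) (orbit_prod L) = (\<Prod>t<d. torus (diag (Suc t)) L)"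
    by (simp add: orbit_prod_def torus_prod torus_diag_diag)
  \<comment> \<open>The shifted product trades the factor for \<open>t = 0\<close> for the one for
    \<open>t = d\<close>. Both equal \<open>L\<close>, which can be cancelled unless
    \<open>L = 0\<close>.\<close>
  moreover have "torus (diag 0) L * (\<Prod>t<d. torus (diag (Suc t)) L) = orbit_prod L * torus (diag d) L"
    unfolding orbit_prod_def
    using prod.lessThan_Suc[of "\<lambda>t. torus (diag t) L" d] prod.lessThan_Suc_shift[of "\<lambda>t. torus (diag t) L" d]
    by simp
  moreover have "torus (diag d) L = L"
    using diag_mod[of d] by (metis mod_self torus_diag_0)
  moreover have "orbit_prod 0 = 0" "(\<Prod>t<d. torus (diag (Suc t)) 0) = (0 :: 'a poly3)"
    using d_gt by (auto simp: orbit_prod_def torus_eq_0_iff prod_zero_iff)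
  ultimately show "torus (diag 1) (orbit_prod L) = orbit_prod L"
    by (cases "L = 0") (simp_all add: mult.commute[of _ L])
qed

lemma orbit_prod_factor:
  assumes "L \<in> forms 1" "L \<noteq> 0"
  obtains f where "f \<in> forms (d - 1)" "f \<noteq> 0" "L * f = orbit_prod L"
proof
  let ?f = "\<Prod>t\<in>{1..<d}. torus (diag t) L"
  show "?f \<in> forms (d - 1)"
    using forms_prod[of "{1..<d}" "\<lambda>t. torus (diag t) L", OF _ torus_forms[OF assms(1)]] by simp
  show "?f \<noteq> 0"
    using assms(2) by (simp add: torus_eq_0_iff)
  have "{..<d} = insert 0 {1..<d}"
    using d_gt by auto
  then show "L * ?f = orbit_prod L"
    by (simp add: orbit_prod_def)
qed

text \<open>\<open>forms 1\<close> contains 0, so \<open>L = 0\<close> is treated separately; there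
  every form of degree \<open>d - 1\<close> is in the kernel.\<close>

lemma kernel_nontrivial:
  assumes "L \<in> forms 1"
  obtains f where "f \<in> forms (d - 1)" "f \<noteq> 0" "L * f \<in> I_inv"
proof (cases "L = 0")
  case True
  have *: "(xmon (expo (d - 1) 0 0) :: 'a poly3) \<in> forms (d - 1)" "xmon (expo (d - 1) 0 0) \<noteq> (0 :: 'a poly3)"
    by (simp_all add: forms_xmon) (metis lookup_single_eq lookup_zero zero_neq_one)
  then show ?thesis
    using that[OF *] True by (simp add: idl.span_zero)
next
  case False
  then obtain f where f: "f \<in> forms (d - 1)" "f \<noteq> 0" "L * f = orbit_prod L"
    using orbit_prod_factor assms by blast
  moreover have "orbit_prod L \<in> I_inv"
    using keys_orbit_prod[OF assms] forms_in_ideal_gen_iff[OF order_refl] keys_subset_inv_exps_iff by blast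
  ultimately show ?thesis
    using that by metis
qed

text \<open>If the map were onto, the invariant monomials and the products of \<open>L\<close> with
  all monomials of degree \<open>d - 1\<close> would span the forms of degree \<open>d\<close>. A
  kernel element makes one of these products redundant, and then at most \<open>d + 1\<close> plus
  the number of the others is one too few.\<close>

lemma image_not_full:
  assumes "L \<in> forms 1"
  shows "\<exists>g\<in>forms d. \<forall>f\<in>forms (d - 1). g - L * f \<notin> I_inv"
proof (rule ccontr)
  assume "\<not> ?thesis"
  then have surj: "\<exists>f\<in>forms (d - 1). g - L * f \<in> I_inv" if "g \<in> forms d" for g
    using that by blast
  obtain f0 where f0: "f0 \<in> forms (d - 1)" "f0 \<noteq> 0" "L * f0 \<in> I_inv"
    using kernel_nontrivial[OF assms] .
  then obtain m0 where m0: "m0 \<in> Poly_Mapping.keys f0"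
    by (metis all_not_in_conv keys_eq_empty)
  define D where "D = {m :: 3 \<Rightarrow>\<^sub>0 nat. mdeg m = d - 1}"
  define Y where "Y = xmon ` inv_exps \<union> (\<lambda>m. L * xmon m) ` (D - {m0})"
  have fin: "finite D"
    by (simp add: D_def finite_mdeg)
  have forms_D: "Poly_Mapping.keys f \<subseteq> D" if "f \<in> forms (d - 1)" for f :: "'a poly3"
    using that by (auto simp: forms_def D_def)
  have Lf: "L * f \<in> forms d" if "f \<in> forms (d - 1)" for f
    using forms_mult[OF assms that] d_gt by simp
  have expand: "L * f = (\<Sum>m\<in>D. const (Poly_Mapping.lookup f m) * (L * xmon m))" if "f \<in> forms (d - 1)" for f
  proof -
    have *: "L * Poly_Mapping.single m c = const c * (L * xmon m)" for m and c :: 'a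
      by (subst single_eq_const_mult) (rule mult.left_commute)
    have "L * f = L * (\<Sum>m\<in>D. Poly_Mapping.single m (Poly_Mapping.lookup f m))"
      using poly_mapping_sum_keys[OF fin forms_D[OF that]] by simp
    also have "\<dots> = (\<Sum>m\<in>D. const (Poly_Mapping.lookup f m) * (L * xmon m))"
      unfolding sum_distrib_left by (rule sum.cong[OF refl *])
    finally show ?thesis .
  qed
  have inI: "F \<in> KV.span Y" if "F \<in> forms d" "F \<in> I_inv" for F
  proof -
    have "F \<in> KV.span (xmon ` inv_exps)"
      using that forms_in_ideal_gen_iff[OF order_refl that(1)] by (simp add: kspan_xmon)
    moreover have "xmon ` inv_exps \<subseteq> Y"
      by (simp add: Y_def)
    ultimately show ?thesis
      using KV.span_mono by blast
  qed
  have base: "L * xmon m \<in> KV.span Y" if "m \<in> D - {m0}" for m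
    using that by (intro KV.span_base) (auto simp: Y_def)
  have m0D: "m0 \<in> D"
    using m0 forms_D[OF f0(1)] by blast
  \<comment> \<open>Solve the kernel relation \<open>L * f0 \<in> I_inv\<close> for the term of
    \<open>m0\<close>, whose coefficient in \<open>f0\<close> is nonzero.\<close>
  have "L * xmon m0 \<in> KV.span Y"
  proof -
    let ?c = "Poly_Mapping.lookup f0 m0"
    have c: "?c \<noteq> 0"
      using m0 by (simp add: in_keys_iff)
    have "L * f0 = const ?c * (L * xmon m0) + (\<Sum>m\<in>D - {m0}. const (Poly_Mapping.lookup f0 m) * (L * xmon m))"
      unfolding expand[OF f0(1)] using fin m0D by (simp add: sum.remove)
    then have "const ?c * (L * xmon m0) = L * f0 - (\<Sum>m\<in>D - {m0}. const (Poly_Mapping.lookup f0 m) * (L * xmon m))"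
      by simp
    also have "\<dots> \<in> KV.span Y"
      using inI[OF Lf[OF f0(1)] f0(3)] base
      by (intro KV.span_diff KV.span_sum KV.span_scale) auto
    finally have "const (1 / ?c) * (const ?c * (L * xmon m0)) \<in> KV.span Y"
      by (rule KV.span_scale)
    moreover have "const (1 / ?c) * (const ?c * (L * xmon m0)) = const (1 / ?c * ?c) * (L * xmon m0)"
      unfolding const_mult by (simp only: mult.assoc)
    ultimately show ?thesis
      using c by simp
  qed
  then have all: "L * xmon m \<in> KV.span Y" if "m \<in> D" for m
    using that base by (cases "m = m0") auto
  have "xmon ` {m. mdeg m = d} \<subseteq> KV.span Y"
  proof
    fix g :: "'a poly3" assume "g \<in> xmon ` {m. mdeg m = d}"
    then have g: "g \<in> forms d"
      by auto
    then obtain f where f: "f \<in> forms (d - 1)" "g - L * f \<in> I_inv"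
      using surj by blast
    then have "g - L * f \<in> KV.span Y"
      using inI g Lf forms_diff by blast
    moreover have "L * f \<in> KV.span Y"
      unfolding expand[OF f(1)] using all by (intro KV.span_sum KV.span_scale) auto
    ultimately have "(g - L * f) + L * f \<in> KV.span Y"
      by (rule KV.span_add)
    then show "g \<in> KV.span Y"
      by simp
  qed
  moreover have "finite Y"
    using finite_inv_exps fin by (simp add: Y_def)
  ultimately have "card (xmon ` {m. mdeg m = d} :: 'a poly3 set) \<le> card Y"
    using KV.independent_span_bound[of Y "xmon ` {m. mdeg m = d}"]
    by (simp add: kindependent_xmon)
  moreover have "card (xmon ` {m. mdeg m = d} :: 'a poly3 set) = card {m :: 3 \<Rightarrow>\<^sub>0 nat. mdeg m = d}"
    by (rule card_image) (rule inj_on_subset[OF inj_xmon subset_UNIV])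
  moreover have "card Y \<le> card inv_exps + card (D - {m0})"
    unfolding Y_def using finite_inv_exps fin
    by (intro order.trans[OF card_Un_le] add_mono card_image_le) auto
  moreover have "card (D - {m0}) = card D - 1" "0 < card D"
    using fin m0D by (auto simp: card_gt_0_iff)
  moreover have "card {m :: 3 \<Rightarrow>\<^sub>0 nat. mdeg m = d} = card D + (d + 1)"
    using card_mdeg_Suc[of "d - 1"] d_gt by (simp add: D_def)
  ultimately show False
    using card_inv_exps_le by linarith
qed

lemma single_d_in_inv_exps: "Poly_Mapping.single i d \<in> inv_exps"
proof -
  have "Poly_Mapping.single i d \<in> {expo d 0 0, expo 0 d 0, expo 0 0 d}"
    using exhaust_3[of i] by (auto simp: expo_def)
  then show ?thesis
    unfolding inv_exps_eq by blast
qed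

lemma var_power_in_I_inv: "var i ^ d \<in> I_inv"
proof -
  have "var i ^ d = (xmon (Poly_Mapping.single i d) :: 'a poly3)"
    by (simp add: var_def power_single_single[unfolded One_nat_def])
  then show ?thesis
    using single_d_in_inv_exps by (simp only:) (intro idl.span_base imageI)
qed

lemma togliatti_I_inv: "togliatti_system d I_inv"
  unfolding togliatti_system_def
proof (intro conjI ballI)
  show "artinian_ideal I_inv"
    using var_power_in_I_inv by (intro artinian_if_powers idl.subspace_span)
  have "card (xmon ` inv_exps :: 'a poly3 set) \<le> d + 1"
    using card_image_le[OF finite_inv_exps] card_inv_exps_le by (rule order.trans)
  then show "\<exists>S. S \<subseteq> forms d \<and> finite S \<and> card S \<le> d + 1 \<and> ideal_gen S = I_inv"
    using finite_inv_exps by (intro exI[of _ "xmon ` inv_exps"]) (auto simp: inv_exps_def)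
  fix L :: "'a poly3" assume L: "L \<in> forms 1"
  obtain f where "f \<in> forms (d - 1)" "f \<noteq> 0" "L * f \<in> I_inv"
    using kernel_nontrivial[OF L] .
  then have "\<not> (\<forall>f\<in>forms (d - 1). L * f \<in> I_inv \<longrightarrow> f \<in> I_inv)"
    using low_degree_in_ideal_gen[OF order_refl] by blast
  then show "\<not> has_max_rank (mult_map I_inv L) (quot_piece I_inv (d - 1)) (quot_piece I_inv d)"
    using image_not_full[OF L] d_gt by (subst has_max_rank_mult_map[OF idl.subspace_span L]) auto
qed

lemma monomial_togliatti_I_inv: "monomial_togliatti d I_inv"
  using togliatti_I_inv by (auto simp: monomial_togliatti_def monomials_def intro!: exI[of _ "xmon ` inv_exps"])

end

section \<open>Minimality\<close>

context diagonal_action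
begin

definition sum_vars :: "'a poly3" where
  "sum_vars = var 1 + var 2 + var 3"

lemma sum_vars_forms: "sum_vars \<in> forms 1"
  unfolding sum_vars_def by (intro forms_add forms_var)

lemma evalp_sum_vars: "evalp sum_vars v = v 1 + v 2 + v 3"
  by (simp add: sum_vars_def evalp_add)

lemma sum_vars_neq_0: "sum_vars \<noteq> 0"
proof
  assume "sum_vars = 0"
  then have "evalp sum_vars (\<lambda>_. 1) = 0"
    by simp
  then show False
    by (simp add: evalp_sum_vars)
qed

lemma orbit_prod_sum_vars:
  "orbit_prod sum_vars = (\<Sum>p\<in>shift_perms d a. Poly_Mapping.single
     (expo (d - card (unit_steps d p 1) - card (unit_steps d p a)) (card (unit_steps d p 1)) (card (unit_steps d p a)))
     (of_int (sign p)))"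
proof -
  have torus_var: "torus (diag t) (var i) = const (diag t i) * var i" for t i
  proof -
    have "monval (diag t) (Poly_Mapping.single i 1) = diag t i"
      using evalp_var[of i "diag t"] by (simp add: var_def)
    then show ?thesis
      by (simp add: var_def const_mult_single)
  qed
  have factor: "torus (diag t) sum_vars = var 1 + const e ^ t * var 2 + const e ^ (a * t) * var 3" for t
    by (simp add: sum_vars_def torus_add torus_var const_power)
  have root: "const e ^ k = 1 \<longleftrightarrow> d dvd k" for k
    by (simp add: e_power_eq_1_iff flip: const_power)
  have "orbit_prod sum_vars = (\<Prod>t<d. var 1 + const e ^ t * var 2 + const e ^ (a * t) * var 3)"
    by (simp add: orbit_prod_def factor)
  also have "\<dots> = (\<Sum>p\<in>shift_perms d a. of_int (sign p) *
      (var 1 ^ (d - card (unit_steps d p 1) - card (unit_steps d p a)) *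
       var 2 ^ card (unit_steps d p 1) * var 3 ^ card (unit_steps d p a)))"
    using a_ge a_less d_gt by (intro prod_eq_shift_perm_sum) (auto simp: root dest: dvd_imp_le)
  also have "\<dots> = (\<Sum>p\<in>shift_perms d a. Poly_Mapping.single
     (expo (d - card (unit_steps d p 1) - card (unit_steps d p a)) (card (unit_steps d p 1)) (card (unit_steps d p a)))
     (of_int (sign p)))"
    by (rule sum.cong[OF refl]) (simp flip: xmon_expo const_of_int add: const_mult_single)
  finally show ?thesis .
qed

text \<open>Up to sign the coefficient is the number of permutations with \<open>j\<close> unit
  steps and \<open>k\<close> steps \<open>a\<close>: they share one sign by
  \<open>shift_perm_sign\<close>, and there is at least one by
  \<open>shift_perm_exists\<close>.\<close>

lemma lookup_orbit_prod_sum_vars: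
  assumes "m \<in> inv_exps"
  shows "Poly_Mapping.lookup (orbit_prod sum_vars) m \<noteq> 0"
proof -
  obtain i j k where m: "m = expo i j k"
    by (metis expo_lookup)
  then have ijk: "i + j + k = d" "d dvd j + a * k"
    using assms by (auto simp: inv_exps_def)
  then obtain q where q: "j + a * k = d * q"
    by (elim dvdE)
  let ?J = "\<lambda>p. unit_steps d p 1" and ?K = "\<lambda>p. unit_steps d p a"
  define P where "P = {p \<in> shift_perms d a. card (?J p) = j \<and> card (?K p) = k}"
  let ?\<epsilon> = "(-1) ^ ((d - 1) * q + k * (a + q)) :: 'a"
  have "Poly_Mapping.lookup (orbit_prod sum_vars) m = (\<Sum>p\<in>shift_perms d a. if p \<in> P then of_int (sign p) else 0)"
    unfolding orbit_prod_sum_vars lookup_sum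
  proof (rule sum.cong[OF refl])
    fix p assume "p \<in> shift_perms d a"
    then show "Poly_Mapping.lookup (Poly_Mapping.single (expo (d - card (?J p) - card (?K p)) (card (?J p)) (card (?K p)))
        (of_int (sign p))) m = (if p \<in> P then of_int (sign p) else 0)"
      using ijk(1) by (auto simp: m P_def lookup_single when_def)
  qed
  also have "\<dots> = (\<Sum>p\<in>P. of_int (sign p))"
    using finite_shift_perms by (intro sum.mono_neutral_cong_right) (auto simp: P_def)
  also have "\<dots> = (\<Sum>p\<in>P. ?\<epsilon>)"
  proof (rule sum.cong[OF refl])
    fix p assume "p \<in> P"
    then have "sign p = (-1) ^ ((d - 1) * q + k * (a + q))"
      using shift_perm_sign[of d a "?J p" "?K p" p q] q a_ge a_less by (simp add: P_def)
    then show "of_int (sign p) = ?\<epsilon>"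
      by simp
  qed
  also have "\<dots> = of_nat (card P) * ?\<epsilon>"
    by simp
  finally have eq: "Poly_Mapping.lookup (orbit_prod sum_vars) m = of_nat (card P) * ?\<epsilon>" .
  have "j + k \<le> d" "0 < d"
    using ijk d_gt by auto
  then obtain J K p where p: "shift_perm d a J K p" "card J = j" "card K = k"
    using shift_perm_exists q by blast
  moreover have "J = ?J p" "K = ?K p"
    using shift_perm_unit_steps[OF p(1)] a_ge a_less by auto
  ultimately have "p \<in> P"
    by (simp add: P_def)
  moreover have "finite P"
    using finite_shift_perms by (simp add: P_def)
  ultimately have "card P \<noteq> 0"
    by auto
  then show ?thesis
    by (simp add: eq)
qed

text \<open>
  As a polynomial in \<open>x\<close>, an invariant multiple of \<open>x + y + z\<close> vanishes at the \<open>d\<close> numbers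
  \<open>- (e\<^sup>t y + e\<^bsup>a t\<^esup> z)\<close>, which are distinct for general \<open>y\<close>, \<open>z\<close>.
\<close>

lemma invariant_multiple_eq_0:
  assumes keys: "Poly_Mapping.keys h \<subseteq> inv_exps" and x0: "Poly_Mapping.lookup h (expo d 0 0) = 0"
    and mult: "h = sum_vars * f"
  shows "h = 0"
proof -
  \<comment> \<open>Up to sign, the product of the differences of the \<open>d\<close> roots. Where
    it does not vanish the roots are distinct; multiplying \<open>h\<close> by \<open>Q\<close>
    covers the other points, so no density argument is needed.\<close>
  define Q :: "'a poly3" where "Q = (\<Prod>(s, t)\<in>{(s, t). s < t \<and> t < d}.
    const (e ^ s - e ^ t) * var 2 + const (e ^ (a * s) - e ^ (a * t)) * var 3)"
  have fin: "finite {(s, t). s < t \<and> t < d}"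
    by (rule finite_subset[of _ "{..<d} \<times> {..<d}"]) auto
  have e_inj: "e ^ s \<noteq> e ^ t" if "s < t" "t < d" for s t
  proof
    assume "e ^ s = e ^ t"
    also have "e ^ t = e ^ s * e ^ (t - s)"
      using that by (simp flip: power_add)
    finally have "e ^ (t - s) = 1"
      by simp
    then show False
      using that e_power_eq_1_iff[of "t - s"] by (auto dest: dvd_imp_le)
  qed
  have "Q \<noteq> 0"
  proof -
    have "const (e ^ s - e ^ t) * var 2 + const (e ^ (a * s) - e ^ (a * t)) * var 3 \<noteq> 0" if "s < t" "t < d" for s t
    proof
      assume "const (e ^ s - e ^ t) * var 2 + const (e ^ (a * s) - e ^ (a * t)) * var 3 = 0"
      then have "evalp (const (e ^ s - e ^ t) * var 2 + const (e ^ (a * s) - e ^ (a * t)) * var 3) (\<lambda>i. if i = 2 then 1 else 0) = 0"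
        by simp
      then show False
        using e_inj[OF that] by (simp add: evalp_simps)
    qed
    then show ?thesis
      using fin by (auto simp: Q_def)
  qed
  have "evalp (h * Q) v = 0" for v
  proof (cases "evalp Q v = 0")
    case False
    define \<rho> where "\<rho> t = - (e ^ t * v 2 + e ^ (a * t) * v 3)" for t
    have "\<rho> s \<noteq> \<rho> t" if "s < t" "t < d" for s t
    proof
      assume "\<rho> s = \<rho> t"
      then have "(e ^ s - e ^ t) * v 2 + (e ^ (a * s) - e ^ (a * t)) * v 3 = 0"
        by (simp add: \<rho>_def algebra_simps)
      moreover have "(\<Prod>(s, t)\<in>{(s, t). s < t \<and> t < d}. (e ^ s - e ^ t) * v 2 + (e ^ (a * s) - e ^ (a * t)) * v 3) = evalp Q v"
        by (auto simp: Q_def evalp_simps case_prod_unfold intro!: prod.cong)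
      ultimately have "evalp Q v = 0"
        using fin that by (metis (mono_tags, lifting) case_prodI mem_Collect_eq prod_zero_iff case_prod_conv)
      then show False
        using False by simp
    qed
    then have inj: "inj_on \<rho> {..<d}"
      by (intro linorder_inj_onI) auto
    define P where "P = (\<Sum>m\<in>Poly_Mapping.keys h. Polynomial.monom
      (Poly_Mapping.lookup h m * (v 2 ^ Poly_Mapping.lookup m 2 * v 3 ^ Poly_Mapping.lookup m 3)) (Poly_Mapping.lookup m 1))"
    define w where "w x i = (if i = 1 then x else v i)" for x and i :: 3
    have w: "w x 1 = x" "w x 2 = v 2" "w x 3 = v 3" for x
      by (simp_all add: w_def)
    have P: "poly P x = evalp h (w x)" for x
      unfolding P_def poly_sum poly_monom evalp_superset[OF finite_keys order_refl]
      by (rule sum.cong[OF refl]) (simp add: monval_eq w mult_ac)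
    have inv: "torus (diag t) h = h" for t
    proof (rule poly_mapping_eqI)
      fix m
      have "Poly_Mapping.lookup h m \<noteq> 0 \<Longrightarrow> e ^ weight m = 1"
        using keys by (auto simp: e_power_eq_1_iff inv_exps_def in_keys_iff)
      then show "Poly_Mapping.lookup (torus (diag t) h) m = Poly_Mapping.lookup h m"
        by (cases "Poly_Mapping.lookup h m = 0") (simp_all add: monval_diag)
    qed
    \<comment> \<open>By invariance \<open>h\<close> may be evaluated at the point moved by
      \<open>diag t\<close>, where \<open>x + y + z\<close> vanishes.\<close>
    have root: "poly P (\<rho> t) = 0" for t
    proof -
      have "poly P (\<rho> t) = evalp h (\<lambda>i. diag t i * w (\<rho> t) i)"
        unfolding P evalp_torus[symmetric] inv ..
      also have "\<dots> = 0"
        unfolding mult evalp_mult evalp_sum_vars by (simp add: w \<rho>_def)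
      finally show ?thesis .
    qed
    \<comment> \<open>Only the power \<open>x ^ d\<close> could contribute degree \<open>d\<close>,
      and its coefficient is 0 by \<open>x0\<close>.\<close>
    have "degree P < d"
    proof (rule degree_lessI)
      show "P \<noteq> 0 \<or> 0 < d" using d_gt by simp
      show "\<forall>k\<ge>d. coeff P k = 0"
      proof (intro allI impI)
        fix k assume "d \<le> k"
        have "Poly_Mapping.lookup m 1 \<noteq> k" if m: "m \<in> Poly_Mapping.keys h" for m
        proof
          assume "Poly_Mapping.lookup m 1 = k"
          moreover have "mdeg m = d"
            using m keys by (auto simp: inv_exps_def)
          ultimately have "m = expo d 0 0"
            using \<open>d \<le> k\<close> by (intro exponent_eqI) (auto simp: mdeg_eq)
          then show False
            using m x0 by (simp add: in_keys_iff)
        qed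
        then show "coeff P k = 0"
          unfolding P_def coeff_sum by (intro sum.neutral) simp
      qed
    qed
    have "P = 0"
    proof (rule ccontr)
      assume "P \<noteq> 0"
      have "card (\<rho> ` {..<d}) \<le> card {x. poly P x = 0}"
        using root poly_roots_finite[OF \<open>P \<noteq> 0\<close>] by (intro card_mono) auto
      also have "\<dots> \<le> degree P"
        using \<open>P \<noteq> 0\<close> by (rule card_poly_roots_bound)
      finally show False
        using \<open>degree P < d\<close> inj by (simp add: card_image)
    qed
    moreover have "w (v 1) = v"
      by (auto simp: w_def)
    ultimately have "evalp h v = 0"
      using P[of "v 1"] by simp
    then show ?thesis
      by (simp add: evalp_mult)
  qed (simp add: evalp_mult)
  then have "h * Q = 0"
    by (rule evalp_eq_0_imp)
  then show ?thesis
    using \<open>Q \<noteq> 0\<close> by simp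
qed

text \<open>Subtracting the multiple of \<open>orbit_prod sum_vars\<close> that kills the
  coefficient of \<open>x ^ d\<close> leaves 0. The product is therefore a scalar multiple of the
  norm, whose support is all of \<open>inv_exps\<close>; a monomial missing from \<open>A\<close>
  makes the scalar 0.\<close>

lemma invariant_multiple_support:
  assumes keys: "Poly_Mapping.keys (sum_vars * f) \<subseteq> A" and A: "A \<subset> inv_exps"
  shows "f = 0"
proof -
  let ?N = "orbit_prod sum_vars" and ?x = "expo d 0 0"
  have xd: "?x \<in> inv_exps"
    by (simp add: inv_exps_def)
  obtain fN where fN: "sum_vars * fN = ?N"
    using orbit_prod_factor[OF sum_vars_forms sum_vars_neq_0] by blast
  define c where "c = Poly_Mapping.lookup (sum_vars * f) ?x / Poly_Mapping.lookup ?N ?x"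
  define h where "h = sum_vars * f - const c * ?N"
  have look_h: "Poly_Mapping.lookup h m = Poly_Mapping.lookup (sum_vars * f) m - c * Poly_Mapping.lookup ?N m" for m
    by (simp add: h_def lookup_minus)
  have "h = 0"
  proof (rule invariant_multiple_eq_0)
    show "Poly_Mapping.keys h \<subseteq> inv_exps"
    proof
      fix m assume "m \<in> Poly_Mapping.keys h"
      then have "m \<in> Poly_Mapping.keys (sum_vars * f) \<or> m \<in> Poly_Mapping.keys ?N"
        using look_h[of m] by (auto simp: in_keys_iff)
      then show "m \<in> inv_exps"
        using keys A keys_orbit_prod[OF sum_vars_forms] by blast
    qed
    show "Poly_Mapping.lookup h ?x = 0"
      using lookup_orbit_prod_sum_vars[OF xd] by (simp add: look_h c_def)
    show "h = sum_vars * (f - const c * fN)"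
      by (simp add: h_def right_diff_distrib mult.left_commute[of sum_vars] fN)
  qed
  obtain m where m: "m \<in> inv_exps" "m \<notin> A"
    using A by blast
  then have "Poly_Mapping.lookup (sum_vars * f) m = 0"
    using keys by (auto simp: in_keys_iff)
  then have "c = 0"
    using look_h[of m] lookup_orbit_prod_sum_vars[OF m(1)] \<open>h = 0\<close> by simp
  then have "sum_vars * f = 0"
    using \<open>h = 0\<close> by (simp add: h_def)
  then show ?thesis
    using sum_vars_neq_0 by simp
qed

text \<open>One linear form suffices: for \<open>x + y + z\<close> the multiplication is injective,
  hence of maximal rank.\<close>

lemma not_togliatti_subset:
  assumes "A \<subset> inv_exps"
  shows "\<not> togliatti_system d (ideal_gen (xmon ` A) :: 'a poly3 set)"
proof
  let ?J = "ideal_gen (xmon ` A) :: 'a poly3 set"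
  assume "togliatti_system d ?J"
  then have "\<not> has_max_rank (mult_map ?J sum_vars) (quot_piece ?J (d - 1)) (quot_piece ?J d)"
    using sum_vars_forms by (simp add: togliatti_system_def)
  moreover have "f \<in> ?J" if f: "f \<in> forms (d - 1)" "sum_vars * f \<in> ?J" for f
  proof -
    have "sum_vars * f \<in> forms d"
      using forms_mult[OF sum_vars_forms f(1)] d_gt by simp
    then have "Poly_Mapping.keys (sum_vars * f) \<subseteq> A"
      using forms_in_ideal_gen_iff[of A "sum_vars * f"] f(2) assms by simp
    then have "f = 0"
      using invariant_multiple_support assms by blast
    then show ?thesis
      by (simp add: idl.span_zero)
  qed
  ultimately show False
    using d_gt by (subst (asm) has_max_rank_mult_map[OF idl.subspace_span sum_vars_forms]) auto
qed

text \<open>An invariant monomial of degree \<open>d\<close> is a multiple of some monomial in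
  \<open>S\<close>, which itself has degree at least \<open>d\<close>; so the two coincide.\<close>

lemma minimal_monomial_generators:
  assumes S: "S \<subseteq> monomials" and gen: "minimal_generators I_inv S"
  shows "S = xmon ` inv_exps"
proof -
  define E where "E = {m. (xmon m :: 'a poly3) \<in> S}"
  have SE: "S = xmon ` E"
    using S by (auto simp: E_def monomials_def)
  have span: "ideal_gen S = I_inv"
    using gen by (simp add: minimal_generators_def)
  have "inv_exps \<subseteq> E"
  proof
    fix m assume m: "m \<in> inv_exps"
    then have "(xmon m :: 'a poly3) \<in> ideal_gen (xmon ` E)"
      using span SE idl.span_base[of "xmon m" "xmon ` inv_exps"] by auto
    then obtain s t where st: "s \<in> E" "m = s + t"
      unfolding ideal_gen_xmon by auto
    have "(xmon s :: 'a poly3) \<in> I_inv"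
      using st(1) SE span idl.span_superset[of S] by auto
    then have "d \<le> mdeg s"
      using mdeg_ge_if_I_inv[OF order_refl, of "xmon s" s] by simp
    then have "mdeg t = 0"
      using m st(2) by (simp add: inv_exps_def del: mdeg_eq_0_iff)
    then show "m \<in> E"
      using st by simp
  qed
  then have sub: "xmon ` inv_exps \<subseteq> S"
    unfolding SE by (rule image_mono)
  show ?thesis
  proof (rule ccontr)
    assume "S \<noteq> xmon ` inv_exps"
    then have "xmon ` inv_exps \<subset> S"
      using sub by (intro psubsetI) auto
    then have "I_inv \<noteq> I_inv"
      using gen unfolding minimal_generators_def by (elim conjE allE impE)
    then show False
      by simp
  qed
qed

lemma minimal_monomial_togliatti_I_inv: "minimal_monomial_togliatti d I_inv"
  unfolding minimal_monomial_togliatti_def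
proof (intro conjI allI impI)
  fix S T :: "'a poly3 set" assume S: "S \<subseteq> monomials \<and> minimal_generators I_inv S" and T: "T \<subset> S"
  have S_eq: "S = xmon ` inv_exps"
    using S minimal_monomial_generators by blast
  obtain A where A: "A \<subseteq> inv_exps" "T = xmon ` A"
    using T unfolding S_eq by (metis psubset_imp_subset subset_imageE)
  then have "A \<subset> inv_exps"
    using T S_eq by blast
  then show "\<not> monomial_togliatti d (ideal_gen T)"
    using not_togliatti_subset A(2) by (simp add: monomial_togliatti_def)
qed (rule monomial_togliatti_I_inv)

end

section \<open>Finiteness of the associated morphism\<close>

lemma image_chart_ring_const: "Fract (const c) 1 \<in> image_chart_ring S F"
  and image_chart_ring_gen: "G \<in> S \<Longrightarrow> Fract G F \<in> image_chart_ring S F"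
  and image_chart_ring_add: "s \<in> image_chart_ring S F \<Longrightarrow> t \<in> image_chart_ring S F \<Longrightarrow> s + t \<in> image_chart_ring S F"
  and image_chart_ring_mult: "s \<in> image_chart_ring S F \<Longrightarrow> t \<in> image_chart_ring S F \<Longrightarrow> s * t \<in> image_chart_ring S F"
  by (auto simp: image_chart_ring_def)

lemma image_chart_ring_0: "0 \<in> image_chart_ring S F"
  using image_chart_ring_const[of 0] by (simp add: Zero_fract_def)

lemma image_chart_ring_1: "1 \<in> image_chart_ring S F"
  using image_chart_ring_const[of 1] by (simp add: One_fract_def)

text \<open>\<open>S\<close> may contain no monomials, but its K-span will contain the powers of the
  variables, and finiteness depends on these.\<close>

lemma image_chart_ring_span:
  assumes "F \<noteq> 0" "G \<in> KV.span S"
  shows "Fract G F \<in> image_chart_ring S F"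
proof -
  have "KV.subspace {G. Fract G F \<in> image_chart_ring S F}"
  proof (rule KV.subspaceI)
    show "0 \<in> {G. Fract G F \<in> image_chart_ring S F}"
      using image_chart_ring_0[of S F] assms(1) by (simp add: fract_collapse)
  next
    fix G H assume "G \<in> {G. Fract G F \<in> image_chart_ring S F}" "H \<in> {G. Fract G F \<in> image_chart_ring S F}"
    then have "Fract G F + Fract H F \<in> image_chart_ring S F"
      by (simp add: image_chart_ring_add)
    moreover have "Fract G F + Fract H F = Fract (G + H) F"
      using assms(1) by (simp add: eq_fract algebra_simps)
    ultimately show "G + H \<in> {G. Fract G F \<in> image_chart_ring S F}"
      by simp
  next
    fix c G assume "G \<in> {G. Fract G F \<in> image_chart_ring S F}"
    then have "Fract (const c) 1 * Fract G F \<in> image_chart_ring S F"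
      by (intro image_chart_ring_mult image_chart_ring_const) simp
    then show "const c * G \<in> {G. Fract G F \<in> image_chart_ring S F}"
      by simp
  qed
  moreover have "S \<subseteq> {G. Fract G F \<in> image_chart_ring S F}"
    using image_chart_ring_gen by blast
  ultimately have "KV.span S \<subseteq> {G. Fract G F \<in> image_chart_ring S F}"
    by (intro KV.span_minimal)
  then show ?thesis
    using assms(2) by blast
qed

lemma chart_ring_add:
  assumes F: "F \<in> forms d" "F \<noteq> 0" and s: "s \<in> chart_ring d F" and t: "t \<in> chart_ring d F"
  shows "s + t \<in> chart_ring d F"
proof -
  obtain g k h l where gh: "s = Fract g (F ^ k)" "g \<in> forms (k * d)" "t = Fract h (F ^ l)" "h \<in> forms (l * d)"
    using s t by (auto simp: chart_ring_def)
  have "g * F ^ l \<in> forms ((k + l) * d)" "h * F ^ k \<in> forms ((k + l) * d)"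
    using forms_mult[OF gh(2) forms_power[OF F(1)], of l] forms_mult[OF gh(4) forms_power[OF F(1)], of k]
    by (simp_all add: add_mult_distrib add.commute)
  then have "g * F ^ l + h * F ^ k \<in> forms ((k + l) * d)"
    by (rule forms_add)
  moreover have "s + t = Fract (g * F ^ l + h * F ^ k) (F ^ (k + l))"
    using F(2) by (simp add: gh(1,3) power_add)
  ultimately show ?thesis
    by (auto simp: chart_ring_def)
qed

lemma chart_ring_mult:
  assumes s: "s \<in> chart_ring d F" and t: "t \<in> chart_ring d F"
  shows "s * t \<in> chart_ring d F"
proof -
  obtain g k h l where gh: "s = Fract g (F ^ k)" "g \<in> forms (k * d)" "t = Fract h (F ^ l)" "h \<in> forms (l * d)"
    using s t by (auto simp: chart_ring_def)
  have "g * h \<in> forms ((k + l) * d)"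
    using forms_mult[OF gh(2,4)] by (simp add: add_mult_distrib)
  moreover have "s * t = Fract (g * h) (F ^ (k + l))"
    by (simp add: gh(1,3) power_add)
  ultimately show ?thesis
    by (auto simp: chart_ring_def)
qed

lemma chart_ring_const: "Fract (const c) 1 \<in> chart_ring d F"
proof -
  have "Fract (const c) 1 = Fract (const c) (F ^ 0)" "const c \<in> forms (0 * d)"
    by simp_all
  then show ?thesis
    unfolding chart_ring_def by blast
qed

lemma chart_ring_sum:
  assumes "F \<in> forms d" "F \<noteq> 0" "\<And>i. i \<in> A \<Longrightarrow> f i \<in> chart_ring d F"
  shows "sum f A \<in> chart_ring d F"
  using assms(3)
proof (induction A rule: infinite_finite_induct)
  case (infinite A)
  then show ?case using chart_ring_const[of 0] by (simp add: Zero_fract_def)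
next
  case empty
  then show ?case using chart_ring_const[of 0] by (simp add: Zero_fract_def)
next
  case (insert x A)
  then show ?case using chart_ring_add[OF assms(1,2)] by simp
qed

lemma image_chart_ring_subset:
  assumes F: "F \<in> forms d" "F \<noteq> 0" and S: "S \<subseteq> forms d"
  shows "image_chart_ring S F \<subseteq> chart_ring d F"
proof -
  have "Fract G F \<in> chart_ring d F" if "G \<in> S" for G
  proof -
    have "G \<in> forms (1 * d)" "Fract G F = Fract G (F ^ 1)"
      using that S by auto
    then show ?thesis
      unfolding chart_ring_def by blast
  qed
  then show ?thesis
    unfolding image_chart_ring_def using chart_ring_const chart_ring_add[OF F] chart_ring_mult
    by (intro Inter_lower) blast
qed

text \<open>Each \<open>var i ^ d / F\<close> lies in the ring of the image. Splitting such factors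
  off reduces every fraction with monomial numerator to one with all exponents below
  \<open>d\<close>, and only finitely many of these exist.\<close>

lemma finite_onto_image_if_powers:
  fixes S :: "'a::field poly3 set"
  assumes S: "S \<subseteq> forms d" "0 \<notin> S" and powers: "\<And>i. var i ^ d \<in> KV.span S" and d: "0 < d"
  shows "finite_onto_image d S"
  unfolding finite_onto_image_def
proof
  fix F assume "F \<in> S"
  then have F: "F \<in> forms d" "F \<noteq> 0"
    using S by auto
  let ?A = "image_chart_ring S F"
  define E where "E = {m :: 3 \<Rightarrow>\<^sub>0 nat. (\<forall>i. Poly_Mapping.lookup m i < d) \<and> d dvd mdeg m}"
  define B where "B = (\<lambda>m. Fract (xmon m) (F ^ (mdeg m div d))) ` E"
  let ?Z = "{\<Sum>b\<in>B. c b * b | c. \<forall>b\<in>B. c b \<in> ?A}"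
  have "finite E"
  proof (rule finite_subset)
    show "E \<subseteq> (\<lambda>(i, j, k). expo i j k) ` ({..<d} \<times> {..<d} \<times> {..<d})"
    proof
      fix m assume "m \<in> E"
      then show "m \<in> (\<lambda>(i, j, k). expo i j k) ` ({..<d} \<times> {..<d} \<times> {..<d})"
        by (intro image_eqI[where x = "(Poly_Mapping.lookup m 1, Poly_Mapping.lookup m 2, Poly_Mapping.lookup m 3)"])
          (auto simp: E_def)
    qed
  qed auto
  then have finB: "finite B"
    by (simp add: B_def)
  have xmon_chart: "Fract (xmon m) (F ^ (mdeg m div d)) \<in> chart_ring d F" if "d dvd mdeg m" for m
  proof -
    have "xmon m \<in> forms (mdeg m div d * d)"
      using that by simp
    then show ?thesis
      unfolding chart_ring_def by blast
  qed
  then have subB: "B \<subseteq> chart_ring d F"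
    by (auto simp: B_def E_def)
  have ZI: "\<alpha> * b \<in> ?Z" if "\<alpha> \<in> ?A" "b \<in> B" for \<alpha> b
  proof -
    have "\<alpha> * b = (\<Sum>b'\<in>B. (if b' = b then \<alpha> else 0) * b')"
      using finB that(2) by (simp add: if_distrib[of "\<lambda>x. x * _"] cong: if_cong)
    then show ?thesis
      using that(1) image_chart_ring_0
      by (auto intro!: exI[of _ "\<lambda>b'. if b' = b then \<alpha> else 0"])
  qed
  have Z_add: "s + t \<in> ?Z" if st: "s \<in> ?Z" "t \<in> ?Z" for s t
  proof -
    obtain c c' where c: "s = (\<Sum>b\<in>B. c b * b)" "\<forall>b\<in>B. c b \<in> ?A" "t = (\<Sum>b\<in>B. c' b * b)" "\<forall>b\<in>B. c' b \<in> ?A"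
      using st by blast
    then have "s + t = (\<Sum>b\<in>B. (c b + c' b) * b)" "\<forall>b\<in>B. c b + c' b \<in> ?A"
      by (auto simp: distrib_right sum.distrib intro: image_chart_ring_add)
    then show ?thesis
      by (intro CollectI exI[of _ "\<lambda>b. c b + c' b"] conjI) auto
  qed
  have monom_Z: "\<exists>\<alpha>\<in>?A. \<exists>b\<in>B. Fract (xmon m) (F ^ (mdeg m div d)) = \<alpha> * b" if "d dvd mdeg m" for m
    using that
  proof (induction "mdeg m" arbitrary: m rule: less_induct)
    case less
    show ?case
    proof (cases "m \<in> E")
      case True
      then show ?thesis
        using image_chart_ring_1 by (intro bexI[of _ 1] bexI[of _ "Fract (xmon m) (F ^ (mdeg m div d))"]) (auto simp: B_def)
    next
      case False
      then obtain i where i: "d \<le> Poly_Mapping.lookup m i"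
        using less(2) by (auto simp: E_def not_less)
      define m' where "m' = m - Poly_Mapping.single i d"
      have m: "m = Poly_Mapping.single i d + m'"
        using i by (intro poly_mapping_eqI) (auto simp: m'_def lookup_add lookup_minus lookup_single when_def)
      have "mdeg (Poly_Mapping.single i d) = d"
        using forms_power[OF forms_var, of i d] by (simp add: var_def power_single_single[unfolded One_nat_def])
      then have deg: "mdeg m = d + mdeg m'"
        using m by simp
      then have "d dvd mdeg m'" "mdeg m' < mdeg m"
        using less(2) d by (auto simp: dvd_add_right_iff)
      then obtain \<alpha> b where ab: "\<alpha> \<in> ?A" "b \<in> B" "Fract (xmon m') (F ^ (mdeg m' div d)) = \<alpha> * b"
        using less(1) by blast
      have "Fract (var i ^ d) F \<in> ?A"
        using image_chart_ring_span[OF F(2) powers] .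
      then have "Fract (var i ^ d) F * \<alpha> \<in> ?A"
        using ab(1) image_chart_ring_mult by blast
      moreover have "Fract (xmon m) (F ^ (mdeg m div d)) = Fract (var i ^ d) F * \<alpha> * b"
      proof -
        have "mdeg m div d = Suc (mdeg m' div d)"
          using deg d by simp
        moreover have "(xmon m :: 'a poly3) = var i ^ d * xmon m'"
          by (simp add: m xmon_add var_def power_single_single[unfolded One_nat_def])
        ultimately show ?thesis
          by (simp add: mult.assoc flip: ab(3))
      qed
      ultimately show ?thesis
        using ab(2) by blast
    qed
  qed
  have "chart_ring d F \<subseteq> ?Z"
  proof
    fix s assume "s \<in> chart_ring d F"
    then obtain g k where g: "s = Fract g (F ^ k)" "g \<in> forms (k * d)"
      by (auto simp: chart_ring_def)
    have "Fract (\<Sum>m\<in>M. Poly_Mapping.single m (Poly_Mapping.lookup g m)) (F ^ k) \<in> ?Z"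
      if "finite M" "M \<subseteq> {m. mdeg m = k * d}" for M
      using that
    proof (induction M rule: finite_induct)
      case empty
      have "0 \<in> ?Z"
        by (intro CollectI exI[of _ "\<lambda>_. 0"]) (simp add: image_chart_ring_0)
      then show ?case
        using F(2) by (simp add: fract_collapse)
    next
      case (insert m M)
      have "mdeg m div d = k" "d dvd mdeg m"
        using insert d by auto
      then obtain \<alpha> b where ab: "\<alpha> \<in> ?A" "b \<in> B" "Fract (xmon m) (F ^ k) = \<alpha> * b"
        using monom_Z by blast
      have "Fract (Poly_Mapping.single m (Poly_Mapping.lookup g m)) (F ^ k) =
          Fract (const (Poly_Mapping.lookup g m)) 1 * Fract (xmon m) (F ^ k)"
        by (simp add: const_mult_single)
      also have "\<dots> = (Fract (const (Poly_Mapping.lookup g m)) 1 * \<alpha>) * b"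
        by (simp add: ab(3) mult.assoc)
      also have "\<dots> \<in> ?Z"
        using ab by (intro ZI image_chart_ring_mult image_chart_ring_const)
      finally have "Fract (Poly_Mapping.single m (Poly_Mapping.lookup g m)) (F ^ k) +
          Fract (\<Sum>m\<in>M. Poly_Mapping.single m (Poly_Mapping.lookup g m)) (F ^ k) \<in> ?Z"
        using insert by (intro Z_add) auto
      moreover have "Fract G (F ^ k) + Fract H (F ^ k) = Fract (G + H) (F ^ k)" for G H
        using F(2) by (simp add: eq_fract algebra_simps)
      ultimately show ?case
        using insert(1,2) by simp
    qed
    from this[of "Poly_Mapping.keys g"] show "s \<in> ?Z"
      using g by (simp add: poly_mapping_sum_keys forms_def subset_iff)
  qed
  moreover have "?Z \<subseteq> chart_ring d F"
  proof clarify
    fix c assume "\<forall>b\<in>B. c b \<in> ?A"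
    then show "(\<Sum>b\<in>B. c b * b) \<in> chart_ring d F"
      using subB image_chart_ring_subset[OF F S(1)]
      by (intro chart_ring_sum[OF F] chart_ring_mult) auto
  qed
  ultimately show "\<exists>B. finite B \<and> B \<subseteq> chart_ring d F \<and>
      chart_ring d F = {\<Sum>b\<in>B. c b * b | c. \<forall>b\<in>B. c b \<in> ?A}"
    using finB subB by (intro exI[of _ B] conjI) auto
qed

section \<open>Points of projective space\<close>

lemma self_in_proj_point: "v \<in> proj_point v"
  unfolding proj_point_def by (intro CollectI exI[of _ 1]) simp

lemma proj_point_scale:
  assumes "c \<noteq> 0"
  shows "proj_point (\<lambda>i. c * v i) = proj_point v"
proof (intro equalityI subsetI)
  fix w assume "w \<in> proj_point (\<lambda>i. c * v i)"
  then obtain b where "w = (\<lambda>i. (b * c) * v i)" "b * c \<noteq> 0"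
    using assms by (auto simp: proj_point_def mult.assoc)
  then show "w \<in> proj_point v"
    unfolding proj_point_def by blast
next
  fix w assume "w \<in> proj_point v"
  then obtain b where "w = (\<lambda>i. b * v i)" "b \<noteq> 0"
    by (auto simp: proj_point_def)
  then have "w = (\<lambda>i. (b / c) * (c * v i))" "b / c \<noteq> 0"
    using assms by auto
  then show "w \<in> proj_point (\<lambda>i. c * v i)"
    unfolding proj_point_def by blast
qed

lemma proj_point_eq_iff: "proj_point v = proj_point w \<longleftrightarrow> (\<exists>c. c \<noteq> 0 \<and> w = (\<lambda>i. c * v i))"
proof
  assume "proj_point v = proj_point w"
  then have "w \<in> proj_point v"
    using self_in_proj_point by blast
  then show "\<exists>c. c \<noteq> 0 \<and> w = (\<lambda>i. c * v i)"
    by (auto simp: proj_point_def)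
qed (auto simp: proj_point_scale)

lemma proj_point_eqI:
  assumes "w \<in> proj_point v"
  shows "proj_point w = proj_point v"
proof -
  obtain c where "w = (\<lambda>i. c * v i)" "c \<noteq> 0"
    using assms by (auto simp: proj_point_def)
  then show ?thesis
    by (simp add: proj_point_scale)
qed

lemma P2_cases:
  assumes "p \<in> P2"
  obtains v where "p = proj_point v" "v \<noteq> (\<lambda>_. 0)"
  using assms by (auto simp: proj_space_def)

lemma proj_point_in_P2: "v \<noteq> (\<lambda>_. 0) \<Longrightarrow> proj_point v \<in> P2"
  by (auto simp: proj_space_def)

lemma P2_member:
  assumes "p \<in> P2" "v \<in> p"
  shows "p = proj_point v" "v \<noteq> (\<lambda>_. 0)"
proof -
  obtain w where w: "p = proj_point w" "w \<noteq> (\<lambda>_. 0)"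
    using assms(1) by (rule P2_cases)
  then show "p = proj_point v"
    using assms(2) proj_point_eqI by blast
  obtain c where "v = (\<lambda>i. c * w i)" "c \<noteq> 0"
    using assms(2) w(1) by (auto simp: proj_point_def)
  then show "v \<noteq> (\<lambda>_. 0)"
    using w(2) by (auto simp: fun_eq_iff)
qed

lemma zariski_open_P2: "zariski_open (P2 :: (3 \<Rightarrow> 'a::field) set set)"
  unfolding zariski_open_def
  by (intro exI[of _ "{1}"] conjI) (use forms_const[of 1] in auto)

lemma regular_map_global:
  fixes G :: "'i \<Rightarrow> 'a::field poly3"
  assumes "\<And>i. i \<in> A \<Longrightarrow> G i \<in> forms k"
    and nz: "\<And>v. v \<noteq> (\<lambda>_. 0) \<Longrightarrow> \<exists>i\<in>A. evalp (G i) v \<noteq> 0"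
    and f: "\<And>v. v \<noteq> (\<lambda>_. 0) \<Longrightarrow> f (proj_point v) = proj_point (\<lambda>i. if i \<in> A then evalp (G i) v else 0)"
  shows "regular_map A f"
  unfolding regular_map_def
proof (intro conjI ballI)
  show "f \<in> P2 \<rightarrow> proj_space A"
  proof
    fix p :: "(3 \<Rightarrow> 'a) set" assume "p \<in> P2"
    then obtain v where v: "p = proj_point v" "v \<noteq> (\<lambda>_. 0)"
      by (rule P2_cases)
    then show "f p \<in> proj_space A"
      using nz[OF v(2)] unfolding v(1) f[OF v(2)] proj_space_def
      by (intro imageI) (auto simp: fun_eq_iff)
  qed
  have local: "(\<exists>i\<in>A. evalp (G i) v \<noteq> 0) \<and> f q = proj_point (\<lambda>i. if i \<in> A then evalp (G i) v else 0)"
    if "q \<in> P2" "v \<in> q" for q v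
    using nz f P2_member[OF that] by blast
  fix p :: "(3 \<Rightarrow> 'a) set" assume "p \<in> P2"
  then show "\<exists>U. zariski_open U \<and> p \<in> U \<and> (\<exists>k G. (\<forall>i\<in>A. G i \<in> forms k) \<and>
      (\<forall>q\<in>U. \<forall>v\<in>q. (\<exists>i\<in>A. evalp (G i) v \<noteq> 0) \<and> f q = proj_point (\<lambda>i. if i \<in> A then evalp (G i) v else 0)))"
    using assms(1) local
    by (intro exI[of _ P2] conjI zariski_open_P2 exI[of _ k] exI[of _ G] ballI) (simp_all only: local)
qed

context diagonal_action
begin

section \<open>Fibres\<close>

lemma e_power_inj:
  assumes "e ^ s = e ^ t" "s < d" "t < d"
  shows "s = t"
proof -
  have "e ^ (s + (d - t)) = e ^ (t + (d - t))"
    unfolding power_add assms(1) ..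
  also have "\<dots> = 1"
    using assms(3) by (simp add: e_power_d)
  finally have "d dvd s + (d - t)"
    by (simp only: e_power_eq_1_iff)
  show ?thesis
  proof (cases "t \<le> s")
    case True
    then have "s + (d - t) = (s - t) + d"
      using assms(3) by simp
    then have "d dvd s - t"
      using \<open>d dvd s + (d - t)\<close> by simp
    then show ?thesis
      using True assms(2) by (auto dest: dvd_imp_le)
  next
    case False
    then have "s + (d - t) < d" "0 < s + (d - t)"
      using assms by auto
    then show ?thesis
      using \<open>d dvd s + (d - t)\<close> by (auto dest: dvd_imp_le)
  qed
qed

lemma root_of_unity_cases:
  assumes "x ^ d = 1"
  obtains n where "n < d" "x = e ^ n"
proof -
  let ?P = "Polynomial.monom 1 d - 1 :: 'a Polynomial.poly"
  have "coeff ?P d = 1"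
    using d_gt by simp
  then have P: "?P \<noteq> 0"
    by (metis coeff_0 zero_neq_one)
  have deg: "degree ?P \<le> d"
    by (rule degree_diff_le) (simp_all add: degree_monom_le)
  let ?R = "{x. poly ?P x = 0}"
  have fin: "finite ?R"
    using P by (rule poly_roots_finite)
  have "card ?R \<le> d"
    using card_poly_roots_bound[OF P] deg by linarith
  moreover have "inj_on (\<lambda>n. e ^ n) {..<d}"
    using e_power_inj by (auto intro: inj_onI)
  then have "card ((\<lambda>n. e ^ n) ` {..<d}) = d"
    by (simp add: card_image)
  moreover have "(\<lambda>n. e ^ n) ` {..<d} \<subseteq> ?R"
    using e_power_d by (auto simp: poly_monom simp flip: power_mult) (metis mult.commute power_mult power_one)
  ultimately have "(\<lambda>n. e ^ n) ` {..<d} = ?R"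
    using fin by (metis card_seteq)
  moreover have "x \<in> ?R"
    using assms by (simp add: poly_monom)
  ultimately show ?thesis
    using that by blast
qed

text \<open>Write \<open>\<zeta> = e ^ n\<close>. The second condition says that
  \<open>gcd A d\<close> divides \<open>n\<close>, which is the solvability condition for
  \<open>A * t\<close> congruent to \<open>n\<close> modulo \<open>d\<close>.\<close>

lemma solve_power:
  assumes "\<zeta> ^ d = 1" "\<zeta> ^ (d div gcd A d) = 1"
  obtains t where "e ^ (A * t) = \<zeta>"
proof -
  obtain n where n: "\<zeta> = e ^ n"
    using root_of_unity_cases[OF assms(1)] by blast
  let ?g = "gcd A d"
  have g: "?g \<noteq> 0"
    using d_gt by simp
  have "e ^ (n * (d div ?g)) = 1"
    using assms(2) by (simp add: n power_mult)
  then have "(d div ?g) * ?g dvd (d div ?g) * n"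
    by (simp add: e_power_eq_1_iff mult.commute)
  moreover have "0 < d div ?g"
    using d_gt g by (simp add: div_greater_zero_iff gcd_le2_nat)
  ultimately have "?g dvd n"
    using nat_mult_dvd_cancel1 by blast
  then obtain t where "[A * t = n] (mod d)"
    using cong_solve_dvd_nat[of A d n] by blast
  then have "e ^ (A * t) = e ^ n"
    using e_power_mod by (metis cong_def)
  then show ?thesis
    using that n by blast
qed

lemma nth_root:
  fixes c :: 'a
  obtains b where "b ^ d = c"
proof -
  have "degree (Polynomial.monom 1 d - [:c:]) = d"
  proof (rule antisym)
    show "degree (Polynomial.monom 1 d - [:c:]) \<le> d"
      by (rule degree_diff_le) (simp_all add: degree_monom_le)
    have "coeff (Polynomial.monom 1 d - [:c:]) d = 1"
      using d_gt by (simp add: coeff_pCons split: nat.split)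
    then show "d \<le> degree (Polynomial.monom 1 d - [:c:])"
      by (intro le_degree) simp
  qed
  then obtain x where "poly (Polynomial.monom 1 d - [:c:]) x = 0"
    using alg_closed_imp_poly_has_root[of "Polynomial.monom 1 d - [:c:]"] d_gt by auto
  then show ?thesis
    using that[of x] by (simp add: poly_monom)
qed

text \<open>\<open>d div gcd a d\<close> is the additive order of \<open>a\<close> modulo
  \<open>d\<close>, so this is the first invariant monomial on the edge from \<open>x ^ d\<close> to
  \<open>z ^ d\<close>.\<close>

lemma inv_exps_edge_xz: "expo (d - d div gcd a d) 0 (d div gcd a d) \<in> inv_exps"
  by (simp add: inv_exps_def) (metis div_mult_swap dvd_triv_left gcd_dvd1 gcd_dvd2 dvd_div_mult mult.commute)

text \<open>Without \<open>x\<close> the weight is \<open>d + (a - 1) * k\<close>, so the order of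
  \<open>a - 1\<close> takes the place of that of \<open>a\<close>.\<close>

lemma inv_exps_edge_yz: "expo 0 (d - d div gcd (a - 1) d) (d div gcd (a - 1) d) \<in> inv_exps"
proof -
  let ?k = "d div gcd (a - 1) d"
  have "?k \<le> d" by simp
  then have "d - ?k + a * ?k = d + (a - 1) * ?k"
    using a_ge by (simp add: diff_mult_distrib)
  moreover have "d dvd (a - 1) * ?k"
    by (metis div_mult_swap dvd_triv_left gcd_dvd1 gcd_dvd2 dvd_div_mult mult.commute)
  ultimately show ?thesis
    by (simp add: inv_exps_def)
qed

lemma ratio_power_eq_1:
  fixes u w :: 'a
  assumes "u ^ (d - k) * w ^ k = 1" "u ^ d = 1" "k \<le> d"
  shows "(w / u) ^ k = 1"
proof -
  have "u \<noteq> 0"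
    using assms(2) d_gt by (auto simp: power_0_left)
  have "u ^ (d - k) * u ^ k = 1"
    using assms(2,3) by (simp flip: power_add)
  then have "w ^ k = u ^ k"
    using assms(1) by (metis mult.assoc mult.commute mult_1)
  then show ?thesis
    using \<open>u \<noteq> 0\<close> by (simp add: power_divide)
qed

text \<open>The ratios \<open>u i\<close> of coordinates are \<open>d\<close>-th roots of unity. If
  \<open>v 1\<close> and \<open>v 2\<close> are nonzero, \<open>u 2 / u 1\<close> determines
  \<open>t\<close> and a monomial linear in \<open>z\<close> determines \<open>u 3\<close>. On the
  lines \<open>y = 0\<close> and \<open>x = 0\<close> just one ratio has to be a power of
  \<open>e ^ a\<close> or of \<open>e ^ (a - 1)\<close>, and the edge monomials supply the
  hypothesis of \<open>solve_power\<close>.\<close>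

lemma same_orbit_normalised:
  fixes v w :: "3 \<Rightarrow> 'a"
  assumes eq: "\<And>m. m \<in> inv_exps \<Longrightarrow> monval w m = monval v m"
  obtains t b where "b \<noteq> 0" "\<And>i. w i = b * diag t i * v i"
proof -
  note finish = that
  have powers: "w i ^ d = v i ^ d" for i
  proof -
    have "evalp (var i ^ d) u = monval u (Poly_Mapping.single i d)" for u :: "3 \<Rightarrow> 'a"
      by (simp add: var_def power_single_single[unfolded One_nat_def])
    then show ?thesis
      using eq[OF single_d_in_inv_exps[of i]] by (simp add: evalp_power)
  qed
  have zero: "w i = 0 \<longleftrightarrow> v i = 0" for i
    using powers[of i] d_gt by (metis power_eq_0_iff less_nat_zero_code neq0_conv)
  \<comment> \<open>The value 1 at vanishing coordinates keeps all \<open>u i\<close> roots of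
    unity.\<close>
  define u where "u i = (if v i = 0 then 1 else w i / v i)" for i
  have wu: "w i = u i * v i" for i
    using zero by (simp add: u_def)
  have u_d: "u i ^ d = 1" for i
    using powers[of i] by (simp add: u_def power_divide)
  have u0: "u i \<noteq> 0" for i
    using u_d[of i] d_gt by (auto simp: power_0_left)
  have mon: "u 1 ^ i * u 2 ^ j * u 3 ^ k = 1" if "expo i j k \<in> inv_exps" "v 1 ^ i * v 2 ^ j * v 3 ^ k \<noteq> 0" for i j k
  proof -
    have "(u 1 ^ i * u 2 ^ j * u 3 ^ k) * (v 1 ^ i * v 2 ^ j * v 3 ^ k) = v 1 ^ i * v 2 ^ j * v 3 ^ k"
      using eq[OF that(1)] unfolding monval_expo wu by (simp add: power_mult_distrib mult_ac)
    then show ?thesis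
      using that(2) unfolding mult_cancel_right2 by blast
  qed
  have result: thesis if "b \<noteq> 0" "w 1 = b * v 1" "w 2 = b * e ^ t * v 2" "w 3 = b * e ^ (a * t) * v 3" for b t
  proof (rule finish)
    fix i show "w i = b * diag t i * v i"
      using exhaust_3[of i] that by auto
  qed (fact that(1))
  show thesis
  proof (cases "v 1 = 0")
    case v1: False
    show ?thesis
    proof (cases "v 2 = 0")
      case v2: False
      have "(u 2 / u 1) ^ d = 1"
        by (simp add: power_divide u_d)
      then obtain t where t: "e ^ t = u 2 / u 1"
        using root_of_unity_cases by metis
      have "w 3 = u 1 * e ^ (a * t) * v 3"
      proof (cases "v 3 = 0")
        case False
        \<comment> \<open>Its weight is \<open>d - a + a = d\<close>; as \<open>z\<close> occurs to
          the first power, it determines \<open>u 3\<close> and not just a power of it.\<close>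
        have "expo (a - 1) (d - a) 1 \<in> inv_exps"
          using a_ge a_less by (simp add: inv_exps_def)
        then have *: "u 1 ^ (a - 1) * u 2 ^ (d - a) * u 3 ^ 1 = 1"
          using v1 v2 False by (intro mon) simp_all
        have "u 2 ^ (d - a) * u 2 ^ a = 1"
          using a_less u_d by (simp flip: power_add)
        then have "u 1 ^ (a - 1) * u 3 = u 1 ^ (a - 1) * u 3 * (u 2 ^ (d - a) * u 2 ^ a)"
          by simp
        also have "\<dots> = (u 1 ^ (a - 1) * u 2 ^ (d - a) * u 3 ^ 1) * u 2 ^ a"
          by (simp add: mult_ac)
        finally have "u 1 ^ (a - 1) * u 3 = u 2 ^ a"
          unfolding * by simp
        moreover have "u 1 ^ a = u 1 * u 1 ^ (a - 1)"
          using a_ge by (simp flip: power_Suc)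
        ultimately have "u 3 * u 1 ^ a = u 1 * u 2 ^ a"
          by (metis mult.assoc mult.commute)
        moreover have "e ^ (a * t) = u 2 ^ a / u 1 ^ a"
          using t by (metis mult.commute power_divide power_mult)
        ultimately have "u 3 * u 1 ^ a = (u 1 * e ^ (a * t)) * u 1 ^ a"
          using u0 by simp
        then have "u 3 = u 1 * e ^ (a * t)"
          using u0 by simp
        then show ?thesis
          using wu by simp
      qed (use zero in simp)
      moreover have "w 2 = u 1 * e ^ t * v 2"
        using wu[of 2] u0 by (simp add: t)
      ultimately show ?thesis
        using result[OF u0[of 1]] wu by blast
    next
      case v2: True
      show ?thesis
      proof (cases "v 3 = 0")
        case False
        let ?k = "d div gcd a d"
        have "u 1 ^ (d - ?k) * u 2 ^ 0 * u 3 ^ ?k = 1"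
          using v1 False by (intro mon inv_exps_edge_xz) simp_all
        then have "(u 3 / u 1) ^ ?k = 1"
          using u_d by (intro ratio_power_eq_1) simp_all
        moreover have "(u 3 / u 1) ^ d = 1"
          by (simp add: power_divide u_d)
        ultimately obtain t where "e ^ (a * t) = u 3 / u 1"
          using solve_power by metis
        then have "w 3 = u 1 * e ^ (a * t) * v 3"
          using wu[of 3] u0 by simp
        then show ?thesis
          using result[OF u0[of 1], of t] wu v2 zero by simp
      next
        case True
        then show ?thesis
          using result[OF u0[of 1], of 0] wu v2 zero by simp
      qed
    qed
  next
    case v1: True
    show ?thesis
    proof (cases "v 2 = 0")
      case v2: False
      show ?thesis
      proof (cases "v 3 = 0")
        case False
        let ?k = "d div gcd (a - 1) d"
        have "u 1 ^ 0 * u 2 ^ (d - ?k) * u 3 ^ ?k = 1"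
          using v2 False by (intro mon inv_exps_edge_yz) simp_all
        then have "(u 3 / u 2) ^ ?k = 1"
          using u_d by (intro ratio_power_eq_1) simp_all
        moreover have "(u 3 / u 2) ^ d = 1"
          by (simp add: power_divide u_d)
        ultimately obtain t where t: "e ^ ((a - 1) * t) = u 3 / u 2"
          using solve_power by metis
        \<comment> \<open>With \<open>x = 0\<close> the scalar is not tied to the first coordinate;
          \<open>u 2 / e ^ t\<close> makes the second one agree, and the ratio of the last two was
          arranged through \<open>t\<close>.\<close>
        have split: "e ^ (a * t) = e ^ t * e ^ ((a - 1) * t)"
          using a_ge by (simp add: diff_mult_distrib flip: power_add)
        have "(u 2 / e ^ t) * e ^ (a * t) = u 3"
          unfolding split t using u0 by simp
        then have "w 3 = (u 2 / e ^ t) * e ^ (a * t) * v 3"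
          using wu[of 3] by simp
        moreover have "w 2 = (u 2 / e ^ t) * e ^ t * v 2"
          using wu[of 2] by simp
        ultimately show ?thesis
          using result[of "u 2 / e ^ t" t] u0 v1 zero by simp
      next
        case True
        then show ?thesis
          using result[OF u0[of 2], of 0] wu v1 zero by simp
      qed
    next
      case True
      then show ?thesis
        using result[OF u0[of 3], of 0] wu v1 zero by simp
    qed
  qed
qed

text \<open>All invariants have degree \<open>d\<close>, so dividing \<open>w\<close> by a
  \<open>d\<close>-th root of \<open>c\<close> reduces to equal values.\<close>

lemma same_orbit:
  fixes v w :: "3 \<Rightarrow> 'a"
  assumes "c \<noteq> 0" "\<And>m. m \<in> inv_exps \<Longrightarrow> monval w m = c * monval v m"
  obtains t b where "b \<noteq> 0" "w = (\<lambda>i. b * (diag t i * v i))"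
proof -
  obtain r where r: "r ^ d = c"
    using nth_root .
  have r0: "r \<noteq> 0"
    using r assms(1) d_gt by (auto simp: power_0_left)
  have eq: "monval (\<lambda>i. w i / r) m = monval v m" if "m \<in> inv_exps" for m
  proof -
    have "monval (\<lambda>i. (1 / r) * w i) m = (1 / r) ^ d * (c * monval v m)"
      unfolding monval_scale using that assms(2) by (simp add: inv_exps_def)
    then show ?thesis
      using r assms(1) by (simp add: power_divide)
  qed
  show thesis
  proof (rule same_orbit_normalised[of "\<lambda>i. w i / r" v, OF eq])
    fix t b assume tb: "b \<noteq> 0" "\<And>i. w i / r = b * diag t i * v i"
    have "w i = (r * b) * (diag t i * v i)" for i
      using tb(2)[of i] r0 by (simp add: field_simps)
    then have "w = (\<lambda>i. (r * b) * (diag t i * v i))"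
      by (rule ext)
    then show thesis
      using that[of "r * b" t] r0 tb(1) by simp
  qed
qed

section \<open>Deck transformations\<close>

text \<open>Restricted to the plane because members of \<open>Bij\<close> are extensional.\<close>

definition proj_act :: "nat \<Rightarrow> (3 \<Rightarrow> 'a) set \<Rightarrow> (3 \<Rightarrow> 'a) set" where
  "proj_act t = restrict (\<lambda>p. (\<lambda>v i. diag t i * v i) ` p) P2"

lemma diag_mult_neq_0: "v \<noteq> (\<lambda>_. 0) \<Longrightarrow> (\<lambda>i. diag t i * v i) \<noteq> (\<lambda>_. 0)"
  by (auto simp: fun_eq_iff)

lemma proj_act_point:
  assumes "v \<noteq> (\<lambda>_. 0)"
  shows "proj_act t (proj_point v) = proj_point (\<lambda>i. diag t i * v i)"
proof -
  have "(\<lambda>v i. diag t i * v i) ` proj_point v = proj_point (\<lambda>i. diag t i * v i)"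
    by (auto simp: proj_point_def image_def mult.left_commute)
  then show ?thesis
    using proj_point_in_P2[OF assms] by (simp add: proj_act_def)
qed

lemma proj_act_in_P2: "p \<in> P2 \<Longrightarrow> proj_act t p \<in> P2"
  by (elim P2_cases) (simp add: proj_act_point proj_point_in_P2 diag_mult_neq_0)

lemma proj_act_add:
  assumes "p \<in> P2"
  shows "proj_act s (proj_act t p) = proj_act (s + t) p"
proof -
  obtain v where v: "p = proj_point v" "v \<noteq> (\<lambda>_. 0)"
    using assms by (rule P2_cases)
  then show ?thesis
    by (simp add: proj_act_point diag_mult_neq_0 diag_add mult.assoc)
qed

lemma proj_act_mod: "proj_act (t mod d) = proj_act t"
  by (simp add: proj_act_def diag_mod)

lemma proj_act_multiple:
  assumes "p \<in> P2" "d dvd t"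
  shows "proj_act t p = p"
proof -
  have "proj_act t = proj_act 0"
    using proj_act_mod[of t] assms(2) by simp
  moreover have "diag 0 i = 1" for i
    by (simp add: diag_def)
  ultimately show ?thesis
    using assms(1) by (elim P2_cases) (simp add: proj_act_point)
qed

text \<open>\<open>(d - 1) * t\<close> stands for \<open>- t\<close> among natural
  exponents.\<close>

lemma proj_act_inverse:
  assumes "p \<in> P2"
  shows "proj_act ((d - 1) * t) (proj_act t p) = p" "proj_act t (proj_act ((d - 1) * t) p) = p"
proof -
  have "(d - 1) * t + t = d * t"
    using d_gt by (simp add: diff_mult_distrib)
  then show "proj_act ((d - 1) * t) (proj_act t p) = p" "proj_act t (proj_act ((d - 1) * t) p) = p"
    using proj_act_multiple[OF assms] by (simp_all add: proj_act_add[OF assms] add.commute[of t])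
qed

lemma proj_act_Bij: "proj_act t \<in> Bij P2"
proof -
  have "bij_betw (proj_act t) P2 P2"
  proof (rule bij_betw_byWitness[where f' = "proj_act ((d - 1) * t)"])
    show "\<forall>p\<in>P2. proj_act ((d - 1) * t) (proj_act t p) = p" "\<forall>p\<in>P2. proj_act t (proj_act ((d - 1) * t) p) = p"
      using proj_act_inverse by blast+
    show "proj_act t ` P2 \<subseteq> P2" "proj_act ((d - 1) * t) ` P2 \<subseteq> P2"
      using proj_act_in_P2 by blast+
  qed
  then show ?thesis
    by (simp add: Bij_def proj_act_def)
qed

lemma inv_into_proj_act:
  assumes "p \<in> P2"
  shows "inv_into P2 (proj_act t) p = proj_act ((d - 1) * t) p"
proof (rule inv_into_f_eq)
  show "inj_on (proj_act t) P2"
    using proj_act_Bij[of t] by (simp add: Bij_def bij_betw_def)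
  show "proj_act ((d - 1) * t) p \<in> P2"
    using assms by (rule proj_act_in_P2)
  show "proj_act t (proj_act ((d - 1) * t) p) = p"
    using assms by (rule proj_act_inverse)
qed

lemma regular_map_proj_act:
  assumes "\<And>p. p \<in> P2 \<Longrightarrow> f p = proj_act t p"
  shows "regular_map UNIV f"
proof (rule regular_map_global[where k = 1 and G = "\<lambda>i. const (diag t i) * var i"])
  fix v :: "3 \<Rightarrow> 'a" assume v: "v \<noteq> (\<lambda>_. 0)"
  then show "\<exists>i\<in>UNIV. evalp (const (diag t i) * var i) v \<noteq> 0"
    by (auto simp: evalp_mult fun_eq_iff)
  show "f (proj_point v) = proj_point (\<lambda>i. if i \<in> UNIV then evalp (const (diag t i) * var i) v else 0)"
    using assms[OF proj_point_in_P2[OF v]] v by (simp add: proj_act_point evalp_mult)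
qed (rule forms_const_mult[OF forms_var])

lemma proj_act_automorphism: "proj_act t \<in> automorphisms_P2"
  unfolding automorphisms_P2_def
  using proj_act_Bij regular_map_proj_act[of "proj_act t"] regular_map_proj_act[of "inv_into P2 (proj_act t)"]
    inv_into_proj_act by blast

text \<open>The first coordinate is left fixed by both powers and makes the scalar 1; the second
  then compares \<open>e ^ s\<close> with \<open>e ^ t\<close>.\<close>

lemma proj_act_inj:
  assumes "proj_act s (proj_point v) = proj_act t (proj_point v)" "v 1 \<noteq> 0" "v 2 \<noteq> 0" "s < d" "t < d"
  shows "s = t"
proof -
  have "v \<noteq> (\<lambda>_. 0)"
    using assms(2) by auto
  then obtain c where c: "(\<lambda>i. diag t i * v i) = (\<lambda>i. c * (diag s i * v i))"
    using assms(1) by (auto simp: proj_act_point proj_point_eq_iff)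
  then have "diag t 1 * v 1 = c * (diag s 1 * v 1)" "diag t 2 * v 2 = c * (diag s 2 * v 2)"
    by (rule fun_cong)+
  then have "e ^ s = e ^ t"
    using assms(2,3) by simp
  then show ?thesis
    using e_power_inj assms(4,5) by blast
qed

end

section \<open>The Galois group\<close>

text \<open>\<open>GT_system\<close> quantifies over all minimal sets of generating forms, hence an
  arbitrary \<open>S\<close>.\<close>

locale generating_forms = diagonal_action +
  fixes S :: "'a poly3 set"
  assumes S_forms: "S \<subseteq> forms d" and S_minimal: "minimal_generators I_inv S"
begin

lemma S_span: "ideal_gen S = I_inv"
  using S_minimal by (simp add: minimal_generators_def)

text \<open>Every member of \<open>S\<close> serves as a denominator in
  \<open>chart_ring\<close>.\<close>

lemma zero_notin_S: "0 \<notin> S"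
proof
  assume "0 \<in> S"
  then have "S - {0} \<subset> S"
    by blast
  have "F \<in> ideal_gen (S - {0})" if "F \<in> S" for F
    using that by (cases "F = 0") (auto intro: idl.span_zero idl.span_base)
  then have "ideal_gen S \<subseteq> ideal_gen (S - {0})"
    by (intro idl.span_minimal idl.subspace_span subsetI)
  moreover have "ideal_gen (S - {0}) \<subseteq> ideal_gen S"
    by (rule idl.span_mono) simp
  ultimately have "ideal_gen (S - {0}) = I_inv"
    using S_span by simp
  with \<open>S - {0} \<subset> S\<close> show False
    using S_minimal unfolding minimal_generators_def by blast
qed

text \<open>The passage from \<open>S\<close> to monomials: identities linear in a form can be
  checked on either set.\<close>

lemma kspan_S: "KV.span S = {F. Poly_Mapping.keys F \<subseteq> inv_exps}"
proof
  have "F \<in> {F. Poly_Mapping.keys F \<subseteq> inv_exps}" if "F \<in> S" for F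
    using that S_forms forms_in_ideal_gen_iff[OF order_refl, of F] idl.span_base[OF that] S_span by auto
  then have "S \<subseteq> KV.span (xmon ` inv_exps)"
    unfolding kspan_xmon by blast
  then have "KV.span S \<subseteq> KV.span (xmon ` inv_exps)"
    by (intro KV.span_minimal KV.subspace_span)
  then show "KV.span S \<subseteq> {F. Poly_Mapping.keys F \<subseteq> inv_exps}"
    unfolding kspan_xmon .
next
  show "{F. Poly_Mapping.keys F \<subseteq> inv_exps} \<subseteq> KV.span S"
  proof
    fix F :: "'a poly3" assume F: "F \<in> {F. Poly_Mapping.keys F \<subseteq> inv_exps}"
    then have "F \<in> forms d" "F \<in> ideal_gen S"
      using keys_subset_inv_exps_iff forms_in_ideal_gen_iff[OF order_refl, of F] S_span by auto
    then show "F \<in> KV.span S"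
      using ideal_gen_forms_kspan[OF S_forms] by blast
  qed
qed

lemma xmon_in_span: "m \<in> inv_exps \<Longrightarrow> xmon m \<in> KV.span S"
  by (simp add: kspan_S)

lemma var_power_in_span: "var i ^ d \<in> KV.span S"
  using xmon_in_span[OF single_d_in_inv_exps[of i]]
  by (simp add: var_def power_single_single[unfolded One_nat_def])

lemma evalp_span:
  assumes "\<And>F. F \<in> S \<Longrightarrow> evalp F w = c * evalp F v" "G \<in> KV.span S"
  shows "evalp G w = c * evalp G v"
proof -
  have "KV.subspace {G. evalp G w = c * evalp G v}"
    by (rule KV.subspaceI) (simp_all add: evalp_add evalp_mult algebra_simps)
  then have "KV.span S \<subseteq> {G. evalp G w = c * evalp G v}"
    using assms(1) by (intro KV.span_minimal) auto
  then show ?thesis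
    using assms(2) by blast
qed

definition coords :: "(3 \<Rightarrow> 'a) \<Rightarrow> 'a poly3 \<Rightarrow> 'a" where
  "coords v F = (if F \<in> S then evalp F v else 0)"

lemma assoc_map_point: "assoc_map S (proj_point v) = proj_point (coords v)"
proof -
  have const: "proj_point (coords w) = proj_point (coords v)" if w: "w \<in> proj_point v" for w
  proof -
    obtain c where c: "w = (\<lambda>i. c * v i)" "c \<noteq> 0"
      using w by (auto simp: proj_point_def)
    have "coords w = (\<lambda>F. c ^ d * coords v F)"
      using S_forms evalp_scale by (fastforce simp: coords_def c(1))
    then show ?thesis
      using c(2) by (simp add: proj_point_scale)
  qed
  have "assoc_map S (proj_point v) = (\<Union>w\<in>proj_point v. proj_point (coords w))"
    unfolding assoc_map_def coords_def ..
  also have "\<dots> = proj_point (coords v)"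
  proof (rule SUP_eq_const)
    show "proj_point v \<noteq> {}"
      using self_in_proj_point by blast
  qed (rule const)
  finally show ?thesis .
qed

text \<open>There are no base points: a common zero of \<open>S\<close> would be a zero of the
  \<open>d\<close>-th powers of all variables.\<close>

lemma coords_nonzero:
  assumes "v \<noteq> (\<lambda>_. 0)"
  shows "\<exists>F\<in>S. evalp F v \<noteq> 0"
proof (rule ccontr)
  assume "\<not> ?thesis"
  \<comment> \<open>Vanishing on the span, in the form that \<open>evalp_span\<close> has for the
    factor 0.\<close>
  then have "evalp G v = 0 * evalp G v" if "G \<in> KV.span S" for G
    using evalp_span[OF _ that, of v 0 v] by simp
  then have "evalp (var i ^ d) v = 0" for i
    using var_power_in_span by simp
  then show False
    using assms d_gt by (auto simp: evalp_power fun_eq_iff)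
qed

lemma regular_map_assoc: "regular_map S (assoc_map S)"
  by (rule regular_map_global[where k = d and G = "\<lambda>F. F"])
    (use S_forms coords_nonzero in \<open>auto simp: assoc_map_point coords_def[abs_def]\<close>)

lemma assoc_map_eqD:
  assumes "assoc_map S (proj_point v) = assoc_map S (proj_point w)"
  obtains t b where "b \<noteq> 0" "w = (\<lambda>i. b * (diag t i * v i))"
proof -
  obtain c where c: "c \<noteq> 0" "coords w = (\<lambda>F. c * coords v F)"
    using assms by (auto simp: assoc_map_point proj_point_eq_iff)
  have eq: "evalp F w = c * evalp F v" if "F \<in> S" for F
    using fun_cong[OF c(2), of F] that by (simp add: coords_def)
  have "monval w m = c * monval v m" if "m \<in> inv_exps" for m
    using evalp_span[OF eq xmon_in_span[OF that]] by simp
  then show thesis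
    using same_orbit[OF c(1), of w v] that by metis
qed

lemma assoc_map_proj_act:
  assumes "p \<in> P2"
  shows "assoc_map S (proj_act t p) = assoc_map S p"
proof -
  obtain v where v: "p = proj_point v" "v \<noteq> (\<lambda>_. 0)"
    using assms by (rule P2_cases)
  have "coords (\<lambda>i. diag t i * v i) = coords v"
  proof
    fix F
    have "evalp F (\<lambda>i. diag t i * v i) = evalp F v" if "F \<in> S"
    proof -
      have "Poly_Mapping.keys F \<subseteq> inv_exps"
        using KV.span_base[OF that] by (simp add: kspan_S)
      then have "monval (diag t) m = 1" if "m \<in> Poly_Mapping.keys F" for m
        using that by (auto simp: monval_diag inv_exps_def e_power_eq_1_iff[THEN iffD2])
      then have "torus (diag t) F = F"
        by (intro poly_mapping_eqI) (metis in_keys_iff lookup_torus mult.right_neutral mult_zero_left)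
      then show ?thesis
        using evalp_torus[of "diag t" F v] by simp
    qed
    then show "coords (\<lambda>i. diag t i * v i) F = coords v F"
      by (simp add: coords_def)
  qed
  then show ?thesis
    by (simp add: v proj_act_point assoc_map_point)
qed

lemma proj_act_deck: "proj_act t \<in> deck_transformations (assoc_map S)"
  using proj_act_automorphism assoc_map_proj_act by (simp add: deck_transformations_def)

lemma fibre_transitive:
  assumes "p \<in> P2" "q \<in> P2" "assoc_map S p = assoc_map S q"
  obtains t where "proj_act t p = q"
proof -
  obtain v where v: "p = proj_point v" "v \<noteq> (\<lambda>_. 0)"
    using assms(1) by (rule P2_cases)
  obtain w where w: "q = proj_point w"
    using assms(2) by (rule P2_cases)
  obtain t b where "b \<noteq> 0" "w = (\<lambda>i. b * (diag t i * v i))"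
    using assoc_map_eqD[of v w] assms(3) v(1) w by metis
  then show thesis
    using that[of t] v w by (simp add: proj_act_point proj_point_scale)
qed

lemma galois_covering_S: "galois_covering d S"
  unfolding galois_covering_def
proof (intro conjI ballI impI)
  show "regular_map S (assoc_map S)"
    by (rule regular_map_assoc)
  show "finite_onto_image d S"
    using S_forms zero_notin_S var_power_in_span d_gt by (intro finite_onto_image_if_powers) auto
  fix p q :: "(3 \<Rightarrow> 'a) set" assume "p \<in> P2" "q \<in> P2" "assoc_map S p = assoc_map S q"
  then obtain t where "proj_act t p = q"
    by (rule fibre_transitive)
  then show "\<exists>\<sigma>\<in>deck_transformations (assoc_map S). \<sigma> p = q"
    using proj_act_deck by blast
qed

text \<open>
  On the open set where a regular map is given by forms \<open>G\<^sub>i\<close>, each point is moved by some power of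
  the generator. As the plane is irreducible, one power works for all points of the open set.
\<close>

lemma deck_local:
  assumes \<sigma>: "\<sigma> \<in> deck_transformations (assoc_map S)" and p: "p \<in> P2"
  obtains t h where "t < d" "h \<noteq> 0" "\<And>v. v \<in> p \<Longrightarrow> evalp h v \<noteq> 0"
    "\<And>v. v \<noteq> (\<lambda>_. 0) \<Longrightarrow> evalp h v \<noteq> 0 \<Longrightarrow> \<sigma> (proj_point v) = proj_act t (proj_point v)"
proof -
  have "regular_map UNIV \<sigma>" and inP2: "\<And>q. q \<in> P2 \<Longrightarrow> \<sigma> q \<in> P2"
    and fib: "\<And>q. q \<in> P2 \<Longrightarrow> assoc_map S (\<sigma> q) = assoc_map S q"
    using \<sigma> by (auto simp: deck_transformations_def automorphisms_P2_def Bij_def bij_betw_def)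
  then obtain U k G where U: "zariski_open U" "p \<in> U" "\<And>i. G i \<in> forms k"
    and G: "\<And>q v. q \<in> U \<Longrightarrow> v \<in> q \<Longrightarrow> (\<exists>i. evalp (G i) v \<noteq> 0) \<and> \<sigma> q = proj_point (\<lambda>i. evalp (G i) v)"
    using p unfolding regular_map_def by simp metis
  obtain H where H: "\<And>h. h \<in> H \<Longrightarrow> \<exists>k. h \<in> forms k" "U = {p \<in> P2. \<exists>h\<in>H. \<forall>v\<in>p. evalp h v \<noteq> 0}"
    using U(1) unfolding zariski_open_def by blast
  obtain h where h: "h \<in> H" "\<And>v. v \<in> p \<Longrightarrow> evalp h v \<noteq> 0"
    using U(2) H(2) by blast
  obtain l where l: "h \<in> forms l"
    using H(1)[OF h(1)] by blast
  obtain v0 where "v0 \<in> p"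
    using p self_in_proj_point by (elim P2_cases) blast
  then have h0: "h \<noteq> 0"
    using h(2) by force
  have inU: "proj_point v \<in> U" if "v \<noteq> (\<lambda>_. 0)" "evalp h v \<noteq> 0" for v
  proof -
    have "evalp h w \<noteq> 0" if w: "w \<in> proj_point v" for w
    proof -
      obtain c where "w = (\<lambda>i. c * v i)" "c \<noteq> 0"
        using w by (auto simp: proj_point_def)
      then show ?thesis
        using evalp_scale[OF l, of c v] \<open>evalp h v \<noteq> 0\<close> by simp
    qed
    then show ?thesis
      unfolding H(2) using h(1) proj_point_in_P2[OF that(1)] by blast
  qed
  \<comment> \<open>The 2 by 2 minors of the vector of the \<open>G i\<close> and the point moved by
    \<open>diag t\<close>. They all vanish at a point exactly when the two vectors are
    proportional.\<close>
  define D where "D t i j = G i * (const (diag t j) * var j) - G j * (const (diag t i) * var i)" for t i j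
  have D: "evalp (D t i j) v = evalp (G i) v * (diag t j * v j) - evalp (G j) v * (diag t i * v i)" for t i j v
    by (simp add: D_def evalp_simps)
  \<comment> \<open>Otherwise choose a nonzero minor for each \<open>t\<close>. Their product is a
    nonzero polynomial, and at a point where it does not vanish no power of the generator could give
    \<open>\<sigma>\<close>. The factor \<open>var 1\<close> keeps that point away from the origin,
    and \<open>h\<close> keeps it in \<open>U\<close>.\<close>
  have "\<exists>t<d. \<forall>i j. D t i j = 0"
  proof (rule ccontr)
    assume "\<not> ?thesis"
    then have "\<forall>t\<in>{..<d}. \<exists>ij. D t (fst ij) (snd ij) \<noteq> 0"
      by (metis fst_conv lessThan_iff snd_conv)
    then obtain ij where ij: "\<And>t. t < d \<Longrightarrow> D t (fst (ij t)) (snd (ij t)) \<noteq> 0"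
      by (metis lessThan_iff)
    define Q where "Q = h * var 1 * (\<Prod>t<d. D t (fst (ij t)) (snd (ij t)))"
    have "var 1 \<noteq> (0 :: 'a poly3)"
      using evalp_var[of 1 "\<lambda>_. 1 :: 'a"] by force
    then have "Q \<noteq> 0"
      using h0 ij by (simp add: Q_def)
    then obtain v where v: "evalp Q v \<noteq> 0"
      by (rule ex_evalp_nonzero)
    then have hv: "evalp h v \<noteq> 0" "v 1 \<noteq> 0" "\<And>t. t < d \<Longrightarrow> evalp (D t (fst (ij t)) (snd (ij t))) v \<noteq> 0"
      by (auto simp: Q_def evalp_simps)
    have v0: "v \<noteq> (\<lambda>_. 0)"
      using hv(2) by auto
    have "\<sigma> (proj_point v) = proj_point (\<lambda>i. evalp (G i) v)"
      using G[OF inU[OF v0 hv(1)] self_in_proj_point] by blast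
    moreover have "assoc_map S (\<sigma> (proj_point v)) = assoc_map S (proj_point v)"
      using fib proj_point_in_P2[OF v0] by blast
    ultimately obtain t b where tb: "b \<noteq> 0" "(\<lambda>i. evalp (G i) v) = (\<lambda>i. b * (diag t i * v i))"
      using assoc_map_eqD[of v "\<lambda>i. evalp (G i) v"] by metis
    \<comment> \<open>The exponent supplied by the fibre lemma is not bounded by
      \<open>d\<close>.\<close>
    have "evalp (D (t mod d) i j) v = 0" for i j
      unfolding D diag_mod using fun_cong[OF tb(2), of i] fun_cong[OF tb(2), of j] by simp
    then show False
      using hv(3)[of "t mod d"] d_gt by simp
  qed
  then obtain t where t: "t < d" "\<And>i j. D t i j = 0"
    by blast
  have "\<sigma> (proj_point v) = proj_act t (proj_point v)" if v: "v \<noteq> (\<lambda>_. 0)" "evalp h v \<noteq> 0" for v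
  proof -
    let ?g = "\<lambda>i. evalp (G i) v"
    have \<sigma>v: "\<exists>i. ?g i \<noteq> 0" "\<sigma> (proj_point v) = proj_point ?g"
      using G[OF inU[OF v] self_in_proj_point] by auto
    have cross: "?g i * (diag t j * v j) = ?g j * (diag t i * v i)" for i j
      using D[of t i j v] t(2) by simp
    obtain j where j: "v j \<noteq> 0"
      using v(1) by auto
    define c where "c = ?g j / (diag t j * v j)"
    have gc: "?g = (\<lambda>i. c * (diag t i * v i))"
    proof
      fix i show "?g i = c * (diag t i * v i)"
        using cross[of i j] j by (simp add: c_def field_simps)
    qed
    have "c \<noteq> 0"
    proof
      assume "c = 0"
      then have "?g i = 0" for i
        using fun_cong[OF gc, of i] by simp
      then show False
        using \<sigma>v(1) by blast
    qed
    then show ?thesis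
      using \<sigma>v(2) gc by (simp add: proj_act_point v proj_point_scale)
  qed
  then show thesis
    using that[OF t(1) h0 h(2)] by blast
qed

text \<open>Any two nonempty open sets of the plane meet: \<open>h0 * h * var 1 * var 2\<close> is
  nonzero, so some point lies in both and has nonzero first two coordinates. There
  \<open>proj_act_inj\<close> identifies the two local exponents.\<close>

lemma deck_transformation_cases:
  assumes \<sigma>: "\<sigma> \<in> deck_transformations (assoc_map S)"
  obtains t where "t < d" "\<sigma> = proj_act t"
proof -
  have "proj_point (\<lambda>_. 1 :: 'a) \<in> P2"
    by (rule proj_point_in_P2) (simp add: fun_eq_iff)
  then obtain t0 h0 where t0: "t0 < d" "h0 \<noteq> 0"
    "\<And>v. v \<noteq> (\<lambda>_. 0) \<Longrightarrow> evalp h0 v \<noteq> 0 \<Longrightarrow> \<sigma> (proj_point v) = proj_act t0 (proj_point v)"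
    using deck_local[OF \<sigma>] by metis
  have "\<sigma> p = proj_act t0 p" if p: "p \<in> P2" for p
  proof -
    obtain t h where t: "t < d" "h \<noteq> 0" "\<And>v. v \<in> p \<Longrightarrow> evalp h v \<noteq> 0"
      "\<And>v. v \<noteq> (\<lambda>_. 0) \<Longrightarrow> evalp h v \<noteq> 0 \<Longrightarrow> \<sigma> (proj_point v) = proj_act t (proj_point v)"
      using deck_local[OF \<sigma> p] by metis
    have "var i \<noteq> (0 :: 'a poly3)" for i
      using evalp_var[of i "\<lambda>_. 1 :: 'a"] by force
    then have "h0 * h * var 1 * var 2 \<noteq> 0"
      using t0(2) t(2) by simp
    then obtain v where "evalp (h0 * h * var 1 * var 2) v \<noteq> 0"
      by (rule ex_evalp_nonzero)
    then have v: "evalp h0 v \<noteq> 0" "evalp h v \<noteq> 0" "v 1 \<noteq> 0" "v 2 \<noteq> 0"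
      by (auto simp: evalp_mult)
    then have "v \<noteq> (\<lambda>_. 0)"
      by auto
    then have "proj_act t0 (proj_point v) = proj_act t (proj_point v)"
      using t0(3) t(4) v by metis
    then have "t0 = t"
      using proj_act_inj v t0(1) t(1) by blast
    obtain w where w: "p = proj_point w" "w \<noteq> (\<lambda>_. 0)"
      using p by (rule P2_cases)
    then show ?thesis
      using t(3)[of w] t(4)[of w] self_in_proj_point \<open>t0 = t\<close> by metis
  qed
  moreover have "\<sigma> \<in> extensional P2" "proj_act t0 \<in> extensional P2"
    using \<sigma> proj_act_Bij by (auto simp: deck_transformations_def automorphisms_P2_def Bij_def)
  ultimately have "\<sigma> = proj_act t0"
    by (rule extensionalityI[rotated 2])
  then show thesis
    using that t0(1) by blast
qed

lemma deck_group_iso: "deck_group (assoc_map S) \<cong> integer_mod_group d"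
proof -
  let ?\<phi> = "\<lambda>k::int. proj_act (nat k)"
  let ?D = "deck_group (assoc_map S)"
  have carrier: "carrier (integer_mod_group d) = {0..<int d}"
    using d_gt by (simp add: carrier_integer_mod_group)
  have carrD: "carrier ?D = deck_transformations (assoc_map S)"
    by (simp add: deck_group_def)
  have mult: "proj_act s \<otimes>\<^bsub>?D\<^esub> proj_act t = proj_act (s + t)" for s t
  proof -
    have "proj_act s \<otimes>\<^bsub>?D\<^esub> proj_act t = compose P2 (proj_act s) (proj_act t)"
      using proj_act_Bij by (simp add: deck_group_def BijGroup_def)
    also have "\<dots> = proj_act (s + t)"
    proof (rule extensionalityI[of _ P2])
      show "proj_act (s + t) \<in> extensional P2"
        by (simp add: proj_act_def)
      fix p :: "(3 \<Rightarrow> 'a) set" assume "p \<in> P2"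
      then show "compose P2 (proj_act s) (proj_act t) p = proj_act (s + t) p"
        by (simp add: compose_def proj_act_add)
    qed (simp add: compose_def)
    finally show ?thesis .
  qed
  have "?\<phi> \<in> hom (integer_mod_group d) ?D"
  proof (rule homI)
    fix x y assume xy: "x \<in> carrier (integer_mod_group d)" "y \<in> carrier (integer_mod_group d)"
    then have "nat ((x + y) mod int d) = (nat x + nat y) mod d"
      by (simp add: carrier nat_mod_distrib nat_add_distrib)
    then show "?\<phi> (x \<otimes>\<^bsub>integer_mod_group d\<^esub> y) = ?\<phi> x \<otimes>\<^bsub>?D\<^esub> ?\<phi> y"
      by (simp add: mult proj_act_mod)
  qed (simp add: carrD proj_act_deck)
  moreover have "bij_betw ?\<phi> (carrier (integer_mod_group d)) (carrier ?D)"
  proof (rule bij_betw_imageI)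
    show "inj_on ?\<phi> (carrier (integer_mod_group d))"
    proof (rule inj_onI)
      fix x y assume xy: "x \<in> carrier (integer_mod_group d)" "y \<in> carrier (integer_mod_group d)" "?\<phi> x = ?\<phi> y"
      then have "nat x = nat y"
        \<comment> \<open>The point with all coordinates 1 separates the powers.\<close>
        using proj_act_inj[of "nat x" "\<lambda>_. 1" "nat y"] by (simp add: carrier nat_less_iff)
      then show "x = y"
        using xy(1,2) by (simp add: carrier eq_nat_nat_iff)
    qed
    show "?\<phi> ` carrier (integer_mod_group d) = carrier ?D"
    proof (intro equalityI subsetI)
      fix \<sigma> assume "\<sigma> \<in> carrier ?D"
      then obtain t where "t < d" "\<sigma> = proj_act t"
        using deck_transformation_cases carrD by metis
      then show "\<sigma> \<in> ?\<phi> ` carrier (integer_mod_group d)"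
        by (intro image_eqI[where x = "int t"]) (auto simp: carrier)
    qed (auto simp: carrD proj_act_deck)
  qed
  ultimately have "integer_mod_group d \<cong> ?D"
    by (auto simp: is_iso_def iso_def)
  then show ?thesis
    by (rule group.iso_sym[OF group_integer_mod_group])
qed

end

section \<open>The representation\<close>

context diagonal_action
begin

lemma rep_matrix_mult: "rep_matrix s ** rep_matrix t = rep_matrix (s + t)"
proof -
  have "(rep_matrix s ** rep_matrix t) $ i $ j = rep_matrix (s + t) $ i $ j" for i j
  proof -
    have "(\<Sum>k\<in>UNIV. rep_matrix s $ i $ k * rep_matrix t $ k $ j) =
        (\<Sum>k\<in>UNIV. if k = i then diag s i * rep_matrix t $ i $ j else 0)"
      by (rule sum.cong) (auto simp: rep_matrix_def)
    then show ?thesis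
      by (simp add: matrix_matrix_mult_def) (simp add: rep_matrix_def diag_add)
  qed
  then show ?thesis
    by (simp add: Finite_Cartesian_Product.vec_eq_iff)
qed

lemma rep_matrix_mod: "rep_matrix (t mod d) = rep_matrix t"
  unfolding rep_matrix_def diag_mod ..

lemma rep_matrix_0: "rep_matrix 0 = Finite_Cartesian_Product.mat 1"
  by (simp add: Finite_Cartesian_Product.vec_eq_iff rep_matrix_def Finite_Cartesian_Product.mat_def diag_def)

lemma rep_matrix_invertible: "invertible (rep_matrix t)"
proof -
  have "(d - 1) * t + t = d * t"
    using d_gt by (simp add: diff_mult_distrib)
  moreover have "rep_matrix (d * t) = rep_matrix 0"
    using rep_matrix_mod[of "d * t"] by simp
  ultimately show ?thesis
    unfolding invertible_def
    by (intro exI[of _ "rep_matrix ((d - 1) * t)"]) (simp add: rep_matrix_mult rep_matrix_0 add.commute[of t])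
qed

lemma diagonal_representation_rep: "diagonal_representation d (\<lambda>k. rep_matrix (nat k))"
  unfolding diagonal_representation_def
proof
  have carrier: "carrier (integer_mod_group d) = {0..<int d}"
    using d_gt by (simp add: carrier_integer_mod_group)
  show "(\<lambda>k. rep_matrix (nat k)) \<in> hom (integer_mod_group d) GL3"
  proof (rule homI)
    fix x y assume xy: "x \<in> carrier (integer_mod_group d)" "y \<in> carrier (integer_mod_group d)"
    then have "nat ((x + y) mod int d) = (nat x + nat y) mod d"
      by (simp add: carrier nat_mod_distrib nat_add_distrib)
    then show "rep_matrix (nat (x \<otimes>\<^bsub>integer_mod_group d\<^esub> y)) = rep_matrix (nat x) \<otimes>\<^bsub>GL3\<^esub> rep_matrix (nat y)"
      by (simp add: GL3_def rep_matrix_mult rep_matrix_mod)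
  qed (simp add: GL3_def rep_matrix_invertible)
  show "\<forall>k\<in>carrier (integer_mod_group d). \<forall>i j. i \<noteq> j \<longrightarrow> rep_matrix (nat k) $ i $ j = 0"
    by (simp add: rep_matrix_def)
qed

text \<open>Invariance under the generator implies invariance under all its powers.\<close>

lemma invariant_forms_rep:
  "invariant_forms d ((\<lambda>k. rep_matrix (nat k)) ` carrier (integer_mod_group d)) = invariant_forms d {M_matrix e a}"
proof -
  have "torus (diag t) F = F" if F: "torus (diag 1) F = F" for t F
  proof (induction t)
    case (Suc t)
    then show ?case
      using F torus_diag_diag[of 1 t F] by simp
  qed simp
  then have "(\<forall>M\<in>(\<lambda>k. rep_matrix (nat k)) ` carrier (integer_mod_group d). act M F = F) \<longleftrightarrow> act (rep_matrix 1) F = F" for F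
  proof (intro iffI ballI)
    have "rep_matrix (nat 1) \<in> (\<lambda>k. rep_matrix (nat k)) ` carrier (integer_mod_group d)"
      using d_gt by (intro imageI) simp
    then show "\<forall>M\<in>(\<lambda>k. rep_matrix (nat k)) ` carrier (integer_mod_group d). act M F = F \<Longrightarrow> act (rep_matrix 1) F = F"
      by (metis nat_1 One_nat_def)
  qed (auto simp: act_rep_matrix)
  then show ?thesis
    unfolding invariant_forms_def M_matrix_eq by simp
qed

lemma GT_system_I_inv: "GT_system d I_inv"
  unfolding GT_system_def
proof (intro conjI allI impI)
  show "togliatti_system d I_inv"
    by (rule togliatti_I_inv)
  have "I_inv = ideal_gen (invariant_forms d ((\<lambda>k. rep_matrix (nat k)) ` carrier (integer_mod_group d)))"
    using I_ideal_eq unfolding I_ideal_def invariant_forms_rep by simp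
  then show "\<exists>\<rho>. diagonal_representation d \<rho> \<and> I_inv = ideal_gen (invariant_forms d (\<rho> ` carrier (integer_mod_group d)))"
    using diagonal_representation_rep by blast
  fix S :: "'a poly3 set" assume S: "finite S \<and> S \<subseteq> forms d \<and> minimal_generators I_inv S"
  then interpret generating_forms d a e S
    by unfold_locales auto
  show "galois_covering d S"
    by (rule galois_covering_S)
  show "deck_group (assoc_map S) \<cong> integer_mod_group d"
    by (rule deck_group_iso)
qed

end

theorem proposition6p9:
  fixes e :: "'a::{alg_closed_field, field_char_0}"
    and p \<alpha> :: "nat \<Rightarrow> nat" and r d a :: nat
  assumes "r \<ge> 2"
    and "\<And>i. i \<in> {1..r} \<Longrightarrow> prime (p i)"
    and "strict_mono_on {1..r} p"
    and "\<And>i. i \<in> {1..r} \<Longrightarrow> \<alpha> i > 0"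
    and "d = (\<Prod>i=1..r. p i ^ \<alpha> i)"
    and "primitive_root_of_unity d e"
    and "2 \<le> a" and "a \<le> d - 1"
  shows "GT_system d (I_ideal d e a) \<and> minimal_monomial_togliatti d (I_ideal d e a) \<and>
    mu (I_ideal d e a) \<ge> d div 2 + 3"
proof -
  interpret diagonal_action d a e
    using assms by unfold_locales
  show ?thesis
    using GT_system_I_inv minimal_monomial_togliatti_I_inv mu_I_inv_ge by (simp add: I_ideal_eq)
qed

end
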